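(* Let $s\in\mathbb N$ and $\boldsymbol\gamma=(\gamma_1,\dots,\gamma_s)\in(0,\infty)^s$. (i) For $\alpha=1$: $$\mathcal H(K^{\rm kor}_{1,\boldsymbol\gamma,s})\hookrightarrow\mathcal H(K^{\rm sob}_{1,\boldsymbol\gamma,s})\leftrightharpoons\mathcal H(K^{\cos}_{1,\boldsymbol\gamma,s})\leftrightharpoons\mathcal H(K^{\rm kor+\cos}_{1,\boldsymbol\gamma,s}),$$ and none of $\mathcal H(K^{\rm sob}_{1,\boldsymbol\gamma,s})$, $\mathcal H(K^{\cos}_{1,\boldsymbol\gamma,s})$, $\mathcal H(K^{\rm kor+\cos}_{1,\boldsymbol\gamma,s})$ is a subset of $\mathcal H(K^{\rm kor}_{1,\boldsymbol\gamma,s})$. (ii) For $\alpha\in\mathbb N$, $\alpha>1$: $\mathcal H(K^{\rm kor}_{\alpha,\boldsymbol\gamma,s})\hookrightarrow\mathcal H(K^{\rm kor+\cos}_{\alpha,\boldsymbol\gamma,s})$, $\mathcal H(K^{\cos}_{\alpha,\boldsymbol\gamma,s})\hookrightarrow\mathcal H(K^{\rm kor+\cos}_{\alpha,\boldsymbol\gamma,s})$, and $\mathcal H(K^{\rm kor+\cos}_{\alpha,\boldsymbol\gamma,s})\hookrightarrow\mathcal H(K^{\rm sob}_{\alpha,\boldsymbol\gamma,s})$. (iii) For real $\alpha>1/2$: $\mathcal H(K^{\cos}_{\alpha,\boldsymbol\gamma,s})\not\subset\mathcal H(K^{\rm kor}_{\alpha,\boldsymbol\gamma,s})$ and $\mathcal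 H(K^{\rm kor+\cos}_{\alpha,\boldsymbol\gamma,s})\not\subset\mathcal H(K^{\rm kor}_{\alpha,\boldsymbol\gamma,s})$; and for $\alpha\ge3/2$: $\mathcal H(K^{\rm kor+\cos}_{\alpha,\boldsymbol\gamma,s})\not\subset\mathcal H(K^{\cos}_{\alpha,\boldsymbol\gamma,s})$ and $\mathcal H(K^{\rm kor}_{\alpha,\boldsymbol\gamma,s})\not\subset\mathcal H(K^{\cos}_{\alpha,\boldsymbol\gamma,s})$.
   Context: For $\alpha>1/2$, $\gamma>0$, $h\in\mathbb Z$: $r_{\alpha,\gamma}(0)=1$, $r_{\alpha,\gamma}(h)=\gamma|h|^{-2\alpha}$ for $h\ne0$. One-dimensional kernels on $[0,1]^2$: Korobov kernel $K^{\rm kor}_{\alpha,\gamma}(x,y)=\sum_{h\in\mathbb Z}r_{\alpha,\gamma}(h)e^{2\pi i h(x-y)}$; half-period cosine kernel $K^{\cos}_{\alpha,\gamma}(x,y)=1+\sum_{k\ge1}r_{\alpha,\gamma}(k)\sqrt2\cos(\pi kx)\sqrt2\cos(\pi ky)$; sum kernel $K^{\rm kor+\cos}_{\alpha,\gamma}=\tfrac12(K^{\rm kor}_{\alpha,\gamma}+K^{\cos}_{\alpha,\gamma})$; for $\alpha\in\mathbb N$ the unanchored Sobolev kernel $K^{\rm sob}_{\alpha,\gamma}(x,y)=1+\gamma\sum_{\tau=1}^\alpha\frac{B_\tau(x)B_\tau(y)}{(\tau!)^2}-(-1)^\alpha\gamma\frac{B_{2\alpha}(|x-y|)}{(2\alpha)!}$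 with $B_\tau$ the Bernoulli polynomials. For each type, the $s$-dimensional kernel with weights $\boldsymbol\gamma$ is the product $K_{\alpha,\boldsymbol\gamma,s}(\boldsymbol x,\boldsymbol y)=\prod_{j=1}^sK_{\alpha,\gamma_j}(x_j,y_j)$, and $\mathcal H(K)$ is the reproducing kernel Hilbert space with norm $\|\cdot\|_K$. Notation: $\mathcal H(K_1)\hookrightarrow\mathcal H(K_2)$ means $\mathcal H(K_1)\subseteq\mathcal H(K_2)$ and there is $C>0$ with $\|f\|_{K_2}\le C\|f\|_{K_1}$ for all $f\in\mathcal H(K_1)$; $\mathcal H(K_1)\leftrightharpoons\mathcal H(K_2)$ means embeddings in both directions; $\mathcal H(K_1)\not\subset\mathcal H(K_2)$ means some function of $\mathcal H(K_1)$ is not in $\mathcal H(K_2)$. *)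

theory Defs
  imports "HOL-Analysis.Analysis"
begin

text \<open>Bernoulli numbers with the convention B_1 = -1/2, defined by the standard
  recursion  sum_{k=0}^{n} (n+1 choose k) B_k = 0  for n >= 1.\<close>
function bernoulli_num :: "nat \<Rightarrow> real" where
  "bernoulli_num n = (if n = 0 then 1 else
     - (\<Sum>k<n. real (Suc n choose k) * bernoulli_num k) / real (Suc n))"
  by auto
termination by (relation "Wellfounded.measure id") auto

definition bernoulli_poly :: "nat \<Rightarrow> real \<Rightarrow> real" where
  "bernoulli_poly n x = (\<Sum>k\<le>n. real (n choose k) * bernoulli_num k * x ^ (n - k))"

definition r_coef :: "real \<Rightarrow> real \<Rightarrow> int \<Rightarrow> real" where
  "r_coef \<alpha> \<gamma> h = (if h = 0 then 1 else \<gamma> * (real_of_int \<bar>h\<bar>) powr (- 2 * \<alpha>))"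

definition K_kor :: "real \<Rightarrow> real \<Rightarrow> real \<Rightarrow> real \<Rightarrow> complex" where
  "K_kor \<alpha> \<gamma> x y =
     infsum (\<lambda>h::int. complex_of_real (r_coef \<alpha> \<gamma> h) *
                        exp (2 * complex_of_real pi * \<i> * of_int h * complex_of_real (x - y))) UNIV"

definition K_cos :: "real \<Rightarrow> real \<Rightarrow> real \<Rightarrow> real \<Rightarrow> complex" where
  "K_cos \<alpha> \<gamma> x y = 1 +
     infsum (\<lambda>k::nat. complex_of_real (r_coef \<alpha> \<gamma> (int k) *
                 (sqrt 2 * cos (pi * real k * x)) * (sqrt 2 * cos (pi * real k * y)))) {1..}"

definition K_korcos :: "real \<Rightarrow> real \<Rightarrow> real \<Rightarrow> real \<Rightarrow> complex" where
  "K_korcos \<alpha> \<gamma> x y = (K_kor \<alpha> \<gamma> x y + K_cos \<alpha> \<gamma> x y) / 2"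

definition K_sob :: "nat \<Rightarrow> real \<Rightarrow> real \<Rightarrow> real \<Rightarrow> complex" where
  "K_sob \<alpha> \<gamma> x y = complex_of_real (1
     + \<gamma> * (\<Sum>\<tau>=1..\<alpha>. bernoulli_poly \<tau> x * bernoulli_poly \<tau> y / (fact \<tau>)^2)
     - (-1) ^ \<alpha> * \<gamma> * bernoulli_poly (2 * \<alpha>) \<bar>x - y\<bar> / fact (2 * \<alpha>))"

definition unit_cube :: "nat \<Rightarrow> (nat \<Rightarrow> real) set" where
  "unit_cube s = {x. (\<forall>j<s. 0 \<le> x j \<and> x j \<le> 1) \<and> (\<forall>j\<ge>s. x j = 0)}"

definition prod_kernel ::
  "(real \<Rightarrow> real \<Rightarrow> real \<Rightarrow> complex) \<Rightarrow> nat \<Rightarrow> (nat \<Rightarrow> real)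
     \<Rightarrow> (nat \<Rightarrow> real) \<Rightarrow> (nat \<Rightarrow> real) \<Rightarrow> complex" where
  "prod_kernel k s \<gamma> x y = (\<Prod>j<s. k (\<gamma> j) (x j) (y j))"

text \<open>Finitely supported coefficient families c on X represent the functions
  sum_y c(y) K(., y) of the linear span of the kernel sections.\<close>
definition fin_coeffs :: "'x set \<Rightarrow> ('x \<Rightarrow> complex) set" where
  "fin_coeffs X = {c. finite {y. c y \<noteq> 0} \<and> {y. c y \<noteq> 0} \<subseteq> X}"

definition kspan_fun :: "('x \<Rightarrow> 'x \<Rightarrow> complex) \<Rightarrow> ('x \<Rightarrow> complex) \<Rightarrow> 'x \<Rightarrow> complex" where
  "kspan_fun K c = (\<lambda>x. \<Sum>y\<in>{y. c y \<noteq> 0}. c y * K x y)"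

definition kspan_norm :: "('x \<Rightarrow> 'x \<Rightarrow> complex) \<Rightarrow> ('x \<Rightarrow> complex) \<Rightarrow> real" where
  "kspan_norm K c = sqrt (Re (\<Sum>y\<in>{y. c y \<noteq> 0}. \<Sum>z\<in>{y. c y \<noteq> 0}. c y * cnj (c z) * K z y))"

definition rkhs_approx :: "('x \<Rightarrow> 'x \<Rightarrow> complex) \<Rightarrow> 'x set \<Rightarrow> ('x \<Rightarrow> complex)
     \<Rightarrow> (nat \<Rightarrow> 'x \<Rightarrow> complex) \<Rightarrow> bool" where
  "rkhs_approx K X f c \<longleftrightarrow>
     (\<forall>n. c n \<in> fin_coeffs X) \<and>
     (\<forall>x\<in>X. (\<lambda>n. kspan_fun K (c n) x) \<longlonglongrightarrow> f x) \<and>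
     (\<forall>e>0. \<exists>N. \<forall>m\<ge>N. \<forall>n\<ge>N. kspan_norm K (c m - c n) < e)"

text \<open>H(K): functions on X (values outside X are irrelevant) obtained as pointwise
  limits of Cauchy sequences of the span; the norm is the limit of the norms.\<close>
definition rkhs :: "('x \<Rightarrow> 'x \<Rightarrow> complex) \<Rightarrow> 'x set \<Rightarrow> ('x \<Rightarrow> complex) set" where
  "rkhs K X = {f. \<exists>c. rkhs_approx K X f c}"

definition rkhs_norm :: "('x \<Rightarrow> 'x \<Rightarrow> complex) \<Rightarrow> 'x set \<Rightarrow> ('x \<Rightarrow> complex) \<Rightarrow> real" where
  "rkhs_norm K X f =
     Inf {L. \<exists>c. rkhs_approx K X f c \<and> (\<lambda>n. kspan_norm K (c n)) \<longlonglongrightarrow> L}"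

definition rkhs_embeds ::
  "('x \<Rightarrow> 'x \<Rightarrow> complex) \<Rightarrow> ('x \<Rightarrow> 'x \<Rightarrow> complex) \<Rightarrow> 'x set \<Rightarrow> bool" where
  "rkhs_embeds K1 K2 X \<longleftrightarrow> rkhs K1 X \<subseteq> rkhs K2 X \<and>
     (\<exists>C>0. \<forall>f\<in>rkhs K1 X. rkhs_norm K2 X f \<le> C * rkhs_norm K1 X f)"

definition rkhs_equiv ::
  "('x \<Rightarrow> 'x \<Rightarrow> complex) \<Rightarrow> ('x \<Rightarrow> 'x \<Rightarrow> complex) \<Rightarrow> 'x set \<Rightarrow> bool" where
  "rkhs_equiv K1 K2 X \<longleftrightarrow> rkhs_embeds K1 K2 X \<and> rkhs_embeds K2 K1 X"

definition rkhs_not_subset ::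
  "('x \<Rightarrow> 'x \<Rightarrow> complex) \<Rightarrow> ('x \<Rightarrow> 'x \<Rightarrow> complex) \<Rightarrow> 'x set \<Rightarrow> bool" where
  "rkhs_not_subset K1 K2 X \<longleftrightarrow> (\<exists>f\<in>rkhs K1 X. f \<notin> rkhs K2 X)"

end

theory Submission
  imports Defs
begin

text \<open>
  A function \<open>f\<close> lies in \<open>H(K)\<close> with norm at most \<open>M\<close> iff \<open>\<bar>\<Sum>c(x) f(x)\<bar> \<le> M \<parallel>c\<parallel>\<^sub>K\<close> for all finite
  coefficient families \<open>c\<close>. Hence \<open>H(K\<^sub>1)\<close> embeds into \<open>H(K\<^sub>2)\<close> as soon as \<open>C K\<^sub>2 - K\<^sub>1\<close> is positive
  semidefinite for some \<open>C\<close>, and by the Schur product theorem this relation passes from the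
  one-dimensional kernels to their products.

  In one dimension the quadratic form of the Sobolev kernel is
  \<open>(c,1)\<^sup>2 + \<gamma> (\<Sum>\<tau>\<le>a. (c,B\<^sub>\<tau>/\<tau>!)\<^sup>2 + \<integral>W\<^sup>2)\<close>, where \<open>W\<close> is \<open>c\<close> applied to the periodised Bernoulli polynomial
  \<open>B\<^sub>a({x-t})/a!\<close>. The Euler-Maclaurin formula expresses \<open>c\<close> applied to a trigonometric function through
  these quantities, and Bessel's inequality for \<open>W\<close> bounds the forms of the Korobov and cosine kernels.
  For smoothness 1 Bessel's inequality is an equality, so that \<open>K\<^sup>c\<^sup>o\<^sup>s - 1 = \<pi>\<^sup>2 (K\<^sup>s\<^sup>o\<^sup>b - 1)\<close>.

  The Korobov space contains only functions with equal values at 0 and 1, which kernel sections of the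
  other spaces violate. For \<open>\<alpha> \<ge> 3/2\<close> the sine \<open>sin (2\<pi>x)\<close> is not in the cosine space: a sum of difference
  quotients at 0 over dyadic scales violates the dual bound.
\<close>

section \<open>Reproducing kernel Hilbert spaces through the dual bound\<close>

text \<open>The spaces are given as pointwise limits of Cauchy sequences and the norm as an infimum,
  so neither completeness nor an inner product on them is at hand. The dual bound avoids both:
  membership, norms and embeddings become inequalities between finite quadratic forms.

  Two one-dimensional comparisons resist the direct argument. At the frequencies
  \<open>2 * pi * k\<close> the boundary terms of the Euler-Maclaurin formula cancel; at the
  half-period frequencies \<open>pi * k\<close> they do not. They carry at least one power of the
  frequency less than the remainder, and the convergence of the sum of \<open>1 / k^2\<close> pays
  for them. In the opposite direction, from Sobolev to cosine, Bessel's inequality alone points the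
  wrong way; equality comes from comparing traces, where the Basel value \<open>pi^2 / 6\<close>
  makes the two diagonals have the same integral.

  The threshold 3/2 comes from the test functional: on the cosine of frequency \<open>k\<close> it
  is at most of order \<open>k\<close>, and one factor \<open>k\<close> is what separates the
  weights \<open>k^(-3)\<close> from the weights \<open>k^(-2)\<close> of smoothness 1, whose cosine
  series has a closed form.\<close>

definition psd_on :: "'a set \<Rightarrow> ('a \<Rightarrow> 'a \<Rightarrow> real) \<Rightarrow> bool" where
  "psd_on X k \<longleftrightarrow> (\<forall>x\<in>X. \<forall>y\<in>X. k x y = k y x) \<and>
     (\<forall>S c. finite S \<longrightarrow> S \<subseteq> X \<longrightarrow> 0 \<le> (\<Sum>x\<in>S. \<Sum>y\<in>S. c x * c y * k x y))"

lemma psd_onI: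
  assumes "\<And>x y. x \<in> X \<Longrightarrow> y \<in> X \<Longrightarrow> k x y = k y x"
    and "\<And>S c. finite S \<Longrightarrow> S \<subseteq> X \<Longrightarrow> 0 \<le> (\<Sum>x\<in>S. \<Sum>y\<in>S. c x * c y * k x y)"
  shows "psd_on X k"
  using assms by (auto simp: psd_on_def)

lemma psd_on_sym: "psd_on X k \<Longrightarrow> x \<in> X \<Longrightarrow> y \<in> X \<Longrightarrow> k x y = k y x"
  by (auto simp: psd_on_def)

lemma psd_on_ge0:
  "psd_on X k \<Longrightarrow> finite S \<Longrightarrow> S \<subseteq> X \<Longrightarrow> 0 \<le> (\<Sum>x\<in>S. \<Sum>y\<in>S. c x * c y * k x y)"
  by (auto simp: psd_on_def)

text \<open>For \<open>e > 0\<close> the minimiser \<open>t = - b / e\<close> gives the claim. For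
  \<open>e = 0\<close> the expression is affine in \<open>t\<close>, and the \<open>t\<close> chosen
  below would give it the value -1 unless \<open>b = 0\<close>.\<close>

lemma quadratic_nonneg_imp_discriminant:
  fixes a b e :: real
  assumes "\<And>t. 0 \<le> a + 2 * t * b + t\<^sup>2 * e" and "0 \<le> e"
  shows "b\<^sup>2 \<le> a * e"
proof (cases "e = 0")
  case True
  show ?thesis
  proof (rule ccontr)
    assume "\<not> ?thesis"
    hence "b \<noteq> 0" using True by auto
    have "0 \<le> a + 2 * (- (a + 1) / (2 * b)) * b" using assms(1)[of "- (a + 1) / (2 * b)"] True by simp
    thus False using \<open>b \<noteq> 0\<close> by (simp add: field_simps)
  qed
next
  case False
  hence e: "e > 0" using assms(2) by simp
  have "0 \<le> a + 2 * (- b / e) * b + (- b / e)\<^sup>2 * e" by (rule assms(1))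
  also have "\<dots> = a - b\<^sup>2 / e" using e by (simp add: field_simps power2_eq_square)
  finally show ?thesis using e by (simp add: field_simps)
qed

definition comb :: "('x \<Rightarrow> complex) \<Rightarrow> real \<Rightarrow> ('x \<Rightarrow> complex) \<Rightarrow> 'x \<Rightarrow> complex" where
  "comb c t d = (\<lambda>x. c x + of_real t * d x)"

text \<open>Real part only: coefficient families are treated as a real inner product space, and the
  imaginary part of a value is recovered by a family with coefficient \<open>\<i>\<close>.\<close>

definition pairing :: "('x \<Rightarrow> complex) \<Rightarrow> ('x \<Rightarrow> complex) \<Rightarrow> real" where
  "pairing d f = Re (\<Sum>z\<in>{z. d z \<noteq> 0}. cnj (d z) * f z)"

lemma comb_fin_coeffs:
  assumes "c \<in> fin_coeffs X" "d \<in> fin_coeffs X"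
  shows "comb c t d \<in> fin_coeffs X"
proof -
  have "{y. comb c t d y \<noteq> 0} \<subseteq> {y. c y \<noteq> 0} \<union> {y. d y \<noteq> 0}" by (auto simp: comb_def)
  thus ?thesis using assms by (auto simp: fin_coeffs_def intro: finite_subset)
qed

lemma pairing_superset:
  assumes "finite S" "{z. d z \<noteq> 0} \<subseteq> S"
  shows "pairing d f = (\<Sum>z\<in>S. Re (d z) * Re (f z) + Im (d z) * Im (f z))"
proof -
  have "(\<Sum>z\<in>{z. d z \<noteq> 0}. cnj (d z) * f z) = (\<Sum>z\<in>S. cnj (d z) * f z)"
    by (rule sum.mono_neutral_left) (use assms in auto)
  thus ?thesis by (simp add: pairing_def)
qed

lemma pairing_comb:
  assumes "c \<in> fin_coeffs X" "d \<in> fin_coeffs X"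
  shows "pairing (comb c t d) f = pairing c f + t * pairing d f"
proof -
  define S where "S = {y. c y \<noteq> 0} \<union> {y. d y \<noteq> 0}"
  have S: "finite S" "{y. c y \<noteq> 0} \<subseteq> S" "{y. d y \<noteq> 0} \<subseteq> S" "{y. comb c t d y \<noteq> 0} \<subseteq> S"
    using assms by (auto simp: S_def fin_coeffs_def comb_def)
  show ?thesis
    unfolding S(2-4)[THEN pairing_superset[OF S(1)]]
    by (simp add: comb_def sum_distrib_left algebra_simps flip: sum.distrib)
qed

locale psd_kernel =
  fixes X :: "'x set" and k :: "'x \<Rightarrow> 'x \<Rightarrow> real"
  assumes psd: "psd_on X k"
begin

abbreviation "K \<equiv> (\<lambda>x y. complex_of_real (k x y))"
abbreviation "V \<equiv> fin_coeffs X"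
abbreviation "N \<equiv> kspan_norm K"
abbreviation "fn \<equiv> kspan_fun K"

text \<open>The real inner product behind \<open>kspan_norm\<close>. The summation set is a
  parameter so that families with different supports can be compared over one common
  \<open>S\<close>.\<close>

definition sip :: "'x set \<Rightarrow> ('x \<Rightarrow> complex) \<Rightarrow> ('x \<Rightarrow> complex) \<Rightarrow> real" where
  "sip S c d = (\<Sum>y\<in>S. \<Sum>z\<in>S. (Re (c y) * Re (d z) + Im (c y) * Im (d z)) * k z y)"

text \<open>For a real symmetric kernel the form of a complex family is the sum of the forms of its
  real and imaginary parts; hence \<open>psd_on\<close> with real coefficients suffices.\<close>

lemma sip_nonneg:
  assumes "finite S" "S \<subseteq> X"
  shows "0 \<le> sip S c c"
proof -
  have "sip S c c = (\<Sum>y\<in>S. \<Sum>z\<in>S. Re (c y) * Re (c z) * k y z) + (\<Sum>y\<in>S. \<Sum>z\<in>S. Im (c y) * Im (c z) * k y z)"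
    unfolding sip_def sum.distrib[symmetric]
  proof (intro sum.cong refl)
    fix y z assume "y \<in> S" "z \<in> S"
    hence "k z y = k y z" using assms psd_on_sym[OF psd] by blast
    thus "(Re (c y) * Re (c z) + Im (c y) * Im (c z)) * k z y = Re (c y) * Re (c z) * k y z + Im (c y) * Im (c z) * k y z"
      by (simp add: algebra_simps)
  qed
  thus ?thesis
    using psd_on_ge0[OF psd assms, of "\<lambda>x. Re (c x)"] psd_on_ge0[OF psd assms, of "\<lambda>x. Im (c x)"] by linarith
qed

lemma sip_commute:
  assumes "S \<subseteq> X"
  shows "sip S c d = sip S d c"
  unfolding sip_def
proof (subst sum.swap, intro sum.cong refl)
  fix y z assume "y \<in> S" "z \<in> S"
  hence "k z y = k y z" using assms psd_on_sym[OF psd] by blast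
  thus "(Re (c z) * Re (d y) + Im (c z) * Im (d y)) * k y z = (Re (d y) * Re (c z) + Im (d y) * Im (c z)) * k z y"
    by (simp add: algebra_simps)
qed

lemma sip_comb: "sip S (comb c t e) d = sip S c d + t * sip S e d"
  by (simp add: sip_def comb_def sum_distrib_left algebra_simps flip: sum.distrib)

lemma kspan_fun_superset:
  assumes "finite S" "{z. c z \<noteq> 0} \<subseteq> S"
  shows "fn c x = (\<Sum>y\<in>S. c y * K x y)"
  unfolding kspan_fun_def by (rule sum.mono_neutral_left) (use assms in auto)

lemma pairing_kspan_fun:
  assumes "finite S" "{z. c z \<noteq> 0} \<subseteq> S" "{z. d z \<noteq> 0} \<subseteq> S"
  shows "pairing d (fn c) = sip S c d"
  unfolding pairing_superset[OF assms(1,3)] kspan_fun_superset[OF assms(1,2)] sip_def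
  by (subst sum.swap) (simp add: sum_distrib_left algebra_simps flip: sum.distrib)

lemma kspan_norm_superset:
  assumes "finite S" "{z. c z \<noteq> 0} \<subseteq> S"
  shows "N c = sqrt (sip S c c)"
proof -
  have "(\<Sum>y\<in>{y. c y \<noteq> 0}. \<Sum>z\<in>{y. c y \<noteq> 0}. c y * cnj (c z) * K z y) =
        (\<Sum>y\<in>S. \<Sum>z\<in>{y. c y \<noteq> 0}. c y * cnj (c z) * K z y)"
    by (rule sum.mono_neutral_left) (use assms in auto)
  also have "\<dots> = (\<Sum>y\<in>S. \<Sum>z\<in>S. c y * cnj (c z) * K z y)"
    by (intro sum.cong refl sum.mono_neutral_left) (use assms in auto)
  finally show ?thesis unfolding kspan_norm_def sip_def by (simp add: algebra_simps)
qed

lemma common_support: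
  assumes "c \<in> V" "d \<in> V"
  obtains S where "finite S" "S \<subseteq> X" "{z. c z \<noteq> 0} \<subseteq> S" "{z. d z \<noteq> 0} \<subseteq> S"
  using assms that[of "{z. c z \<noteq> 0} \<union> {z. d z \<noteq> 0}"] by (auto simp: fin_coeffs_def)

lemma kspan_norm_nonneg: "c \<in> V \<Longrightarrow> 0 \<le> N c"
  by (rule common_support[of c c]) (auto simp: kspan_norm_superset sip_nonneg)

lemma pairing_self: "c \<in> V \<Longrightarrow> pairing c (fn c) = (N c)\<^sup>2"
  by (rule common_support[of c c]) (auto simp: kspan_norm_superset sip_nonneg pairing_kspan_fun)

lemma kspan_norm_comb:
  assumes "c \<in> V" "d \<in> V"
  shows "(N (comb c t d))\<^sup>2 = (N c)\<^sup>2 + 2 * t * pairing d (fn c) + t\<^sup>2 * (N d)\<^sup>2"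
proof -
  obtain S where S: "finite S" "S \<subseteq> X" "{z. c z \<noteq> 0} \<subseteq> S" "{z. d z \<noteq> 0} \<subseteq> S"
    using common_support[OF assms] .
  have S': "{z. comb c t d z \<noteq> 0} \<subseteq> S" using S(3,4) by (force simp: comb_def)
  have "sip S (comb c t d) (comb c t d) = sip S c (comb c t d) + t * sip S d (comb c t d)" by (rule sip_comb)
  also have "\<dots> = sip S (comb c t d) c + t * sip S (comb c t d) d" using sip_commute[OF S(2)] by metis
  also have "\<dots> = sip S c c + t * sip S d c + t * (sip S c d + t * sip S d d)" by (simp add: sip_comb)
  also have "sip S d c = sip S c d" using sip_commute[OF S(2)] by metis
  finally have "sip S (comb c t d) (comb c t d) = sip S c c + 2 * t * sip S c d + t\<^sup>2 * sip S d d"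
    by (simp add: algebra_simps power2_eq_square)
  moreover have "(N e)\<^sup>2 = sip S e e" if "{z. e z \<noteq> 0} \<subseteq> S" for e
    using kspan_norm_superset[OF S(1) that] sip_nonneg[OF S(1,2)] by simp
  ultimately show ?thesis using S S' by (simp add: pairing_kspan_fun)
qed

lemma pairing_kspan_fun_le:
  assumes "c \<in> V" "d \<in> V"
  shows "\<bar>pairing d (fn c)\<bar> \<le> N c * N d"
proof -
  have "(pairing d (fn c))\<^sup>2 \<le> (N c)\<^sup>2 * (N d)\<^sup>2"
  proof (rule quadratic_nonneg_imp_discriminant)
    show "0 \<le> (N c)\<^sup>2 + 2 * t * pairing d (fn c) + t\<^sup>2 * (N d)\<^sup>2" for t
      unfolding kspan_norm_comb[OF assms, symmetric] by simp
  qed simp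
  hence "(pairing d (fn c))\<^sup>2 \<le> (N c * N d)\<^sup>2" by (simp add: power_mult_distrib)
  thus ?thesis using kspan_norm_nonneg assms by (simp add: abs_le_square_iff[symmetric])
qed

lemma diff_comb: "c - d = comb c (- 1) d"
  by (auto simp: comb_def)

lemma kspan_norm_diff:
  assumes "c \<in> V" "d \<in> V"
  shows "\<bar>N c - N d\<bar> \<le> N (c - d)"
proof -
  have "(N (c - d))\<^sup>2 = (N c)\<^sup>2 - 2 * pairing d (fn c) + (N d)\<^sup>2"
    unfolding diff_comb by (simp add: kspan_norm_comb[OF assms])
  also have "\<dots> \<ge> (N c - N d)\<^sup>2"
    using pairing_kspan_fun_le[OF assms] by (simp add: power2_diff)
  finally show ?thesis
    by (metis abs_le_square_iff abs_of_nonneg assms comb_fin_coeffs diff_comb kspan_norm_nonneg)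
qed

lemma approx_norm_convergent:
  assumes "rkhs_approx K X f c"
  obtains L where "(\<lambda>n. N (c n)) \<longlonglongrightarrow> L"
proof -
  have V: "c n \<in> V" for n using assms by (auto simp: rkhs_approx_def)
  have "Cauchy (\<lambda>n. N (c n))"
  proof (rule metric_CauchyI)
    fix e :: real assume "e > 0"
    then obtain M where "\<forall>m\<ge>M. \<forall>n\<ge>M. N (c m - c n) < e" using assms by (auto simp: rkhs_approx_def)
    thus "\<exists>M. \<forall>m\<ge>M. \<forall>n\<ge>M. dist (N (c m)) (N (c n)) < e"
      using kspan_norm_diff[OF V V] unfolding dist_real_def by (meson le_less_trans)
  qed
  thus ?thesis using that by (auto simp: Cauchy_convergent_iff convergent_def)
qed

lemma approx_pairing_le:
  assumes "rkhs_approx K X f c" "(\<lambda>n. N (c n)) \<longlonglongrightarrow> L" "d \<in> V"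
  shows "pairing d f \<le> L * N d"
proof -
  have V: "c n \<in> V" for n using assms by (auto simp: rkhs_approx_def)
  have "(\<lambda>n. pairing d (fn (c n))) \<longlonglongrightarrow> pairing d f"
    unfolding pairing_def
    by (intro tendsto_Re tendsto_sum tendsto_mult tendsto_const)
       (use assms in \<open>auto simp: rkhs_approx_def fin_coeffs_def\<close>)
  moreover have "(\<lambda>n. N (c n) * N d) \<longlonglongrightarrow> L * N d" by (intro tendsto_intros assms)
  moreover have "pairing d (fn (c n)) \<le> N (c n) * N d" for n
    using pairing_kspan_fun_le[OF V assms(3)] by (meson abs_le_D1)
  ultimately show ?thesis by (auto intro: LIMSEQ_le)
qed

lemma rkhs_norm_set:
  assumes "f \<in> rkhs K X"
  shows "{L. \<exists>c. rkhs_approx K X f c \<and> (\<lambda>n. kspan_norm K (c n)) \<longlonglongrightarrow> L} \<noteq> {}"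
    and "\<And>L. L \<in> {L. \<exists>c. rkhs_approx K X f c \<and> (\<lambda>n. kspan_norm K (c n)) \<longlonglongrightarrow> L} \<Longrightarrow> 0 \<le> L"
proof -
  show "{L. \<exists>c. rkhs_approx K X f c \<and> (\<lambda>n. kspan_norm K (c n)) \<longlonglongrightarrow> L} \<noteq> {}"
  proof -
    obtain c where c: "rkhs_approx K X f c" using assms by (auto simp: rkhs_def)
    then obtain L where "(\<lambda>n. N (c n)) \<longlonglongrightarrow> L" by (rule approx_norm_convergent)
    with c show ?thesis by blast
  qed
  show "0 \<le> L" if "L \<in> {L. \<exists>c. rkhs_approx K X f c \<and> (\<lambda>n. kspan_norm K (c n)) \<longlonglongrightarrow> L}" for L
    using that kspan_norm_nonneg by (auto simp: rkhs_approx_def intro!: LIMSEQ_le_const)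
qed

lemma rkhs_norm_nonneg: "f \<in> rkhs K X \<Longrightarrow> 0 \<le> rkhs_norm K X f"
  unfolding rkhs_norm_def by (intro cInf_greatest rkhs_norm_set) auto

text \<open>The bound holds with the limit \<open>L\<close> of every approximating sequence; after
  division by \<open>N d\<close> it passes to the infimum of these limits.\<close>

lemma rkhs_pairing_le:
  assumes "f \<in> rkhs K X" "d \<in> V"
  shows "pairing d f \<le> rkhs_norm K X f * N d"
proof (cases "N d = 0")
  case True
  obtain c where c: "rkhs_approx K X f c" using assms by (auto simp: rkhs_def)
  then obtain L where "(\<lambda>n. N (c n)) \<longlonglongrightarrow> L" by (rule approx_norm_convergent)
  thus ?thesis using approx_pairing_le[OF c _ assms(2)] True by auto
next
  case False
  hence pos: "N d > 0" using kspan_norm_nonneg[OF assms(2)] by simp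
  have "pairing d f / N d \<le> rkhs_norm K X f"
    unfolding rkhs_norm_def
  proof (rule cInf_greatest)
    fix L assume "L \<in> {L. \<exists>c. rkhs_approx K X f c \<and> (\<lambda>n. kspan_norm K (c n)) \<longlonglongrightarrow> L}"
    then obtain c where "rkhs_approx K X f c" "(\<lambda>n. N (c n)) \<longlonglongrightarrow> L" by auto
    thus "pairing d f / N d \<le> L" using approx_pairing_le assms(2) pos by (auto simp: field_simps)
  qed (use rkhs_norm_set[OF assms(1)] in auto)
  thus ?thesis using pos by (simp add: field_simps)
qed

text \<open>Riesz representation without completeness: a minimising sequence of
  \<open>J c = (N c)\<^sup>2 - 2 * pairing c f\<close> is Cauchy by the parallelogram law, and the
  variational inequality at the minimum forces its functions to converge to \<open>f\<close>.\<close>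

lemma rkhs_memI:
  assumes bound: "\<And>d. d \<in> V \<Longrightarrow> pairing d f \<le> M * N d" and M: "0 \<le> M"
  shows "f \<in> rkhs K X" and "rkhs_norm K X f \<le> M"
proof -
  define J where "J c = (N c)\<^sup>2 - 2 * pairing c f" for c
  define j where "j = Inf (J ` V)"
  have zero: "(\<lambda>_. 0) \<in> V" by (auto simp: fin_coeffs_def)
  \<comment> \<open>Completing the square in \<open>N c\<close> bounds \<open>J\<close> from below,
    so a minimising sequence exists.\<close>
  have "- M\<^sup>2 \<le> J c" if "c \<in> V" for c
  proof -
    have "J c \<ge> (N c)\<^sup>2 - 2 * (M * N c)" using bound[OF that] by (simp add: J_def)
    also have "(N c)\<^sup>2 - 2 * (M * N c) = (N c - M)\<^sup>2 - M\<^sup>2" by (simp add: power2_diff)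
    finally show ?thesis by (smt (verit) zero_le_power2)
  qed
  hence bdd: "bdd_below (J ` V)" by (auto intro!: bdd_belowI)
  have j_le: "j \<le> J c" if "c \<in> V" for c unfolding j_def by (rule cInf_lower) (use that bdd in auto)
  have "\<exists>c\<in>V. J c < j + 1 / real (Suc n)" for n
  proof -
    have "Inf (J ` V) < j + 1 / real (Suc n)" unfolding j_def by simp
    thus ?thesis using cInf_less_iff[of "J ` V"] bdd zero by auto
  qed
  then obtain c where cV: "\<And>n. c n \<in> V" and cJ: "\<And>n. J (c n) < j + 1 / real (Suc n)" by metis
  define \<epsilon> where "\<epsilon> n = J (c n) - j" for n
  have eps: "0 \<le> \<epsilon> n" "\<epsilon> n \<le> 1 / real (Suc n)" for n
    using j_le[OF cV[of n]] cJ[of n] by (auto simp: \<epsilon>_def)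
  have eps0: "\<epsilon> \<longlonglongrightarrow> 0"
    by (rule tendsto_sandwich[of "\<lambda>_. 0" _ _ "\<lambda>n. 1 / real (Suc n)"])
       (use eps LIMSEQ_Suc[OF lim_1_over_n] in \<open>auto\<close>)
  have Jcomb: "J (comb a t d) = J a + 2 * t * (pairing d (fn a) - pairing d f) + t\<^sup>2 * (N d)\<^sup>2"
    if "a \<in> V" "d \<in> V" for a d t
    using that by (simp add: J_def kspan_norm_comb pairing_comb algebra_simps)
  \<comment> \<open>\<open>c n\<close> minimises \<open>J\<close> up to \<open>\<epsilon> n\<close>,
    so a move along \<open>d\<close> lowers \<open>J\<close> by at most \<open>\<epsilon> n\<close>.
    The discriminant turns this into a bound on the derivative of \<open>J\<close> in direction
    \<open>d\<close>.\<close>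
  have EL: "(pairing d (fn (c n)) - pairing d f)\<^sup>2 \<le> \<epsilon> n * (N d)\<^sup>2" if "d \<in> V" for d n
  proof (rule quadratic_nonneg_imp_discriminant)
    fix t
    show "0 \<le> \<epsilon> n + 2 * t * (pairing d (fn (c n)) - pairing d f) + t\<^sup>2 * (N d)\<^sup>2"
      using j_le[OF comb_fin_coeffs[OF cV[of n] that, of t]] Jcomb[OF cV[of n] that, of t]
      by (simp add: \<epsilon>_def)
  qed simp
  have conv: "(\<lambda>n. pairing d (fn (c n))) \<longlonglongrightarrow> pairing d f" if "d \<in> V" for d
  proof -
    have "(\<lambda>n. (pairing d (fn (c n)) - pairing d f)\<^sup>2) \<longlonglongrightarrow> 0"
      by (rule tendsto_sandwich[of "\<lambda>_. 0" _ _ "\<lambda>n. \<epsilon> n * (N d)\<^sup>2"])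
         (use EL[OF that] tendsto_mult_left_zero[OF eps0] in auto)
    hence "(\<lambda>n. sqrt ((pairing d (fn (c n)) - pairing d f)\<^sup>2)) \<longlonglongrightarrow> sqrt 0"
      by (rule tendsto_real_sqrt)
    hence "(\<lambda>n. pairing d (fn (c n)) - pairing d f) \<longlonglongrightarrow> 0"
      by (simp add: tendsto_rabs_zero_iff)
    thus ?thesis by (simp add: LIM_zero_iff)
  qed
  \<comment> \<open>Comparison with the midpoint \<open>comb (c n) (1/2) e\<close> of
    \<open>c n\<close> and \<open>c m\<close>, whose \<open>J\<close> is at least
    \<open>j\<close>.\<close>
  have cauchy: "(N (c m - c n))\<^sup>2 \<le> 2 * (\<epsilon> m + \<epsilon> n)" for m n
  proof -
    define e where "e = c m - c n"
    have eV: "e \<in> V" unfolding e_def diff_comb by (intro comb_fin_coeffs cV)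
    have "comb (c n) 1 e = c m" by (auto simp: comb_def e_def)
    hence 1: "J (c m) = J (c n) + 2 * (pairing e (fn (c n)) - pairing e f) + (N e)\<^sup>2"
      using Jcomb[OF cV[of n] eV, of 1] by simp
    have "j \<le> J (c n) + (pairing e (fn (c n)) - pairing e f) + (N e)\<^sup>2 / 4"
      using Jcomb[OF cV[of n] eV, of "1/2"] j_le[OF comb_fin_coeffs[OF cV[of n] eV, of "1/2"]]
      by (simp add: power2_eq_square)
    with 1 show ?thesis unfolding \<epsilon>_def e_def[symmetric] by (simp add: field_simps)
  qed
  have approx: "rkhs_approx K X f c"
    unfolding rkhs_approx_def
  proof (intro conjI allI ballI impI)
    fix n show "c n \<in> V" by (rule cV)
  next
    fix x assume x: "x \<in> X"
    \<comment> \<open>The point masses with coefficients 1 and \<open>\<i>\<close> at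
      \<open>x\<close> read off the real and the imaginary part of the value at
      \<open>x\<close>.\<close>
    define d where "d = (\<lambda>z. if z = x then 1 else 0 :: complex)"
    define d' where "d' = (\<lambda>z. if z = x then \<i> else 0)"
    have dV: "d \<in> V" "d' \<in> V" and supp: "{z. d z \<noteq> 0} = {x}" "{z. d' z \<noteq> 0} = {x}"
      using x by (auto simp: d_def d'_def fin_coeffs_def)
    have "pairing d g = Re (g x)" "pairing d' g = Im (g x)" for g
      unfolding pairing_def supp by (simp_all add: d_def d'_def)
    with conv[OF dV(1)] conv[OF dV(2)] show "(\<lambda>n. fn (c n) x) \<longlonglongrightarrow> f x"
      by (simp add: tendsto_complex_iff)
  next
    fix e :: real assume e: "e > 0"
    have "\<forall>\<^sub>F n in sequentially. \<epsilon> n < e\<^sup>2 / 4"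
      using order_tendstoD(2)[OF eps0, of "e\<^sup>2 / 4"] e by simp
    then obtain M where M: "\<And>n. n \<ge> M \<Longrightarrow> \<epsilon> n < e\<^sup>2 / 4" by (auto simp: eventually_sequentially)
    have "N (c m - c n) < e" if "m \<ge> M" "n \<ge> M" for m n
    proof -
      have "(N (c m - c n))\<^sup>2 < e\<^sup>2" using cauchy[of m n] M[OF that(1)] M[OF that(2)] by argo
      thus ?thesis by (rule power2_less_imp_less) (use e in simp)
    qed
    thus "\<exists>M. \<forall>m\<ge>M. \<forall>n\<ge>M. N (c m - c n) < e" by blast
  qed
  thus mem: "f \<in> rkhs K X" by (auto simp: rkhs_def)
  obtain L where L: "(\<lambda>n. N (c n)) \<longlonglongrightarrow> L" using approx by (rule approx_norm_convergent)
  \<comment> \<open>\<open>EL\<close> with \<open>d = c n\<close> compares the square of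
    \<open>N (c n)\<close> with \<open>pairing (c n) f\<close>, which is at most
    \<open>M * N (c n)\<close>.\<close>
  have "N (c n) \<le> M + sqrt (\<epsilon> n)" for n
  proof (cases "N (c n) = 0")
    case True
    thus ?thesis using M eps by simp
  next
    case False
    hence pos: "N (c n) > 0" using kspan_norm_nonneg[OF cV[of n]] by simp
    have "(N (c n))\<^sup>2 - pairing (c n) f \<le> sqrt (\<epsilon> n * (N (c n))\<^sup>2)"
      using real_le_rsqrt[OF EL[OF cV[of n], of n]] by (simp add: pairing_self[OF cV])
    hence "N (c n) * N (c n) \<le> (M + sqrt (\<epsilon> n)) * N (c n)"
      using bound[OF cV[of n]] pos by (simp add: real_sqrt_mult algebra_simps power2_eq_square)
    thus ?thesis using pos by simp
  qed
  moreover have "(\<lambda>n. M + sqrt (\<epsilon> n)) \<longlonglongrightarrow> M + sqrt 0" by (intro tendsto_intros eps0)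
  ultimately have "L \<le> M" using L by (auto intro: LIMSEQ_le)
  moreover have "rkhs_norm K X f \<le> L"
    unfolding rkhs_norm_def
  proof (rule cInf_lower)
    show "bdd_below {L. \<exists>c. rkhs_approx K X f c \<and> (\<lambda>n. kspan_norm K (c n)) \<longlonglongrightarrow> L}"
      by (rule bdd_belowI) (rule rkhs_norm_set(2)[OF mem])
  qed (use approx L in auto)
  ultimately show "rkhs_norm K X f \<le> M" by simp
qed

text \<open>A constant sequence approximates a section. The functions that witness the
  non-inclusions below are obtained as such sections.\<close>

lemma section_mem_rkhs:
  assumes "y \<in> X"
  shows "(\<lambda>x. K x y) \<in> rkhs K X"
proof -
  define d where "d = (\<lambda>z. if z = y then 1 else 0 :: complex)"
  have dV: "d \<in> V" and supp: "{z. d z \<noteq> 0} = {y}" using assms by (auto simp: d_def fin_coeffs_def)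
  have "fn d x = K x y" for x unfolding kspan_fun_def supp by (simp add: d_def)
  moreover have "N (d - d) = 0" unfolding kspan_norm_def by simp
  ultimately have "rkhs_approx K X (\<lambda>x. K x y) (\<lambda>_. d)" using dV by (simp add: rkhs_approx_def)
  thus ?thesis by (auto simp: rkhs_def)
qed

text \<open>The form in which non-membership is proved: it is enough to find real functionals for
  which no single \<open>M\<close> works.\<close>

lemma rkhs_real_bound:
  assumes "f \<in> rkhs K X"
  obtains M where "\<And>S c. finite S \<Longrightarrow> S \<subseteq> X \<Longrightarrow>
    (\<Sum>x\<in>S. c x * Re (f x))\<^sup>2 \<le> M * (\<Sum>x\<in>S. \<Sum>y\<in>S. c x * c y * k x y)"
proof -
  have "(\<Sum>x\<in>S. c x * Re (f x))\<^sup>2 \<le> (rkhs_norm K X f)\<^sup>2 * (\<Sum>x\<in>S. \<Sum>y\<in>S. c x * c y * k x y)"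
    if S: "finite S" "S \<subseteq> X" for S c
  proof -
    \<comment> \<open>Both signs \<open>\<sigma>\<close> are tested, which bounds the absolute value
      of the sum.\<close>
    define d where "d \<sigma> = (\<lambda>z. if z \<in> S then complex_of_real (\<sigma> * c z) else 0)" for \<sigma>
    have supp: "{z. d \<sigma> z \<noteq> 0} \<subseteq> S" for \<sigma> by (auto simp: d_def)
    have dV: "d \<sigma> \<in> V" for \<sigma> using S supp[of \<sigma>] by (auto simp: fin_coeffs_def intro: finite_subset)
    let ?Q = "\<Sum>x\<in>S. \<Sum>y\<in>S. c x * c y * k x y"
    have "N (d \<sigma>) = sqrt ?Q" if "\<sigma>\<^sup>2 = 1" for \<sigma>
    proof -
      have "sip S (d \<sigma>) (d \<sigma>) = (\<Sum>x\<in>S. \<Sum>y\<in>S. \<sigma>\<^sup>2 * (c x * c y * k x y))"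
        unfolding sip_def
        by (intro sum.cong refl)
           (use S psd_on_sym[OF psd] in \<open>auto simp: d_def power2_eq_square algebra_simps\<close>)
      thus ?thesis using kspan_norm_superset[OF S(1) supp] that by simp
    qed
    moreover have "pairing (d \<sigma>) f = \<sigma> * (\<Sum>x\<in>S. c x * Re (f x))" for \<sigma>
      unfolding pairing_superset[OF S(1) supp] by (simp add: d_def sum_distrib_left algebra_simps)
    ultimately have "\<bar>\<Sum>x\<in>S. c x * Re (f x)\<bar> \<le> rkhs_norm K X f * sqrt ?Q"
      using rkhs_pairing_le[OF assms dV, of 1] rkhs_pairing_le[OF assms dV, of "-1"] by simp
    hence "(\<Sum>x\<in>S. c x * Re (f x))\<^sup>2 \<le> (rkhs_norm K X f * sqrt ?Q)\<^sup>2"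
      using power2_le_iff_abs_le[of "rkhs_norm K X f * sqrt ?Q"] rkhs_norm_nonneg[OF assms] psd_on_ge0[OF psd S, of c] by simp
    thus ?thesis using psd_on_ge0[OF psd S, of c] by (simp add: power_mult_distrib)
  qed
  thus ?thesis using that by blast
qed

end

text \<open>Positivity of \<open>C * k2 - k1\<close> compares the norms of coefficient families, so
  the dual bound for \<open>k1\<close> is one for \<open>k2\<close> with an extra factor
  \<open>sqrt C\<close>, which is also the embedding constant.\<close>

lemma rkhs_embeds_of_dominated:
  assumes k1: "psd_on X k1" and k2: "psd_on X k2" and C: "C > 0"
    and dom: "psd_on X (\<lambda>x y. C * k2 x y - k1 x y)"
  shows "rkhs_embeds (\<lambda>x y. complex_of_real (k1 x y)) (\<lambda>x y. complex_of_real (k2 x y)) X"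
proof -
  interpret A: psd_kernel X k1 by unfold_locales (rule k1)
  interpret B: psd_kernel X k2 by unfold_locales (rule k2)
  interpret D: psd_kernel X "\<lambda>x y. C * k2 x y - k1 x y" by unfold_locales (rule dom)
  have N: "A.N d \<le> sqrt C * B.N d" if d: "d \<in> fin_coeffs X" for d
  proof -
    obtain S where S: "finite S" "S \<subseteq> X" "{z. d z \<noteq> 0} \<subseteq> S" using A.common_support[OF d d] by metis
    have "D.sip S d d = C * B.sip S d d - A.sip S d d"
      unfolding A.sip_def B.sip_def D.sip_def
      by (simp add: sum_distrib_left sum_subtractf[symmetric] algebra_simps)
    thus ?thesis using D.sip_nonneg[OF S(1,2), of d]
      by (simp add: A.kspan_norm_superset[OF S(1,3)] B.kspan_norm_superset[OF S(1,3)] real_sqrt_mult[symmetric])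
  qed
  have *: "f \<in> rkhs B.K X \<and> rkhs_norm B.K X f \<le> sqrt C * rkhs_norm A.K X f" if f: "f \<in> rkhs A.K X" for f
  proof -
    have "pairing d f \<le> (sqrt C * rkhs_norm A.K X f) * B.N d" if "d \<in> fin_coeffs X" for d
      using A.rkhs_pairing_le[OF f that] mult_left_mono[OF N[OF that] A.rkhs_norm_nonneg[OF f]]
      by (simp add: algebra_simps)
    thus ?thesis using B.rkhs_memI[of f "sqrt C * rkhs_norm A.K X f"] A.rkhs_norm_nonneg[OF f] C by auto
  qed
  moreover have "sqrt C > 0" using C by simp
  ultimately show ?thesis unfolding rkhs_embeds_def by blast
qed

section \<open>Schur products and domination of kernels\<close>

lemma psd_on_cong:
  assumes "\<And>x y. x \<in> X \<Longrightarrow> y \<in> X \<Longrightarrow> k x y = k' x y"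
  shows "psd_on X k \<longleftrightarrow> psd_on X k'"
proof -
  have "(\<Sum>x\<in>S. \<Sum>y\<in>S. c x * c y * k x y) = (\<Sum>x\<in>S. \<Sum>y\<in>S. c x * c y * k' x y)" if "S \<subseteq> X" for S c
    by (intro sum.cong refl) (use assms that in auto)
  thus ?thesis using assms by (simp add: psd_on_def)
qed

lemma psd_on_subset: "psd_on Y k \<Longrightarrow> X \<subseteq> Y \<Longrightarrow> psd_on X k"
  unfolding psd_on_def by blast

lemma psd_on_add:
  assumes "psd_on X k" "psd_on X l"
  shows "psd_on X (\<lambda>x y. k x y + l x y)"
proof (rule psd_onI)
  fix S and c :: "'a \<Rightarrow> real" assume S: "finite S" "S \<subseteq> X"
  have "(\<Sum>x\<in>S. \<Sum>y\<in>S. c x * c y * (k x y + l x y)) =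
        (\<Sum>x\<in>S. \<Sum>y\<in>S. c x * c y * k x y) + (\<Sum>x\<in>S. \<Sum>y\<in>S. c x * c y * l x y)"
    by (simp add: algebra_simps sum.distrib)
  thus "0 \<le> (\<Sum>x\<in>S. \<Sum>y\<in>S. c x * c y * (k x y + l x y))"
    using psd_on_ge0[OF assms(1) S, of c] psd_on_ge0[OF assms(2) S, of c] by simp
qed (use assms[THEN psd_on_sym] in metis)

lemma psd_on_scale:
  assumes "psd_on X k" "0 \<le> a"
  shows "psd_on X (\<lambda>x y. a * k x y)"
proof (rule psd_onI)
  fix S and c :: "'a \<Rightarrow> real" assume S: "finite S" "S \<subseteq> X"
  have "(\<Sum>x\<in>S. \<Sum>y\<in>S. c x * c y * (a * k x y)) = a * (\<Sum>x\<in>S. \<Sum>y\<in>S. c x * c y * k x y)"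
    by (simp add: algebra_simps sum_distrib_left)
  thus "0 \<le> (\<Sum>x\<in>S. \<Sum>y\<in>S. c x * c y * (a * k x y))"
    using psd_on_ge0[OF assms(1) S, of c] assms(2) by simp
qed (use assms(1)[THEN psd_on_sym] in metis)

lemma rank1_form:
  fixes c f :: "'a \<Rightarrow> real"
  shows "(\<Sum>x\<in>S. \<Sum>y\<in>S. c x * c y * (f x * f y)) = (\<Sum>x\<in>S. c x * f x)\<^sup>2"
  by (simp add: power2_eq_square sum_product algebra_simps)

lemma psd_on_rank1: "psd_on X (\<lambda>x y. f x * f y)"
  by (rule psd_onI) (auto simp: rank1_form)

lemma psd_on_one: "psd_on X (\<lambda>x y. 1)"
  using psd_on_rank1[of X "\<lambda>_. 1"] by simp

lemma psd_on_sum: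
  assumes "\<And>i. i \<in> I \<Longrightarrow> psd_on X (k i)"
  shows "psd_on X (\<lambda>x y. \<Sum>i\<in>I. k i x y)"
  using assms
proof (induction I rule: infinite_finite_induct)
  case (insert i I)
  thus ?case using psd_on_add[of X "k i" "\<lambda>x y. \<Sum>i\<in>I. k i x y"] by simp
qed (simp_all add: psd_on_def)

text \<open>A form involves finitely many points, so pointwise convergence suffices. Through this
  lemma infinite series kernels are handled by their partial sums.\<close>

lemma psd_on_LIMSEQ:
  assumes "\<And>n. psd_on X (k n)" "\<And>x y. x \<in> X \<Longrightarrow> y \<in> X \<Longrightarrow> (\<lambda>n. k n x y) \<longlonglongrightarrow> l x y"
  shows "psd_on X l"
proof (rule psd_onI)
  fix x y assume xy: "x \<in> X" "y \<in> X"
  have "(\<lambda>n. k n x y) = (\<lambda>n. k n y x)" using xy assms(1)[THEN psd_on_sym] by blast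
  thus "l x y = l y x" using assms(2)[OF xy] assms(2)[OF xy(2,1)] LIMSEQ_unique by metis
next
  fix S and c :: "'a \<Rightarrow> real" assume S: "finite S" "S \<subseteq> X"
  have "(\<lambda>n. \<Sum>x\<in>S. \<Sum>y\<in>S. c x * c y * k n x y) \<longlonglongrightarrow> (\<Sum>x\<in>S. \<Sum>y\<in>S. c x * c y * l x y)"
    by (intro tendsto_sum tendsto_mult tendsto_const assms(2)) (use S in auto)
  thus "0 \<le> (\<Sum>x\<in>S. \<Sum>y\<in>S. c x * c y * l x y)"
    by (rule LIMSEQ_le_const) (use psd_on_ge0[OF assms(1) S] in auto)
qed

lemma psd_on_pullback:
  assumes "psd_on Y k" "g ` X \<subseteq> Y"
  shows "psd_on X (\<lambda>x y. k (g x) (g y))"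
proof (rule psd_onI)
  fix S and c :: "'b \<Rightarrow> real" assume S: "finite S" "S \<subseteq> X"
  \<comment> \<open>\<open>g\<close> may identify points, as coordinate projections do, so the
    coefficients over each fibre are added up.\<close>
  define C where "C u = (\<Sum>x | x \<in> S \<and> g x = u. c x)" for u
  have "(\<Sum>x\<in>S. c x * h (g x)) = (\<Sum>u\<in>g ` S. C u * h u)" for h
    unfolding C_def by (subst sum.image_gen[OF S(1), of _ g]) (simp add: sum_distrib_right)
  hence "(\<Sum>x\<in>S. c x * (\<Sum>y\<in>S. c y * k (g x) (g y))) = (\<Sum>u\<in>g ` S. C u * (\<Sum>v\<in>g ` S. C v * k u v))"
    by simp
  hence "(\<Sum>x\<in>S. \<Sum>y\<in>S. c x * c y * k (g x) (g y)) = (\<Sum>u\<in>g ` S. \<Sum>v\<in>g ` S. C u * C v * k u v)"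
    by (simp add: sum_distrib_left algebra_simps)
  thus "0 \<le> (\<Sum>x\<in>S. \<Sum>y\<in>S. c x * c y * k (g x) (g y))"
    using psd_on_ge0[OF assms(1), of "g ` S" C] S assms(2) by auto
qed (use psd_on_sym[OF assms(1)] assms(2) in blast)

text \<open>Along \<open>c + t * \<delta>\<close>, with \<open>\<delta>\<close> the point mass at
  \<open>a\<close>, the form is a nonnegative quadratic in \<open>t\<close>; its discriminant gives
  the claim.\<close>

lemma psd_on_Cauchy_Schwarz:
  assumes k: "psd_on X k" and S: "finite S" "S \<subseteq> X" and a: "a \<in> S"
  shows "(\<Sum>x\<in>S. c x * k x a)\<^sup>2 \<le> (\<Sum>x\<in>S. \<Sum>y\<in>S. c x * c y * k x y) * k a a"
proof (rule quadratic_nonneg_imp_discriminant)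
  define \<delta> where "\<delta> = (\<lambda>x. if x = a then 1 else 0 :: real)"
  have d: "(\<Sum>x\<in>S. \<delta> x * h x) = h a" for h
    using S a by (simp add: \<delta>_def of_bool_def if_distrib[of "\<lambda>u. u * _"] cong: if_cong)
  show "0 \<le> k a a"
    using psd_on_ge0[OF k, of "{a}" "\<lambda>_. 1"] a S by auto
  fix t :: real
  have "0 \<le> (\<Sum>x\<in>S. \<Sum>y\<in>S. (c x + t * \<delta> x) * (c y + t * \<delta> y) * k x y)"
    by (rule psd_on_ge0[OF k S])
  also have "\<dots> = (\<Sum>x\<in>S. \<Sum>y\<in>S. c x * c y * k x y) + t * (\<Sum>x\<in>S. c x * (\<Sum>y\<in>S. \<delta> y * k x y))
      + t * (\<Sum>x\<in>S. \<delta> x * (\<Sum>y\<in>S. c y * k x y)) + t\<^sup>2 * (\<Sum>x\<in>S. \<delta> x * (\<Sum>y\<in>S. \<delta> y * k x y))"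
    by (simp add: algebra_simps sum.distrib sum_distrib_left power2_eq_square)
  also have "(\<Sum>x\<in>S. \<delta> x * (\<Sum>y\<in>S. c y * k x y)) = (\<Sum>x\<in>S. c x * k x a)"
    unfolding d by (intro sum.cong refl) (use a S psd_on_sym[OF k, of a] in auto)
  finally show "0 \<le> (\<Sum>x\<in>S. \<Sum>y\<in>S. c x * c y * k x y) + 2 * t * (\<Sum>x\<in>S. c x * k x a) + t\<^sup>2 * k a a"
    unfolding d by simp
qed

text \<open>The Schur product theorem, by pivoting: subtracting the rank one kernel
  \<open>k x a * k a y / k a a\<close> leaves a positive semidefinite kernel that vanishes on the row \<open>a\<close>.
  If \<open>k a a = 0\<close> that kernel is 0 because of division by zero, and the row already vanishes.\<close>

lemma schur_product_finite:
  assumes "finite S" "psd_on S k" "psd_on S l"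
  shows "0 \<le> (\<Sum>x\<in>S. \<Sum>y\<in>S. c x * c y * (k x y * l x y))"
  using assms
proof (induction S arbitrary: k rule: finite_induct)
  case (insert a S)
  let ?T = "insert a S"
  have T: "finite ?T" using insert by simp
  define k' where "k' x y = k x y - k x a * k y a / k a a" for x y
  have CS: "(\<Sum>x\<in>?T. e x * k x a)\<^sup>2 \<le> (\<Sum>x\<in>?T. \<Sum>y\<in>?T. e x * e y * k x y) * k a a" for e
    by (rule psd_on_Cauchy_Schwarz[OF insert.prems(1) T]) auto
  have ka: "0 \<le> k a a" using psd_on_ge0[OF insert.prems(1), of "{a}" "\<lambda>_. 1"] by simp
  have row: "k x a = 0" if "k a a = 0" "x \<in> ?T" for x
  proof -
    have "(\<Sum>y\<in>?T. (if y = x then 1 else 0) * k y a)\<^sup>2 \<le> 0"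
      using CS[of "\<lambda>y. if y = x then 1 else 0"] that(1) by simp
    moreover have "(\<Sum>y\<in>?T. (if y = x then 1 else 0) * k y a) = k x a"
      using T that(2) by (simp add: if_distrib[of "\<lambda>u. u * _"] cong: if_cong)
    ultimately show ?thesis by simp
  qed
  have k'a: "k' x a = 0" "k' a x = 0" if "x \<in> ?T" for x
    using row[OF _ that] psd_on_sym[OF insert.prems(1), of a x] that
    by (cases "k a a = 0"; simp add: k'_def)+
  have k': "psd_on ?T k'"
  proof (rule psd_onI)
    fix U and e :: "'a \<Rightarrow> real" assume U: "finite U" "U \<subseteq> ?T"
    \<comment> \<open>Coefficients are extended by zero because \<open>CS\<close> is stated for the
      full set \<open>?T\<close>.\<close>
    define e' where "e' x = (if x \<in> U then e x else 0)" for x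
    have "(\<Sum>x\<in>U. \<Sum>y\<in>U. e x * e y * k' x y) = (\<Sum>x\<in>?T. \<Sum>y\<in>?T. e' x * e' y * k' x y)"
    proof -
      have "(\<Sum>x\<in>U. \<Sum>y\<in>U. e x * e y * k' x y) = (\<Sum>x\<in>U. \<Sum>y\<in>?T. e' x * e' y * k' x y)"
        by (intro sum.cong refl sum.mono_neutral_cong_left) (use T U in \<open>auto simp: e'_def\<close>)
      also have "\<dots> = (\<Sum>x\<in>?T. \<Sum>y\<in>?T. e' x * e' y * k' x y)"
        by (intro sum.mono_neutral_left) (use T U in \<open>auto simp: e'_def\<close>)
      finally show ?thesis .
    qed
    also have "\<dots> = (\<Sum>x\<in>?T. \<Sum>y\<in>?T. e' x * e' y * k x y) - (\<Sum>x\<in>?T. \<Sum>y\<in>?T. e' x * e' y * (k x a * k y a)) / k a a"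
      unfolding k'_def right_diff_distrib sum_subtractf sum_divide_distrib times_divide_eq_right ..
    also have "\<dots> = (\<Sum>x\<in>?T. \<Sum>y\<in>?T. e' x * e' y * k x y) - (\<Sum>x\<in>?T. e' x * k x a)\<^sup>2 / k a a"
      unfolding rank1_form ..
    also have "\<dots> \<ge> 0"
    proof (cases "k a a = 0")
      case True
      thus ?thesis using psd_on_ge0[OF insert.prems(1) T, of e'] by simp
    next
      case False
      thus ?thesis using CS[of e'] ka by (simp only: diff_ge_0_iff_ge) (simp add: divide_le_eq)
    qed
    finally show "0 \<le> (\<Sum>x\<in>U. \<Sum>y\<in>U. e x * e y * k' x y)" .
  next
    fix x y assume "x \<in> ?T" "y \<in> ?T"
    hence "k x y = k y x" by (rule psd_on_sym[OF insert.prems(1)])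
    thus "k' x y = k' y x" unfolding k'_def by (simp add: mult.commute)
  qed
  \<comment> \<open>The induction hypothesis covers \<open>S\<close>; since the row and column of
    \<open>a\<close> in \<open>k'\<close> vanish, the sum over \<open>?T\<close> is the
    same.\<close>
  have "0 \<le> (\<Sum>x\<in>S. \<Sum>y\<in>S. c x * c y * (k' x y * l x y))"
    by (rule insert.IH) (use k' insert.prems psd_on_subset in blast)+
  also have "\<dots> = (\<Sum>x\<in>?T. \<Sum>y\<in>?T. c x * c y * (k' x y * l x y))"
    using insert.hyps by (simp add: k'a)
  finally have 1: "0 \<le> (\<Sum>x\<in>?T. \<Sum>y\<in>?T. c x * c y * (k' x y * l x y))" .
  \<comment> \<open>The removed rank one kernel times \<open>l\<close> is the form of
    \<open>l\<close> with coefficients \<open>c x * k x a\<close>.\<close>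
  have "0 \<le> (\<Sum>x\<in>?T. \<Sum>y\<in>?T. (c x * k x a) * (c y * k y a) * l x y)"
    by (rule psd_on_ge0[OF insert.prems(2) T]) auto
  hence 2: "0 \<le> (\<Sum>x\<in>?T. \<Sum>y\<in>?T. (c x * k x a) * (c y * k y a) * l x y) / k a a"
    using ka by simp
  have "(\<Sum>x\<in>?T. \<Sum>y\<in>?T. c x * c y * (k x y * l x y)) =
      (\<Sum>x\<in>?T. \<Sum>y\<in>?T. c x * c y * (k' x y * l x y)) + (\<Sum>x\<in>?T. \<Sum>y\<in>?T. (c x * k x a) * (c y * k y a) * l x y) / k a a"
    unfolding k'_def sum_divide_distrib sum.distrib[symmetric]
    by (intro sum.cong refl) (simp add: algebra_simps)
  with 1 2 show ?case by linarith
qed simp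

lemma psd_on_mult:
  assumes "psd_on X k" "psd_on X l"
  shows "psd_on X (\<lambda>x y. k x y * l x y)"
proof (rule psd_onI)
  fix x y assume "x \<in> X" "y \<in> X"
  thus "k x y * l x y = k y x * l y x" using assms[THEN psd_on_sym, of x y] by simp
next
  fix S and c :: "'a \<Rightarrow> real" assume "finite S" "S \<subseteq> X"
  thus "0 \<le> (\<Sum>x\<in>S. \<Sum>y\<in>S. c x * c y * (k x y * l x y))"
    by (intro schur_product_finite assms[THEN psd_on_subset])
qed

section \<open>Domination of kernels up to a constant\<close>

definition dominated_on :: "'a set \<Rightarrow> ('a \<Rightarrow> 'a \<Rightarrow> real) \<Rightarrow> ('a \<Rightarrow> 'a \<Rightarrow> real) \<Rightarrow> bool" where
  "dominated_on X k l \<longleftrightarrow> psd_on X k \<and> psd_on X l \<and> (\<exists>C>0. psd_on X (\<lambda>x y. C * l x y - k x y))"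

lemma dominated_onI:
  assumes "psd_on X k" "psd_on X l" "C > 0" "psd_on X (\<lambda>x y. C * l x y - k x y)"
  shows "dominated_on X k l"
  using assms by (auto simp: dominated_on_def)

lemma dominated_on_trans:
  assumes "dominated_on X k l" "dominated_on X l m"
  shows "dominated_on X k m"
proof -
  obtain C D where C: "C > 0" "psd_on X (\<lambda>x y. C * l x y - k x y)"
    and D: "D > 0" "psd_on X (\<lambda>x y. D * m x y - l x y)"
    using assms by (auto simp: dominated_on_def)
  have "psd_on X (\<lambda>x y. (C * l x y - k x y) + C * (D * m x y - l x y))"
    using C D by (intro psd_on_add psd_on_scale) auto
  hence "psd_on X (\<lambda>x y. (C * D) * m x y - k x y)" by (simp add: algebra_simps)
  thus ?thesis using assms C D by (auto simp: dominated_on_def intro!: exI[of _ "C * D"])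
qed

lemma dominated_on_pullback:
  assumes "dominated_on Y k l" "g ` X \<subseteq> Y"
  shows "dominated_on X (\<lambda>x y. k (g x) (g y)) (\<lambda>x y. l (g x) (g y))"
proof -
  obtain C where "C > 0" "psd_on Y (\<lambda>x y. C * l x y - k x y)" using assms by (auto simp: dominated_on_def)
  thus ?thesis using assms(1) psd_on_pullback[OF _ assms(2)]
    by (intro dominated_onI[of _ _ _ C]) (auto simp: dominated_on_def)
qed

text \<open>The difference telescopes into \<open>(C l - k) (D l')\<close> plus
  \<open>k (D l' - k')\<close>, both Schur products of positive semidefinite kernels. Positivity of
  \<open>k\<close> and \<open>l'\<close> is used here, which is why \<open>dominated_on\<close>
  carries it along.\<close>

lemma dominated_on_mult:
  assumes "dominated_on X k l" "dominated_on X k' l'"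
  shows "dominated_on X (\<lambda>x y. k x y * k' x y) (\<lambda>x y. l x y * l' x y)"
proof -
  obtain C D where C: "C > 0" "psd_on X (\<lambda>x y. C * l x y - k x y)"
    and D: "D > 0" "psd_on X (\<lambda>x y. D * l' x y - k' x y)"
    using assms by (auto simp: dominated_on_def)
  have p: "psd_on X k" "psd_on X l" "psd_on X k'" "psd_on X l'" using assms by (auto simp: dominated_on_def)
  have "psd_on X (\<lambda>x y. (C * l x y - k x y) * (D * l' x y) + k x y * (D * l' x y - k' x y))"
    using C D p by (intro psd_on_add psd_on_mult psd_on_scale) auto
  hence "psd_on X (\<lambda>x y. (C * D) * (l x y * l' x y) - k x y * k' x y)" by (simp add: algebra_simps)
  thus ?thesis using C D p by (intro dominated_onI[of _ _ _ "C * D"] psd_on_mult) auto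
qed

lemma dominated_on_refl: "psd_on X k \<Longrightarrow> dominated_on X k k"
  by (rule dominated_onI[of _ _ _ 2]) auto

lemma dominated_on_prod:
  assumes "\<And>j. j < (s::nat) \<Longrightarrow> dominated_on X (k j) (l j)"
  shows "dominated_on X (\<lambda>x y. \<Prod>j<s. k j x y) (\<lambda>x y. \<Prod>j<s. l j x y)"
  using assms
proof (induction s)
  case 0
  thus ?case using dominated_on_refl[OF psd_on_one] by simp
next
  case (Suc s)
  thus ?case using dominated_on_mult[of X "\<lambda>x y. \<Prod>j<s. k j x y" "\<lambda>x y. \<Prod>j<s. l j x y" "k s" "l s"] by simp
qed

text \<open>Each factor sees one coordinate and is pulled back along that projection; the constants
  of the factors multiply.\<close>

lemma dominated_on_cube:
  assumes "\<And>j. j < s \<Longrightarrow> dominated_on {0..1} (k j) (l j)"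
  shows "dominated_on (unit_cube s) (\<lambda>x y. \<Prod>j<s. k j (x j) (y j)) (\<lambda>x y. \<Prod>j<s. l j (x j) (y j))"
  by (rule dominated_on_prod, rule dominated_on_pullback, rule assms) (auto simp: unit_cube_def)

lemma rkhs_embeds_of_dominated_on:
  assumes "dominated_on X k l"
  shows "rkhs_embeds (\<lambda>x y. complex_of_real (k x y)) (\<lambda>x y. complex_of_real (l x y)) X"
  using assms rkhs_embeds_of_dominated unfolding dominated_on_def by blast

section \<open>Bernoulli polynomials and the Euler-Maclaurin formula\<close>

declare bernoulli_num.simps [simp del]

text \<open>With the factorial divided out, the derivative of \<open>\<beta> (Suc n)\<close> is
  \<open>\<beta> n\<close>, so repeated integration by parts produces no numerical factors.\<close>

definition \<beta> :: "nat \<Rightarrow> real \<Rightarrow> real" where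
  "\<beta> n x = bernoulli_poly n x / fact n"

lemma \<beta>_altdef: "\<beta> n x = (\<Sum>k\<le>n. bernoulli_num k / fact k * (x ^ (n - k) / fact (n - k)))"
  unfolding \<beta>_def bernoulli_poly_def sum_divide_distrib
  by (intro sum.cong refl) (simp add: binomial_fact field_simps)

lemma \<beta>_0 [simp]: "\<beta> 0 x = 1"
  by (simp add: \<beta>_altdef bernoulli_num.simps[of 0])

lemma bernoulli_num_1: "bernoulli_num 1 = - 1 / 2"
  by (simp add: bernoulli_num.simps[of "Suc 0"] bernoulli_num.simps[of 0])

lemma bernoulli_num_2: "bernoulli_num 2 = 1 / 6"
proof -
  have "bernoulli_num 2 = - (\<Sum>k<2. real (Suc 2 choose k) * bernoulli_num k) / real (Suc 2)"
    by (subst bernoulli_num.simps) simp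
  also have "{..<2::nat} = {0, 1}" by auto
  also have "- (\<Sum>k\<in>{0, 1}. real (Suc 2 choose k) * bernoulli_num k) / real (Suc 2) = 1 / 6"
    using bernoulli_num_1 by (simp add: bernoulli_num.simps[of 0])
  finally show ?thesis .
qed

lemma \<beta>_1: "\<beta> (Suc 0) x = x - 1 / 2"
  using bernoulli_num_1 by (simp add: \<beta>_altdef bernoulli_num.simps[of 0])

lemma \<beta>_2: "\<beta> 2 x = x\<^sup>2 / 2 - x / 2 + 1 / 12"
  using bernoulli_num_1 bernoulli_num_2
  by (simp add: \<beta>_altdef numeral_2_eq_2 atMost_Suc bernoulli_num.simps[of 0])

lemma \<beta>_deriv [derivative_intros]:
  assumes "(g has_real_derivative g') (at t within A)"
  shows "((\<lambda>t. \<beta> (Suc n) (g t)) has_real_derivative \<beta> n (g t) * g') (at t within A)"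
proof -
  have "((\<lambda>x. \<Sum>k\<le>n. bernoulli_num k / fact k * (x ^ (Suc n - k) / fact (Suc n - k))) has_real_derivative \<beta> n (g t)) (at (g t))"
    unfolding \<beta>_altdef
  proof (rule DERIV_sum)
    fix k assume "k \<in> {..n}"
    hence k: "Suc n - k = Suc (n - k)" by auto
    have "((\<lambda>x. bernoulli_num k / fact k * (x ^ Suc (n - k) / fact (Suc (n - k)))) has_real_derivative
      bernoulli_num k / fact k * ((1 + real (n - k)) * (g t) ^ (n - k) / fact (Suc (n - k)))) (at (g t))"
      using DERIV_pow[of "Suc (n - k)" "g t" UNIV] by (intro DERIV_cmult DERIV_cdivide) simp
    also have "(1 + real (n - k)) * (g t) ^ (n - k) / fact (Suc (n - k)) = (g t) ^ (n - k) / fact (n - k)"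
      by (simp add: divide_simps)
    finally show "((\<lambda>x. bernoulli_num k / fact k * (x ^ (Suc n - k) / fact (Suc n - k))) has_real_derivative
      bernoulli_num k / fact k * ((g t) ^ (n - k) / fact (n - k))) (at (g t))" unfolding k .
  qed
  hence "((\<lambda>x. (\<Sum>k\<le>n. bernoulli_num k / fact k * (x ^ (Suc n - k) / fact (Suc n - k))) + bernoulli_num (Suc n) / fact (Suc n))
     has_real_derivative \<beta> n (g t) + 0) (at (g t))"
    by (intro DERIV_add DERIV_const)
  hence "(\<beta> (Suc n) has_real_derivative \<beta> n (g t)) (at (g t))"
    by (simp add: \<beta>_altdef[abs_def])
  thus ?thesis using assms by (rule DERIV_chain2)
qed

lemma \<beta>_continuous: "continuous_on A (\<beta> n)"
  unfolding \<beta>_altdef[abs_def] by (intro continuous_intros) auto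

lemma \<beta>_continuous_intro [continuous_intros]:
  "continuous_on A g \<Longrightarrow> continuous_on A (\<lambda>t. \<beta> n (g t))"
  using continuous_on_compose2[OF \<beta>_continuous[of UNIV n], of A g] by auto

text \<open>The recursion of the Bernoulli numbers says that this difference vanishes. For
  \<open>n = 1\<close> the end values differ by 1, and that jump is what later produces point
  evaluations.\<close>

lemma \<beta>_endpoints:
  assumes "2 \<le> n"
  shows "\<beta> n 1 = \<beta> n 0"
proof -
  obtain m where n: "n = Suc m" "m \<ge> 1" using assms by (cases n) auto
  have rec: "real (Suc m) * bernoulli_num m = - (\<Sum>k<m. real (Suc m choose k) * bernoulli_num k)"
    using n(2) by (subst bernoulli_num.simps) (simp add: field_simps)
  have "(\<Sum>k\<le>m. real (Suc m choose k) * bernoulli_num k) = 0"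
    using rec by (simp add: lessThan_Suc_atMost[symmetric])
  hence "bernoulli_poly n 1 = bernoulli_num n"
    by (simp add: bernoulli_poly_def n)
  moreover have "bernoulli_poly n 0 = (\<Sum>k\<le>n. if k = n then bernoulli_num n else 0)"
    unfolding bernoulli_poly_def by (intro sum.cong refl) (auto simp: power_0_left)
  ultimately show ?thesis by (simp add: \<beta>_def)
qed

section \<open>Integration on the unit interval and periodised Bernoulli functions\<close>

abbreviation U :: "real measure" where "U \<equiv> restrict_space lborel {0..1}"

interpretation U: finite_measure U
  by (rule finite_measureI) (simp add: emeasure_restrict_space)

text \<open>An algebra of integrable functions on a finite measure space: integrability reduces to
  closure rules. Continuity would be too strong, since \<open>pbern 1 x\<close> can jump.\<close>

definition bdd_meas :: "(real \<Rightarrow> real) \<Rightarrow> bool" where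
  "bdd_meas f \<longleftrightarrow> f \<in> borel_measurable U \<and> (\<exists>B. \<forall>t\<in>{0..1}. \<bar>f t\<bar> \<le> B)"

lemma bdd_meas_integrable:
  assumes "bdd_meas f"
  shows "integrable U f"
proof -
  obtain B where "\<forall>t\<in>{0..1}. \<bar>f t\<bar> \<le> B" using assms by (auto simp: bdd_meas_def)
  thus ?thesis using assms
    by (intro U.integrable_const_bound[of _ B]) (auto simp: bdd_meas_def space_restrict_space intro!: AE_I2)
qed

lemma bdd_meas_const: "bdd_meas (\<lambda>_. c)"
  by (auto simp: bdd_meas_def)

lemma bdd_meas_add:
  assumes "bdd_meas f" "bdd_meas g"
  shows "bdd_meas (\<lambda>t. f t + g t)"
proof -
  obtain B C where "\<forall>t\<in>{0..1}. \<bar>f t\<bar> \<le> B" "\<forall>t\<in>{0..1}. \<bar>g t\<bar> \<le> C" using assms by (auto simp: bdd_meas_def)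
  hence "\<forall>t\<in>{0..1}. \<bar>f t + g t\<bar> \<le> B + C" by (smt (verit))
  thus ?thesis using assms by (auto simp: bdd_meas_def intro!: borel_measurable_add)
qed

lemma bdd_meas_mult:
  assumes "bdd_meas f" "bdd_meas g"
  shows "bdd_meas (\<lambda>t. f t * g t)"
proof -
  obtain B C where "\<forall>t\<in>{0..1}. \<bar>f t\<bar> \<le> B" "\<forall>t\<in>{0..1}. \<bar>g t\<bar> \<le> C" using assms by (auto simp: bdd_meas_def)
  hence "\<forall>t\<in>{0..1}. \<bar>f t * g t\<bar> \<le> B * C" unfolding abs_mult by (smt (verit) mult_mono abs_ge_zero)
  thus ?thesis using assms by (auto simp: bdd_meas_def intro!: borel_measurable_times)
qed

lemma bdd_meas_uminus: "bdd_meas f \<Longrightarrow> bdd_meas (\<lambda>t. - f t)"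
  using bdd_meas_mult[OF bdd_meas_const[of "-1"]] by simp

lemma bdd_meas_diff: "bdd_meas f \<Longrightarrow> bdd_meas g \<Longrightarrow> bdd_meas (\<lambda>t. f t - g t)"
  using bdd_meas_add[OF _ bdd_meas_uminus, of f g] by simp

lemma bdd_meas_sum: "(\<And>i. i \<in> I \<Longrightarrow> bdd_meas (f i)) \<Longrightarrow> bdd_meas (\<lambda>t. \<Sum>i\<in>I. f i t)"
  by (induction I rule: infinite_finite_induct) (auto intro: bdd_meas_const bdd_meas_add)

lemma bdd_meas_power2: "bdd_meas f \<Longrightarrow> bdd_meas (\<lambda>t. (f t)\<^sup>2)"
  unfolding power2_eq_square by (rule bdd_meas_mult)

lemma bdd_meas_continuous:
  assumes "continuous_on UNIV f"
  shows "bdd_meas f"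
proof -
  have "compact (f ` {0..1})"
    by (intro compact_continuous_image continuous_on_subset[OF assms]) auto
  hence "bounded (f ` {0..1})" by (rule compact_imp_bounded)
  then obtain B where "\<forall>t\<in>{0..1}. \<bar>f t\<bar> \<le> B" by (auto simp: bounded_iff)
  thus ?thesis using borel_measurable_continuous_onI[OF assms]
    by (auto simp: bdd_meas_def intro!: measurable_restrict_space1)
qed

lemma bdd_meas_If_le:
  assumes "bdd_meas f" "bdd_meas g"
  shows "bdd_meas (\<lambda>t. if t \<le> x then f t else g t)"
proof -
  obtain B C where "\<forall>t\<in>{0..1}. \<bar>f t\<bar> \<le> B" "\<forall>t\<in>{0..1}. \<bar>g t\<bar> \<le> C" using assms by (auto simp: bdd_meas_def)
  hence "\<forall>t\<in>{0..1}. \<bar>if t \<le> x then f t else g t\<bar> \<le> max B C" by (smt (verit))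
  moreover have "(\<lambda>t. if t \<le> x then f t else g t) \<in> borel_measurable U"
  proof (rule measurable_If)
    have "{t \<in> space U. t \<le> x} = {0..1} \<inter> {..x}" by auto
    thus "{t \<in> space U. t \<le> x} \<in> sets U" by (auto simp: sets_restrict_space)
  qed (use assms in \<open>auto simp: bdd_meas_def\<close>)
  ultimately show ?thesis unfolding bdd_meas_def by blast
qed

lemma bdd_meas_has_integral:
  assumes "bdd_meas f" "(f has_integral i) {0..1}"
  shows "integral\<^sup>L U f = i"
proof -
  have "set_integrable lborel {0..1} f"
    using bdd_meas_integrable[OF assms(1)] unfolding set_integrable_def
    by (subst (asm) integrable_restrict_space) auto
  hence "set_lebesgue_integral lborel {0..1} f = integral {0..1} f"
    by (rule set_borel_integral_eq_integral)
  thus ?thesis using assms(2)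
    by (simp add: integral_restrict_space set_lebesgue_integral_def integral_unique)
qed

text \<open>The finite exceptional set admits antiderivatives with a kink, as they arise from
  periodised Bernoulli functions at \<open>t = x\<close>.\<close>

lemma integral_FTC:
  assumes "finite S" "continuous_on {0..1} F"
    "\<And>t. t \<in> {0..1} - S \<Longrightarrow> (F has_real_derivative f t) (at t)" "bdd_meas f"
  shows "integral\<^sup>L U f = F 1 - F 0"
  by (rule bdd_meas_has_integral[OF assms(4)], rule fundamental_theorem_of_calculus_strong[of S])
     (use assms in \<open>auto simp: has_real_derivative_iff_has_vector_derivative[symmetric]\<close>)

text \<open>As a function of \<open>t\<close> this is \<open>B\<^sub>n({x - t}) / n!\<close> on the unit interval.\<close>

definition pbern :: "nat \<Rightarrow> real \<Rightarrow> real \<Rightarrow> real" where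
  "pbern n x t = (if t \<le> x then \<beta> n (x - t) else \<beta> n (x - t + 1))"

lemma bdd_meas_pbern: "bdd_meas (pbern n x)"
  unfolding pbern_def by (intro bdd_meas_If_le bdd_meas_continuous continuous_intros)

lemma pbern_deriv:
  assumes "t \<noteq> x"
  shows "(pbern (Suc n) x has_real_derivative - pbern n x t) (at t)"
proof (cases "t < x")
  case True
  have "((\<lambda>t. \<beta> (Suc n) (x - t)) has_real_derivative - pbern n x t) (at t)"
    using True by (auto intro!: derivative_eq_intros simp: pbern_def)
  thus ?thesis
    by (rule has_field_derivative_transform_within_open[of _ _ _ "{..<x}"]) (use True in \<open>auto simp: pbern_def\<close>)
next
  case False
  have "((\<lambda>t. \<beta> (Suc n) (x - t + 1)) has_real_derivative - pbern n x t) (at t)"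
    using False assms by (auto intro!: derivative_eq_intros simp: pbern_def)
  thus ?thesis
    by (rule has_field_derivative_transform_within_open[of _ _ _ "{x<..}"]) (use False assms in \<open>auto simp: pbern_def\<close>)
qed

lemma pbern_continuous:
  assumes "2 \<le> n"
  shows "continuous_on A (pbern n x)"
proof -
  have "continuous_on ({..x} \<union> {x..}) (\<lambda>t. if t \<le> x then \<beta> n (x - t) else \<beta> n (x - t + 1))"
    by (rule continuous_on_If) (auto intro!: continuous_intros simp: \<beta>_endpoints[OF assms])
  moreover have "{..x} \<union> {x..} = UNIV" by auto
  ultimately show ?thesis unfolding pbern_def[abs_def] by (metis continuous_on_subset subset_UNIV)
qed

lemma pbern_ends:
  assumes "2 \<le> n" "x \<in> {0..1}"
  shows "pbern n x 0 = \<beta> n x" "pbern n x 1 = \<beta> n x"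
  using assms \<beta>_endpoints[OF assms(1)] by (auto simp: pbern_def)

lemma integral_pbern:
  assumes "1 \<le> n" "x \<in> {0..1}"
  shows "integral\<^sup>L U (pbern n x) = 0"
proof -
  have n: "2 \<le> Suc n" using assms by simp
  have "integral\<^sup>L U (\<lambda>t. - pbern n x t) = pbern (Suc n) x 1 - pbern (Suc n) x 0"
    by (rule integral_FTC[of "{x}"]) (use pbern_deriv pbern_continuous[OF n] bdd_meas_pbern bdd_meas_uminus in auto)
  thus ?thesis using pbern_ends[OF n assms(2)] by simp
qed

text \<open>From index 2 on the periodised function is continuous with equal end values
  \<open>\<beta> (Suc n) x\<close>, so only the increment of \<open>\<phi>\<close> remains as a
  boundary term.\<close>

lemma integral_pbern_by_parts:
  assumes n: "1 \<le> n" and x: "x \<in> {0..1}" and S: "finite S" and c: "continuous_on {0..1} \<phi>"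
    and d: "\<And>t. t \<in> {0..1} - S \<Longrightarrow> (\<phi> has_real_derivative \<phi>' t) (at t)"
    and bdd_meas: "bdd_meas \<phi>" "bdd_meas \<phi>'"
  shows "(\<integral>t. pbern (Suc n) x t * \<phi>' t \<partial>U) = (\<integral>t. pbern n x t * \<phi> t \<partial>U) + \<beta> (Suc n) x * (\<phi> 1 - \<phi> 0)"
proof -
  have n2: "2 \<le> Suc n" using n by simp
  have "(\<integral>t. pbern (Suc n) x t * \<phi>' t - pbern n x t * \<phi> t \<partial>U) = pbern (Suc n) x 1 * \<phi> 1 - pbern (Suc n) x 0 * \<phi> 0"
  proof (rule integral_FTC[of "insert x S"])
    fix t assume t: "t \<in> {0..1} - insert x S"
    show "((\<lambda>t. pbern (Suc n) x t * \<phi> t) has_real_derivative pbern (Suc n) x t * \<phi>' t - pbern n x t * \<phi> t) (at t)"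
      by (rule derivative_eq_intros pbern_deriv d | use t in \<open>force simp: algebra_simps\<close>)+
  qed (use S c bdd_meas bdd_meas_pbern in \<open>auto intro!: continuous_intros pbern_continuous n2 bdd_meas_diff bdd_meas_mult\<close>)
  also have "(\<integral>t. pbern (Suc n) x t * \<phi>' t - pbern n x t * \<phi> t \<partial>U) =
      (\<integral>t. pbern (Suc n) x t * \<phi>' t \<partial>U) - (\<integral>t. pbern n x t * \<phi> t \<partial>U)"
    by (intro Bochner_Integration.integral_diff bdd_meas_integrable bdd_meas_mult bdd_meas_pbern bdd_meas)
  finally show ?thesis using pbern_ends[OF n2 x] by (simp add: algebra_simps)
qed

text \<open>At index 1 the periodised function has a unit jump at \<open>t = x\<close>, which
  contributes the term \<open>- \<phi> x\<close>. All representations of point values below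
  originate here.\<close>

lemma integral_pbern_1_by_parts:
  assumes x: "x \<in> {0..1}" and S: "finite S" and c: "continuous_on {0..1} \<phi>"
    and d: "\<And>t. t \<in> {0..1} - S \<Longrightarrow> (\<phi> has_real_derivative \<phi>' t) (at t)"
    and bdd_meas: "bdd_meas \<phi>" "bdd_meas \<phi>'"
  shows "(\<integral>t. pbern (Suc 0) x t * \<phi>' t \<partial>U) = integral\<^sup>L U \<phi> + \<beta> (Suc 0) x * (\<phi> 1 - \<phi> 0) - \<phi> x"
proof -
  \<comment> \<open>\<open>pbern (Suc 0) x t * \<phi> t\<close> is
    \<open>(x - t - 1/2) * \<phi> t\<close> plus the part of \<open>\<phi>\<close> beyond
    \<open>x\<close>. Freezing that part at \<open>\<phi> x\<close> for \<open>t \<le> x\<close>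
    removes the jump and keeps the derivative off \<open>x\<close>.\<close>
  define H where "H t = (if t \<le> x then \<phi> x else \<phi> t)" for t
  have H: "continuous_on {0..1} H"
  proof -
    have "continuous_on ({0..x} \<union> {x..1}) H"
      unfolding H_def
      by (rule continuous_on_If) (use x in \<open>auto intro!: continuous_intros continuous_on_subset[OF c]\<close>)
    moreover have "{0..x} \<union> {x..1} = {0..1}" using x by auto
    ultimately show ?thesis by simp
  qed
  have Hd: "(H has_real_derivative (if t \<le> x then 0 else \<phi>' t)) (at t)" if t: "t \<in> {0..1} - insert x S" for t
  proof (cases "t < x")
    case True
    have "((\<lambda>_. \<phi> x) has_real_derivative (if t \<le> x then 0 else \<phi>' t)) (at t)" using True by simp
    thus ?thesis
      by (rule has_field_derivative_transform_within_open[of _ _ _ "{..<x}"]) (use True in \<open>auto simp: H_def\<close>)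
  next
    case False
    have "(\<phi> has_real_derivative (if t \<le> x then 0 else \<phi>' t)) (at t)" using False t d by auto
    thus ?thesis
      by (rule has_field_derivative_transform_within_open[of _ _ _ "{x<..}"]) (use False t in \<open>auto simp: H_def\<close>)
  qed
  have "(\<integral>t. pbern (Suc 0) x t * \<phi>' t - \<phi> t \<partial>U) = ((x - 1 - 1/2) * \<phi> 1 + H 1) - ((x - 0 - 1/2) * \<phi> 0 + H 0)"
  proof (rule integral_FTC[of "insert x S"])
    fix t assume t: "t \<in> {0..1} - insert x S"
    have "((\<lambda>t. (x - t - 1/2) * \<phi> t + H t) has_real_derivative
       ((x - t - 1/2) * \<phi>' t + (- 1) * \<phi> t) + (if t \<le> x then 0 else \<phi>' t)) (at t)"
      by (rule derivative_eq_intros Hd[OF t] d refl | use t in force)+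
    thus "((\<lambda>t. (x - t - 1/2) * \<phi> t + H t) has_real_derivative pbern (Suc 0) x t * \<phi>' t - \<phi> t) (at t)"
      by (rule DERIV_cong) (simp add: pbern_def \<beta>_1 algebra_simps)
  qed (use S c bdd_meas bdd_meas_pbern in \<open>auto intro!: continuous_intros H bdd_meas_diff bdd_meas_mult\<close>)
  also have "(\<integral>t. pbern (Suc 0) x t * \<phi>' t - \<phi> t \<partial>U) = (\<integral>t. pbern (Suc 0) x t * \<phi>' t \<partial>U) - integral\<^sup>L U \<phi>"
    by (intro Bochner_Integration.integral_diff bdd_meas_integrable bdd_meas_mult bdd_meas_pbern bdd_meas)
  moreover have "H 1 = \<phi> 1" "H 0 = \<phi> x" using x by (auto simp: H_def)
  ultimately show ?thesis by (simp add: \<beta>_1 algebra_simps diff_divide_distrib)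
qed

text \<open>Each integration by parts raises the first index, lowers the second and costs a sign;
  the boundary terms vanish by periodicity. At second index 1 the integral evaluates the first
  function at \<open>y\<close>.\<close>

lemma integral_pbern_pbern_aux:
  assumes x: "x \<in> {0..1}" and y: "y \<in> {0..1}" and m: "1 \<le> m"
  shows "(\<integral>t. pbern m x t * pbern (Suc n) y t \<partial>U) = (-1) ^ n * pbern (m + Suc n) x y"
  using m
proof (induction n arbitrary: m)
  case 0
  have "(\<integral>t. pbern (Suc 0) y t * (- pbern m x t) \<partial>U) =
    integral\<^sup>L U (pbern (Suc m) x) + \<beta> (Suc 0) y * (pbern (Suc m) x 1 - pbern (Suc m) x 0) - pbern (Suc m) x y"
    by (rule integral_pbern_1_by_parts[OF y, of "{x}"]) (use 0 in \<open>auto intro!: pbern_continuous pbern_deriv bdd_meas_pbern bdd_meas_uminus\<close>)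
  thus ?case using integral_pbern[OF _ x, of "Suc m"] pbern_ends[OF _ x, of "Suc m"] 0 by (simp add: mult.commute)
next
  case (Suc n)
  have "(\<integral>t. pbern (Suc m) x t * (- pbern (Suc n) y t) \<partial>U) =
     (\<integral>t. pbern m x t * pbern (Suc (Suc n)) y t \<partial>U) + \<beta> (Suc m) x * (pbern (Suc (Suc n)) y 1 - pbern (Suc (Suc n)) y 0)"
    by (rule integral_pbern_by_parts[OF Suc.prems x, of "{y}"])
       (auto intro!: pbern_continuous pbern_deriv bdd_meas_pbern bdd_meas_uminus)
  thus ?case using Suc.IH[of "Suc m"] pbern_ends[OF _ y, of "Suc (Suc n)"] by simp
qed

text \<open>The last term of the Sobolev kernel is thus the Gram kernel of the functions
  \<open>pbern a x\<close> in \<open>L^2\<close>; this is the source of its positivity.\<close>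

lemma integral_pbern_pbern:
  assumes x: "x \<in> {0..1}" and y: "y \<in> {0..1}" and a: "1 \<le> a"
  shows "(\<integral>t. pbern a x t * pbern a y t \<partial>U) = - ((-1) ^ a * \<beta> (2 * a) \<bar>x - y\<bar>)"
proof -
  obtain n where n: "a = Suc n" using a by (cases a) auto
  have *: "(\<integral>t. pbern a x t * pbern a y t \<partial>U) = - ((-1) ^ a * \<beta> (2 * a) (x - y))" if "x \<in> {0..1}" "y \<in> {0..1}" "y \<le> x" for x y
    using integral_pbern_pbern_aux[OF that(1,2) a, of n] that(3) by (simp add: n pbern_def mult_2)
  show ?thesis
  proof (cases "y \<le> x")
    case True
    thus ?thesis using *[OF x y] by simp
  next
    case False
    thus ?thesis using *[OF y x] by (simp add: mult.commute)
  qed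
qed

lemma bdd_meas_cos: "bdd_meas (\<lambda>t. cos (\<omega> * t + \<theta>))"
  by (intro bdd_meas_continuous continuous_intros)

text \<open>A derivative multiplies the cosine by \<open>\<omega>\<close> and shifts its phase by
  \<open>pi / 2\<close>, which gives one formula for all orders. The induction trades the remainder
  for the next boundary term and the next remainder.\<close>

lemma euler_maclaurin_cos:
  assumes x: "x \<in> {0..1}" and a: "1 \<le> a"
  shows "cos (\<omega> * x + \<theta>) = (\<integral>t. cos (\<omega> * t + \<theta>) \<partial>U)
    + (\<Sum>\<tau>=1..a. \<beta> \<tau> x * (\<omega> ^ (\<tau> - 1) * (cos (\<omega> + \<theta> + real (\<tau> - 1) * (pi / 2)) - cos (\<theta> + real (\<tau> - 1) * (pi / 2)))))
    - \<omega> ^ a * (\<integral>t. pbern a x t * cos (\<omega> * t + \<theta> + real a * (pi / 2)) \<partial>U)"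
  using a
proof (induction a rule: dec_induct)
  case base
  have shift: "cos (\<omega> * t + \<theta> + pi / 2) = - sin (\<omega> * t + \<theta>)" for t
    using cos_add[of "\<omega> * t + \<theta>" "pi / 2"] by simp
  have "(\<integral>t. pbern (Suc 0) x t * (\<omega> * cos (\<omega> * t + \<theta> + pi / 2)) \<partial>U) =
     (\<integral>t. cos (\<omega> * t + \<theta>) \<partial>U) + \<beta> (Suc 0) x * (cos (\<omega> * 1 + \<theta>) - cos (\<omega> * 0 + \<theta>)) - cos (\<omega> * x + \<theta>)"
    by (rule integral_pbern_1_by_parts[OF x, of "{}"])
       (auto intro!: continuous_intros derivative_eq_intros bdd_meas_continuous simp: shift)
  moreover have "(\<integral>t. pbern (Suc 0) x t * (\<omega> * cos (\<omega> * t + \<theta> + pi / 2)) \<partial>U) =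
     \<omega> * (\<integral>t. pbern (Suc 0) x t * cos (\<omega> * t + \<theta> + pi / 2) \<partial>U)"
    by (simp add: mult.left_commute[of _ \<omega>])
  ultimately show ?case by simp
next
  case (step n)
  define \<phi> where "\<phi> t = cos (\<omega> * t + \<theta> + real n * (pi / 2))" for t
  have "(\<integral>t. pbern (Suc n) x t * (\<omega> * cos (\<omega> * t + \<theta> + real (Suc n) * (pi / 2))) \<partial>U) =
     (\<integral>t. pbern n x t * \<phi> t \<partial>U) + \<beta> (Suc n) x * (\<phi> 1 - \<phi> 0)"
  proof (rule integral_pbern_by_parts[OF step(1) x, of "{}"])
    fix t
    have "cos (\<omega> * t + \<theta> + real (Suc n) * (pi / 2)) = - sin (\<omega> * t + \<theta> + real n * (pi / 2))"
      using cos_add[of "\<omega> * t + \<theta> + real n * (pi / 2)" "pi / 2"] by (simp add: algebra_simps add_divide_distrib)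
    thus "(\<phi> has_real_derivative \<omega> * cos (\<omega> * t + \<theta> + real (Suc n) * (pi / 2))) (at t)"
      unfolding \<phi>_def by (auto intro!: derivative_eq_intros)
  qed (auto simp: \<phi>_def intro!: continuous_intros bdd_meas_continuous)
  moreover have "(\<integral>t. pbern (Suc n) x t * (\<omega> * cos (\<omega> * t + \<theta> + real (Suc n) * (pi / 2))) \<partial>U) =
     \<omega> * (\<integral>t. pbern (Suc n) x t * cos (\<omega> * t + \<theta> + real (Suc n) * (pi / 2)) \<partial>U)"
    by (simp add: mult.left_commute[of _ \<omega>])
  ultimately have "(\<integral>t. pbern n x t * \<phi> t \<partial>U) =
     \<omega> * (\<integral>t. pbern (Suc n) x t * cos (\<omega> * t + \<theta> + real (Suc n) * (pi / 2)) \<partial>U) - \<beta> (Suc n) x * (\<phi> 1 - \<phi> 0)"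
    by simp
  hence "\<omega> ^ n * (\<integral>t. pbern n x t * \<phi> t \<partial>U) =
     \<omega> ^ Suc n * (\<integral>t. pbern (Suc n) x t * cos (\<omega> * t + \<theta> + real (Suc n) * (pi / 2)) \<partial>U)
      - \<beta> (Suc n) x * (\<omega> ^ n * (\<phi> 1 - \<phi> 0))"
    by (simp only: right_diff_distrib power_Suc mult_ac)
  with step.IH show ?case unfolding \<phi>_def by simp
qed

lemma bessel_inequality:
  assumes "finite I" "bdd_meas W" "\<And>i. i \<in> I \<Longrightarrow> bdd_meas (e i)"
    and orth: "\<And>i j. i \<in> I \<Longrightarrow> j \<in> I \<Longrightarrow> (\<integral>t. e i t * e j t \<partial>U) = (if i = j then 1 else 0)"
  shows "(\<Sum>i\<in>I. (\<integral>t. W t * e i t \<partial>U)\<^sup>2) \<le> (\<integral>t. (W t)\<^sup>2 \<partial>U)"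
proof -
  define c where "c i = (\<integral>t. W t * e i t \<partial>U)" for i
  define P where "P t = (\<Sum>i\<in>I. c i * e i t)" for t
  have P: "bdd_meas P" unfolding P_def by (intro bdd_meas_sum bdd_meas_mult bdd_meas_const assms)
  have int: "(\<integral>t. f t * P t \<partial>U) = (\<Sum>i\<in>I. c i * (\<integral>t. f t * e i t \<partial>U))" if "bdd_meas f" for f
  proof -
    have "(\<integral>t. f t * P t \<partial>U) = (\<integral>t. (\<Sum>i\<in>I. c i * (f t * e i t)) \<partial>U)"
      by (simp add: P_def sum_distrib_left algebra_simps)
    also have "\<dots> = (\<Sum>i\<in>I. \<integral>t. c i * (f t * e i t) \<partial>U)"
      by (intro Bochner_Integration.integral_sum bdd_meas_integrable bdd_meas_mult bdd_meas_const assms that)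
    finally show ?thesis by simp
  qed
  have eP: "(\<integral>t. e i t * P t \<partial>U) = c i" if "i \<in> I" for i
  proof -
    have "(\<integral>t. e i t * P t \<partial>U) = (\<Sum>j\<in>I. if j = i then c j else 0)"
      unfolding int[OF assms(3)[OF that]] by (intro sum.cong refl) (auto simp: orth[OF that])
    thus ?thesis using that assms(1) by simp
  qed
  have PP: "(\<integral>t. P t * P t \<partial>U) = (\<Sum>i\<in>I. (c i)\<^sup>2)"
    unfolding int[OF P] by (intro sum.cong refl) (simp add: eP mult.commute[of "P _"] power2_eq_square)
  have WP: "(\<integral>t. W t * P t \<partial>U) = (\<Sum>i\<in>I. (c i)\<^sup>2)"
    unfolding int[OF assms(2)] by (simp add: c_def power2_eq_square)
  have "0 \<le> (\<integral>t. (W t - P t)\<^sup>2 \<partial>U)" by simp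
  also have "\<dots> = (\<integral>t. ((W t)\<^sup>2 - 2 * (W t * P t)) + P t * P t \<partial>U)"
    by (simp add: power2_diff power2_eq_square algebra_simps)
  also have "\<dots> = (\<integral>t. (W t)\<^sup>2 - 2 * (W t * P t) \<partial>U) + (\<integral>t. P t * P t \<partial>U)"
    by (intro Bochner_Integration.integral_add bdd_meas_integrable bdd_meas_diff bdd_meas_mult bdd_meas_power2 bdd_meas_const assms P)
  also have "(\<integral>t. (W t)\<^sup>2 - 2 * (W t * P t) \<partial>U) = (\<integral>t. (W t)\<^sup>2 \<partial>U) - (\<integral>t. 2 * (W t * P t) \<partial>U)"
    by (intro Bochner_Integration.integral_diff bdd_meas_integrable bdd_meas_diff bdd_meas_mult bdd_meas_power2 bdd_meas_const assms P)
  finally show ?thesis using PP WP by (simp add: c_def)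
qed

section \<open>The one-dimensional kernels\<close>

text \<open>Index \<open>n\<close> stands for the frequency \<open>n + 1\<close>.\<close>

definition decay :: "real \<Rightarrow> nat \<Rightarrow> real" where
  "decay \<alpha> n = real (Suc n) powr (- 2 * \<alpha>)"

text \<open>The frequencies \<open>n + 1\<close> and \<open>- (n + 1)\<close> of the Korobov kernel
  combined into one real term.\<close>

definition skor :: "nat \<Rightarrow> real \<Rightarrow> real \<Rightarrow> real" where
  "skor n x y = 2 * cos (2 * pi * real (Suc n) * (x - y))"

definition scos :: "nat \<Rightarrow> real \<Rightarrow> real \<Rightarrow> real" where
  "scos n x y = 2 * (cos (pi * real (Suc n) * x) * cos (pi * real (Suc n) * y))"

definition kkor :: "real \<Rightarrow> real \<Rightarrow> real \<Rightarrow> real \<Rightarrow> real" where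
  "kkor \<alpha> \<gamma> x y = 1 + \<gamma> * (\<Sum>n. decay \<alpha> n * skor n x y)"

definition kcos :: "real \<Rightarrow> real \<Rightarrow> real \<Rightarrow> real \<Rightarrow> real" where
  "kcos \<alpha> \<gamma> x y = 1 + \<gamma> * (\<Sum>n. decay \<alpha> n * scos n x y)"

definition kkc :: "real \<Rightarrow> real \<Rightarrow> real \<Rightarrow> real \<Rightarrow> real" where
  "kkc \<alpha> \<gamma> x y = (kkor \<alpha> \<gamma> x y + kcos \<alpha> \<gamma> x y) / 2"

definition ksob :: "nat \<Rightarrow> real \<Rightarrow> real \<Rightarrow> real \<Rightarrow> real" where
  "ksob a \<gamma> x y = 1 + \<gamma> * ((\<Sum>\<tau>=1..a. \<beta> \<tau> x * \<beta> \<tau> y) - (-1) ^ a * \<beta> (2 * a) \<bar>x - y\<bar>)"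

lemma K_sob_eq: "K_sob a \<gamma> x y = complex_of_real (ksob a \<gamma> x y)"
  by (simp add: K_sob_def ksob_def \<beta>_def power2_eq_square algebra_simps)

lemma decay_nonneg: "0 \<le> decay \<alpha> n"
  by (simp add: decay_def)

lemma decay_summable:
  assumes "\<alpha> > 1/2"
  shows "summable (decay \<alpha>)"
proof -
  have "summable (\<lambda>n. real n powr (- 2 * \<alpha>))" using assms by (simp add: summable_real_powr_iff)
  thus ?thesis unfolding decay_def by (subst summable_Suc_iff)
qed

lemma decay_series_summable:
  assumes "\<alpha> > 1/2" "\<And>n. \<bar>g n\<bar> \<le> B"
  shows "summable (\<lambda>n. \<bar>decay \<alpha> n * g n\<bar>)" "summable (\<lambda>n. decay \<alpha> n * g n)"
proof -
  have "summable (\<lambda>n. decay \<alpha> n * B)" by (intro summable_mult2 decay_summable assms)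
  thus "summable (\<lambda>n. \<bar>decay \<alpha> n * g n\<bar>)"
    by (rule summable_comparison_test')
       (use decay_nonneg assms(2) in \<open>auto simp: abs_mult intro!: mult_left_mono\<close>)
  thus "summable (\<lambda>n. decay \<alpha> n * g n)" by (rule summable_rabs_cancel)
qed

lemma skor_bound: "\<bar>skor n x y\<bar> \<le> 2"
  by (simp add: skor_def abs_mult)

lemma scos_bound: "\<bar>scos n x y\<bar> \<le> 2"
  by (simp add: scos_def abs_mult mult_le_one)

lemma kkor_sums: "\<alpha> > 1/2 \<Longrightarrow> (\<lambda>n. decay \<alpha> n * skor n x y) sums (\<Sum>n. decay \<alpha> n * skor n x y)"
  by (intro summable_sums decay_series_summable(2)[OF _ skor_bound])

lemma kcos_sums: "\<alpha> > 1/2 \<Longrightarrow> (\<lambda>n. decay \<alpha> n * scos n x y) sums (\<Sum>n. decay \<alpha> n * scos n x y)"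
  by (intro summable_sums decay_series_summable(2)[OF _ scos_bound])

lemma K_cos_eq:
  assumes "\<alpha> > 1/2"
  shows "K_cos \<alpha> \<gamma> x y = complex_of_real (kcos \<alpha> \<gamma> x y)"
proof -
  define f where "f k = complex_of_real (r_coef \<alpha> \<gamma> (int k) * (sqrt 2 * cos (pi * real k * x)) * (sqrt 2 * cos (pi * real k * y)))" for k
  have f: "f (Suc n) = complex_of_real (\<gamma> * (decay \<alpha> n * scos n x y))" for n
  proof -
    have "r_coef \<alpha> \<gamma> (int (Suc n)) = \<gamma> * decay \<alpha> n" by (simp add: r_coef_def decay_def add.commute)
    moreover have "\<gamma> * decay \<alpha> n * (sqrt 2 * u) * (sqrt 2 * v) = \<gamma> * (decay \<alpha> n * ((sqrt 2 * sqrt 2) * (u * v)))" for u v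
      by (simp only: mult_ac)
    moreover have "sqrt 2 * sqrt 2 = (2::real)" by simp
    ultimately show ?thesis unfolding f_def scos_def by (simp only:)
  qed
  have "summable (\<lambda>n. norm (f (Suc n)))"
    unfolding f norm_of_real abs_mult[of \<gamma>]
    by (intro summable_mult decay_series_summable(1)[OF assms scos_bound])
  moreover have "(\<lambda>n. f (Suc n)) sums complex_of_real (\<gamma> * (\<Sum>n. decay \<alpha> n * scos n x y))"
    unfolding f by (intro sums_of_real sums_mult kcos_sums assms)
  ultimately have "((\<lambda>n. f (Suc n)) has_sum complex_of_real (\<gamma> * (\<Sum>n. decay \<alpha> n * scos n x y))) UNIV"
    by (intro norm_summable_imp_has_sum)
  hence "(f has_sum complex_of_real (\<gamma> * (\<Sum>n. decay \<alpha> n * scos n x y))) (Suc ` UNIV)"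
    by (subst has_sum_reindex) (auto simp: o_def)
  moreover have "Suc ` UNIV = {1..}" by (auto simp: image_iff) (metis Suc_le_D)
  ultimately show ?thesis
    unfolding K_cos_def f_def[symmetric] kcos_def by (simp add: infsumI)
qed

text \<open>The unordered sum over the integers is split into zero, positive and negative
  frequencies. Each half converges absolutely, so both may be recombined termwise.\<close>

lemma K_kor_eq:
  assumes "\<alpha> > 1/2"
  shows "K_kor \<alpha> \<gamma> x y = complex_of_real (kkor \<alpha> \<gamma> x y)"
proof -
  define f where "f h = complex_of_real (r_coef \<alpha> \<gamma> h) *
     exp (2 * complex_of_real pi * \<i> * of_int h * complex_of_real (x - y))" for h :: int
  have f_cis: "f h = complex_of_real (r_coef \<alpha> \<gamma> h) * cis (2 * pi * of_int h * (x - y))" for h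
    unfolding f_def cis_conv_exp by (simp add: algebra_simps)
  have r: "r_coef \<alpha> \<gamma> (int (Suc n)) = \<gamma> * decay \<alpha> n" "r_coef \<alpha> \<gamma> (- int (Suc n)) = \<gamma> * decay \<alpha> n" for n
    by (simp_all add: r_coef_def decay_def add.commute)
  have sm: "summable (\<lambda>n. \<bar>\<gamma> * decay \<alpha> n\<bar>)"
    using decay_nonneg decay_summable[OF assms] by (simp add: abs_mult summable_mult)
  have n1: "summable (\<lambda>n. norm (f (int (Suc n))))" "summable (\<lambda>n. norm (f (- int (Suc n))))"
    unfolding f_cis r norm_mult norm_of_real norm_cis mult_1_right by (rule sm)+
  obtain A where A: "((\<lambda>n. f (int (Suc n))) has_sum A) UNIV"
    using norm_summable_imp_has_sum[OF n1(1) summable_sums[OF summable_norm_cancel[OF n1(1)]]] by blast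
  obtain B where B: "((\<lambda>n. f (- int (Suc n))) has_sum B) UNIV"
    using norm_summable_imp_has_sum[OF n1(2) summable_sums[OF summable_norm_cancel[OF n1(2)]]] by blast
  have "(f has_sum A) ((\<lambda>n. int (Suc n)) ` UNIV)"
    using A by (subst has_sum_reindex) (auto simp: o_def inj_def)
  moreover have "(f has_sum B) ((\<lambda>n. - int (Suc n)) ` UNIV)"
    using B by (subst has_sum_reindex) (auto simp: o_def inj_def)
  ultimately have "(f has_sum (A + B)) ((\<lambda>n. int (Suc n)) ` UNIV \<union> (\<lambda>n. - int (Suc n)) ` UNIV)"
    by (rule has_sum_Un_disjoint) auto
  hence "(f has_sum (1 + (A + B))) ({0} \<union> ((\<lambda>n. int (Suc n)) ` UNIV \<union> (\<lambda>n. - int (Suc n)) ` UNIV))"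
    by (rule has_sum_Un_disjoint[rotated])
       (use has_sum_finite[of "{0}" f] in \<open>auto simp: f_def r_coef_def\<close>)
  moreover have "{0} \<union> ((\<lambda>n. int (Suc n)) ` UNIV \<union> (\<lambda>n. - int (Suc n)) ` UNIV) = UNIV"
  proof -
    have "h \<in> {0} \<union> ((\<lambda>n. int (Suc n)) ` UNIV \<union> (\<lambda>n. - int (Suc n)) ` UNIV)" for h :: int
    proof -
      consider "h = 0" | "h = int (Suc (nat (h - 1)))" | "h = - int (Suc (nat (- h - 1)))" by linarith
      thus ?thesis by cases blast+
    qed
    thus ?thesis by blast
  qed
  ultimately have total: "(f has_sum (1 + (A + B))) UNIV" by simp
  have "f (int (Suc n)) + f (- int (Suc n)) = complex_of_real (\<gamma> * (decay \<alpha> n * skor n x y))" for n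
  proof -
    define \<phi> where "\<phi> = 2 * pi * real (Suc n) * (x - y)"
    have "2 * pi * of_int (int (Suc n)) * (x - y) = \<phi>" "2 * pi * of_int (- int (Suc n)) * (x - y) = - \<phi>"
      by (simp_all add: \<phi>_def algebra_simps)
    thus ?thesis unfolding f_cis r skor_def \<phi>_def[symmetric] by (simp add: complex_eq_iff)
  qed
  hence "((\<lambda>n. complex_of_real (\<gamma> * (decay \<alpha> n * skor n x y))) has_sum (A + B)) UNIV"
    using has_sum_add[OF A B] by simp
  hence "(\<lambda>n. complex_of_real (\<gamma> * (decay \<alpha> n * skor n x y))) sums (A + B)" by (rule has_sum_imp_sums)
  moreover have "(\<lambda>n. complex_of_real (\<gamma> * (decay \<alpha> n * skor n x y))) sums complex_of_real (\<gamma> * (\<Sum>n. decay \<alpha> n * skor n x y))"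
    by (intro sums_of_real sums_mult kkor_sums assms)
  ultimately have "A + B = complex_of_real (\<gamma> * (\<Sum>n. decay \<alpha> n * skor n x y))" by (rule sums_unique2)
  thus ?thesis unfolding K_kor_def f_def[symmetric] kkor_def using total by (simp add: infsumI)
qed

lemma psd_skor: "psd_on X (skor n)"
proof -
  have "psd_on X (\<lambda>x y. 2 * (cos (2 * pi * real (Suc n) * x) * cos (2 * pi * real (Suc n) * y)
      + sin (2 * pi * real (Suc n) * x) * sin (2 * pi * real (Suc n) * y)))"
    by (intro psd_on_scale psd_on_add psd_on_rank1) auto
  thus ?thesis unfolding skor_def[abs_def] right_diff_distrib cos_diff .
qed

lemma psd_scos: "psd_on X (scos n)"
  unfolding scos_def[abs_def] by (intro psd_on_scale psd_on_rank1) auto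

lemma psd_on_series:
  assumes "\<gamma> \<ge> 0" "\<And>n. psd_on X (p n)" "\<And>x y. (\<lambda>n. decay \<alpha> n * p n x y) sums l x y"
  shows "psd_on X (\<lambda>x y. 1 + \<gamma> * l x y)"
proof (rule psd_on_LIMSEQ)
  show "psd_on X (\<lambda>x y. 1 + \<gamma> * (\<Sum>n<N. decay \<alpha> n * p n x y))" for N
    by (intro psd_on_add psd_on_one psd_on_scale psd_on_sum assms decay_nonneg)
  show "(\<lambda>N. 1 + \<gamma> * (\<Sum>n<N. decay \<alpha> n * p n x y)) \<longlonglongrightarrow> 1 + \<gamma> * l x y" for x y
    using assms(3)[of x y] unfolding sums_def by (intro tendsto_intros)
qed

text \<open>Reduces a domination to partial sums, provided the constant is uniform in
  \<open>N\<close>; Bessel's inequality supplies that uniformity.\<close>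

lemma psd_on_series_bound:
  assumes "\<And>x y. (\<lambda>n. decay \<alpha> n * p n x y) sums l x y"
    "\<And>N. psd_on X (\<lambda>x y. k x y - (1 + \<gamma> * (\<Sum>n<N. decay \<alpha> n * p n x y)))"
  shows "psd_on X (\<lambda>x y. k x y - (1 + \<gamma> * l x y))"
proof (rule psd_on_LIMSEQ[OF assms(2)])
  show "(\<lambda>N. k x y - (1 + \<gamma> * (\<Sum>n<N. decay \<alpha> n * p n x y))) \<longlonglongrightarrow> k x y - (1 + \<gamma> * l x y)" for x y
    using assms(1)[of x y] unfolding sums_def by (intro tendsto_intros)
qed

lemma psd_kkor: "\<alpha> > 1/2 \<Longrightarrow> \<gamma> \<ge> 0 \<Longrightarrow> psd_on X (kkor \<alpha> \<gamma>)"
  unfolding kkor_def[abs_def] by (rule psd_on_series[OF _ psd_skor kkor_sums])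

lemma psd_kcos: "\<alpha> > 1/2 \<Longrightarrow> \<gamma> \<ge> 0 \<Longrightarrow> psd_on X (kcos \<alpha> \<gamma>)"
  unfolding kcos_def[abs_def] by (rule psd_on_series[OF _ psd_scos kcos_sums])

lemma psd_kkc:
  assumes "\<alpha> > 1/2" "\<gamma> \<ge> 0"
  shows "psd_on X (kkc \<alpha> \<gamma>)"
proof -
  have "psd_on X (\<lambda>x y. (1/2) * (kkor \<alpha> \<gamma> x y + kcos \<alpha> \<gamma> x y))"
    using assms by (intro psd_on_scale psd_on_add psd_kkor psd_kcos) auto
  thus ?thesis by (simp add: kkc_def[abs_def])
qed

lemma kkor_dominated_kkc:
  assumes "\<alpha> > 1/2" "\<gamma> \<ge> 0"
  shows "dominated_on X (kkor \<alpha> \<gamma>) (kkc \<alpha> \<gamma>)"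
proof (rule dominated_onI[of _ _ _ 2])
  have "(\<lambda>x y. 2 * kkc \<alpha> \<gamma> x y - kkor \<alpha> \<gamma> x y) = kcos \<alpha> \<gamma>" by (simp add: kkc_def fun_eq_iff field_simps)
  thus "psd_on X (\<lambda>x y. 2 * kkc \<alpha> \<gamma> x y - kkor \<alpha> \<gamma> x y)" using psd_kcos[OF assms] by simp
qed (use psd_kkor[OF assms] psd_kkc[OF assms] in auto)

lemma kcos_dominated_kkc:
  assumes "\<alpha> > 1/2" "\<gamma> \<ge> 0"
  shows "dominated_on X (kcos \<alpha> \<gamma>) (kkc \<alpha> \<gamma>)"
proof (rule dominated_onI[of _ _ _ 2])
  have "(\<lambda>x y. 2 * kkc \<alpha> \<gamma> x y - kcos \<alpha> \<gamma> x y) = kkor \<alpha> \<gamma>" by (simp add: kkc_def fun_eq_iff field_simps)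
  thus "psd_on X (\<lambda>x y. 2 * kkc \<alpha> \<gamma> x y - kcos \<alpha> \<gamma> x y)" using psd_kkor[OF assms] by simp
qed (use psd_kcos[OF assms] psd_kkc[OF assms] in auto)

lemma kkc_dominated:
  assumes "dominated_on X (kkor \<alpha> \<gamma>) k" "dominated_on X (kcos \<alpha> \<gamma>) k" "\<alpha> > 1/2" "\<gamma> \<ge> 0"
  shows "dominated_on X (kkc \<alpha> \<gamma>) k"
proof -
  obtain C D where C: "C > 0" "psd_on X (\<lambda>x y. C * k x y - kkor \<alpha> \<gamma> x y)"
    and D: "D > 0" "psd_on X (\<lambda>x y. D * k x y - kcos \<alpha> \<gamma> x y)"
    using assms by (auto simp: dominated_on_def)
  have "psd_on X (\<lambda>x y. (1/2) * ((C * k x y - kkor \<alpha> \<gamma> x y) + (D * k x y - kcos \<alpha> \<gamma> x y)))"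
    by (intro psd_on_scale psd_on_add C D) auto
  hence "psd_on X (\<lambda>x y. ((C + D) / 2) * k x y - kkc \<alpha> \<gamma> x y)"
    by (rule psd_on_cong[THEN iffD1, rotated]) (simp add: kkc_def field_simps)
  thus ?thesis using assms C D psd_kkc[OF assms(3,4)]
    by (intro dominated_onI[of _ _ _ "(C + D) / 2"]) (auto simp: dominated_on_def)
qed

section \<open>Quadratic forms and Bessel bounds\<close>

lemma integral_U_const: "(\<integral>t. c \<partial>U) = (c::real)"
  by (rule bdd_meas_has_integral[OF bdd_meas_const]) (use has_integral_const_real[of c 0 1] in simp)

lemma integral_cos_zero:
  assumes "\<omega> \<noteq> 0" "sin (\<omega> + \<theta>) = sin \<theta>"
  shows "(\<integral>t. cos (\<omega> * t + \<theta>) \<partial>U) = 0"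
proof -
  have "(\<integral>t. cos (\<omega> * t + \<theta>) \<partial>U) = sin (\<omega> * 1 + \<theta>) / \<omega> - sin (\<omega> * 0 + \<theta>) / \<omega>"
    by (rule integral_FTC[of "{}"])
       (use assms(1) in \<open>auto intro!: continuous_intros derivative_eq_intros bdd_meas_cos\<close>)
  thus ?thesis using assms(2) by simp
qed

text \<open>A product of cosines splits into the difference and the sum frequency, and the two sine
  conditions say that these integrate to 0. This covers full and half periods and shifted phases at
  once.\<close>

lemma orthonormal_cos:
  fixes \<omega> :: "nat \<Rightarrow> real"
  assumes pos: "\<And>i. 0 < \<omega> i" and inj: "inj \<omega>" and diff: "\<And>i j. sin (\<omega> i - \<omega> j) = 0"
    and sum: "\<And>i j. sin (\<omega> i + \<omega> j + 2 * \<theta>) = sin (2 * \<theta>)"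
  shows "(\<integral>t. (sqrt 2 * cos (\<omega> i * t + \<theta>)) * (sqrt 2 * cos (\<omega> j * t + \<theta>)) \<partial>U) = (if i = j then 1 else 0)"
proof -
  have "(sqrt 2 * cos (\<omega> i * t + \<theta>)) * (sqrt 2 * cos (\<omega> j * t + \<theta>)) =
      cos ((\<omega> i - \<omega> j) * t + 0) + cos ((\<omega> i + \<omega> j) * t + 2 * \<theta>)" for t
  proof -
    have "(sqrt 2 * cos (\<omega> i * t + \<theta>)) * (sqrt 2 * cos (\<omega> j * t + \<theta>)) = 2 * (cos (\<omega> i * t + \<theta>) * cos (\<omega> j * t + \<theta>))"
      by simp
    thus ?thesis unfolding cos_times_cos by (simp add: algebra_simps)
  qed
  hence "(\<integral>t. (sqrt 2 * cos (\<omega> i * t + \<theta>)) * (sqrt 2 * cos (\<omega> j * t + \<theta>)) \<partial>U) =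
      (\<integral>t. cos ((\<omega> i - \<omega> j) * t + 0) + cos ((\<omega> i + \<omega> j) * t + 2 * \<theta>) \<partial>U)" by presburger
  also have "\<dots> = (\<integral>t. cos ((\<omega> i - \<omega> j) * t + 0) \<partial>U) + (\<integral>t. cos ((\<omega> i + \<omega> j) * t + 2 * \<theta>) \<partial>U)"
    by (intro Bochner_Integration.integral_add bdd_meas_integrable bdd_meas_cos)
  also have "(\<integral>t. cos ((\<omega> i + \<omega> j) * t + 2 * \<theta>) \<partial>U) = 0"
    using pos[of i] pos[of j] sum by (intro integral_cos_zero) auto
  also have "(\<integral>t. cos ((\<omega> i - \<omega> j) * t + 0) \<partial>U) = (if i = j then 1 else 0)"
  proof (cases "i = j")
    case True
    thus ?thesis using integral_U_const[of 1] by simp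
  next
    case False
    hence "\<omega> i - \<omega> j \<noteq> 0" using inj by (auto dest: injD)
    thus ?thesis using False diff integral_cos_zero[of "\<omega> i - \<omega> j" 0] by simp
  qed
  finally show ?thesis by simp
qed

lemma bessel_cos:
  fixes \<omega> :: "nat \<Rightarrow> real"
  assumes "\<And>i. 0 < \<omega> i" "inj \<omega>" "\<And>i j. sin (\<omega> i - \<omega> j) = 0"
    "\<And>i j. sin (\<omega> i + \<omega> j + 2 * \<theta>) = sin (2 * \<theta>)" and W: "bdd_meas W"
  shows "(\<Sum>i<N. 2 * (\<integral>t. W t * cos (\<omega> i * t + \<theta>) \<partial>U)\<^sup>2) \<le> (\<integral>t. (W t)\<^sup>2 \<partial>U)"
proof -
  have "2 * (\<integral>t. W t * cos (\<omega> i * t + \<theta>) \<partial>U)\<^sup>2 = (\<integral>t. W t * (sqrt 2 * cos (\<omega> i * t + \<theta>)) \<partial>U)\<^sup>2" for i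
    by (simp add: mult.left_commute[of _ "sqrt 2"] power_mult_distrib)
  hence "(\<Sum>i<N. 2 * (\<integral>t. W t * cos (\<omega> i * t + \<theta>) \<partial>U)\<^sup>2) =
    (\<Sum>i<N. (\<integral>t. W t * (sqrt 2 * cos (\<omega> i * t + \<theta>)) \<partial>U)\<^sup>2)" by simp
  also have "\<dots> \<le> (\<integral>t. (W t)\<^sup>2 \<partial>U)"
    by (rule bessel_inequality[OF _ W], simp, intro bdd_meas_mult bdd_meas_const bdd_meas_cos, rule orthonormal_cos[OF assms(1-4)])
  finally show ?thesis .
qed

lemma freq_full:
  fixes i j :: nat
  defines "\<omega> \<equiv> \<lambda>n. 2 * pi * real (Suc n)"
  shows "0 < \<omega> i" "inj \<omega>" "sin (\<omega> i - \<omega> j) = 0" "sin (\<omega> i + \<theta>) = sin \<theta>" "cos (\<omega> i + \<theta>) = cos \<theta>"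
    "sin (\<omega> i + \<omega> j + \<theta>) = sin \<theta>"
proof -
  have *: "sin (\<omega> n) = 0" "cos (\<omega> n) = 1" for n
    using sin_2npi[of "Suc n"] cos_2npi[of "Suc n"] unfolding \<omega>_def by (simp_all only: mult_ac)
  show "0 < \<omega> i" "inj \<omega>" by (auto simp: \<omega>_def inj_def)
  show "sin (\<omega> i - \<omega> j) = 0" "sin (\<omega> i + \<theta>) = sin \<theta>" "cos (\<omega> i + \<theta>) = cos \<theta>"
    "sin (\<omega> i + \<omega> j + \<theta>) = sin \<theta>"
    by (simp_all add: sin_add cos_add sin_diff *)
qed

text \<open>Half-period cosines are orthogonal only for suitable phases. At multiples of
  \<open>pi / 2\<close> they are, up to sign, pure cosines or pure sines, and both sides of the last
  equation are 0.\<close>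

lemma freq_half:
  fixes i j a :: nat
  defines "\<omega> \<equiv> \<lambda>n. pi * real (Suc n)"
  shows "0 < \<omega> i" "inj \<omega>" "sin (\<omega> i) = 0" "sin (\<omega> i - \<omega> j) = 0"
    "sin (\<omega> i + \<omega> j + 2 * (real a * (pi / 2))) = sin (2 * (real a * (pi / 2)))"
proof -
  have *: "sin (\<omega> n) = 0" for n
    using sin_npi[of "Suc n"] unfolding \<omega>_def by (simp only: mult_ac)
  show "0 < \<omega> i" "inj \<omega>" by (auto simp: \<omega>_def inj_def)
  have "2 * (real a * (pi / 2)) = real a * pi" by simp
  thus "sin (\<omega> i) = 0" "sin (\<omega> i - \<omega> j) = 0"
    "sin (\<omega> i + \<omega> j + 2 * (real a * (pi / 2))) = sin (2 * (real a * (pi / 2)))"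
    by (simp_all add: sin_add cos_add sin_diff *)
qed

definition lin :: "real set \<Rightarrow> (real \<Rightarrow> real) \<Rightarrow> (real \<Rightarrow> real) \<Rightarrow> real" where
  "lin S c f = (\<Sum>x\<in>S. c x * f x)"

text \<open>The Euler-Maclaurin remainders of all points of \<open>S\<close> merge into this one
  function, to which Bessel's inequality is applied.\<close>

definition pbern_lin :: "nat \<Rightarrow> real set \<Rightarrow> (real \<Rightarrow> real) \<Rightarrow> real \<Rightarrow> real" where
  "pbern_lin a S c t = lin S c (\<lambda>x. pbern a x t)"

lemma bdd_meas_pbern_lin: "bdd_meas (pbern_lin a S c)"
  unfolding pbern_lin_def lin_def by (intro bdd_meas_sum bdd_meas_mult bdd_meas_const bdd_meas_pbern)

lemma integral_pbern_lin:
  assumes "bdd_meas f"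
  shows "(\<integral>t. pbern_lin a S c t * f t \<partial>U) = lin S c (\<lambda>x. \<integral>t. pbern a x t * f t \<partial>U)"
proof -
  have "(\<integral>t. pbern_lin a S c t * f t \<partial>U) = (\<integral>t. (\<Sum>x\<in>S. c x * (pbern a x t * f t)) \<partial>U)"
    by (simp only: pbern_lin_def lin_def sum_distrib_right mult.assoc)
  also have "\<dots> = (\<Sum>x\<in>S. \<integral>t. c x * (pbern a x t * f t) \<partial>U)"
    by (intro Bochner_Integration.integral_sum bdd_meas_integrable bdd_meas_mult bdd_meas_const bdd_meas_pbern assms)
  finally show ?thesis by (simp add: lin_def)
qed

lemma lin_cos:
  assumes S: "S \<subseteq> {0..1}" and a: "1 \<le> a"
  shows "lin S c (\<lambda>x. cos (\<omega> * x + \<theta>)) = lin S c (\<lambda>_. 1) * (\<integral>t. cos (\<omega> * t + \<theta>) \<partial>U)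
    + (\<Sum>\<tau>=1..a. lin S c (\<beta> \<tau>) * (\<omega> ^ (\<tau> - 1) * (cos (\<omega> + \<theta> + real (\<tau> - 1) * (pi / 2)) - cos (\<theta> + real (\<tau> - 1) * (pi / 2)))))
    - \<omega> ^ a * (\<integral>t. pbern_lin a S c t * cos (\<omega> * t + (\<theta> + real a * (pi / 2))) \<partial>U)"
proof -
  define \<Delta> where "\<Delta> \<tau> = \<omega> ^ (\<tau> - 1) * (cos (\<omega> + \<theta> + real (\<tau> - 1) * (pi / 2)) - cos (\<theta> + real (\<tau> - 1) * (pi / 2)))" for \<tau>
  have "lin S c (\<lambda>x. cos (\<omega> * x + \<theta>)) = lin S c (\<lambda>x. (\<integral>t. cos (\<omega> * t + \<theta>) \<partial>U)
    + (\<Sum>\<tau>=1..a. \<beta> \<tau> x * \<Delta> \<tau>) - \<omega> ^ a * (\<integral>t. pbern a x t * cos (\<omega> * t + (\<theta> + real a * (pi / 2))) \<partial>U))"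
    unfolding lin_def \<Delta>_def
  proof (intro sum.cong refl arg_cong2[of _ _ _ _ "(*)"])
    fix x assume "x \<in> S"
    hence "x \<in> {0..1}" using S by blast
    from euler_maclaurin_cos[OF this a, of \<omega> \<theta>]
    show "cos (\<omega> * x + \<theta>) = (\<integral>t. cos (\<omega> * t + \<theta>) \<partial>U)
    + (\<Sum>\<tau>=1..a. \<beta> \<tau> x * (\<omega> ^ (\<tau> - 1) * (cos (\<omega> + \<theta> + real (\<tau> - 1) * (pi / 2)) - cos (\<theta> + real (\<tau> - 1) * (pi / 2)))))
    - \<omega> ^ a * (\<integral>t. pbern a x t * cos (\<omega> * t + (\<theta> + real a * (pi / 2))) \<partial>U)"
      by (simp only: add.assoc)
  qed
  also have "\<dots> = lin S c (\<lambda>_. 1) * (\<integral>t. cos (\<omega> * t + \<theta>) \<partial>U) + (\<Sum>x\<in>S. c x * (\<Sum>\<tau>=1..a. \<beta> \<tau> x * \<Delta> \<tau>))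
      - \<omega> ^ a * lin S c (\<lambda>x. \<integral>t. pbern a x t * cos (\<omega> * t + (\<theta> + real a * (pi / 2))) \<partial>U)"
    unfolding lin_def by (simp add: sum_distrib_left sum_distrib_right algebra_simps sum.distrib sum_subtractf)
  also have "(\<Sum>x\<in>S. c x * (\<Sum>\<tau>=1..a. \<beta> \<tau> x * \<Delta> \<tau>)) = (\<Sum>\<tau>=1..a. lin S c (\<beta> \<tau>) * \<Delta> \<tau>)"
    unfolding lin_def sum_distrib_left sum_distrib_right by (subst sum.swap) (simp add: mult.assoc)
  also have "lin S c (\<lambda>x. \<integral>t. pbern a x t * cos (\<omega> * t + (\<theta> + real a * (pi / 2))) \<partial>U) =
      (\<integral>t. pbern_lin a S c t * cos (\<omega> * t + (\<theta> + real a * (pi / 2))) \<partial>U)"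
    by (rule integral_pbern_lin[symmetric]) (rule bdd_meas_cos)
  finally show ?thesis unfolding \<Delta>_def .
qed

lemma integral_pbern_lin_sq:
  assumes S: "S \<subseteq> {0..1}" and a: "1 \<le> a"
  shows "(\<integral>t. (pbern_lin a S c t)\<^sup>2 \<partial>U) = (\<Sum>x\<in>S. \<Sum>y\<in>S. c x * c y * - ((-1) ^ a * \<beta> (2 * a) \<bar>x - y\<bar>))"
proof -
  have "(\<integral>t. (pbern_lin a S c t)\<^sup>2 \<partial>U) = lin S c (\<lambda>x. \<integral>t. pbern_lin a S c t * pbern a x t \<partial>U)"
    unfolding power2_eq_square integral_pbern_lin[OF bdd_meas_pbern_lin] by (simp only: mult.commute)
  also have "\<dots> = (\<Sum>x\<in>S. c x * (\<Sum>y\<in>S. c y * - ((-1) ^ a * \<beta> (2 * a) \<bar>x - y\<bar>)))"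
    unfolding integral_pbern_lin[OF bdd_meas_pbern] lin_def
  proof (intro sum.cong refl arg_cong2[of _ _ _ _ "(*)"])
    fix x y assume "x \<in> S" "y \<in> S"
    hence "x \<in> {0..1}" "y \<in> {0..1}" using S by auto
    thus "(\<integral>t. pbern a y t * pbern a x t \<partial>U) = - ((-1) ^ a * \<beta> (2 * a) \<bar>x - y\<bar>)"
      using integral_pbern_pbern[OF _ _ a, of y x] by (simp only: abs_minus_commute)
  qed
  finally show ?thesis by (simp add: sum_distrib_left mult.assoc)
qed

lemma ksob_form:
  assumes S: "S \<subseteq> {0..1}" and a: "1 \<le> a"
  shows "(\<Sum>x\<in>S. \<Sum>y\<in>S. c x * c y * ksob a \<gamma> x y) =
    (lin S c (\<lambda>_. 1))\<^sup>2 + \<gamma> * ((\<Sum>\<tau>=1..a. (lin S c (\<beta> \<tau>))\<^sup>2) + (\<integral>t. (pbern_lin a S c t)\<^sup>2 \<partial>U))"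
proof -
  have "(\<Sum>x\<in>S. \<Sum>y\<in>S. c x * c y * ksob a \<gamma> x y) = (\<Sum>x\<in>S. \<Sum>y\<in>S. c x * c y * (1 * 1))
     + \<gamma> * ((\<Sum>x\<in>S. \<Sum>y\<in>S. \<Sum>\<tau>=1..a. c x * c y * (\<beta> \<tau> x * \<beta> \<tau> y))
           + (\<Sum>x\<in>S. \<Sum>y\<in>S. c x * c y * - ((-1) ^ a * \<beta> (2 * a) \<bar>x - y\<bar>)))"
    unfolding ksob_def
    by (simp add: sum_distrib_left algebra_simps sum.distrib sum_subtractf sum_negf)
  also have "(\<Sum>x\<in>S. \<Sum>y\<in>S. \<Sum>\<tau>=1..a. c x * c y * (\<beta> \<tau> x * \<beta> \<tau> y)) =
      (\<Sum>\<tau>=1..a. \<Sum>x\<in>S. \<Sum>y\<in>S. c x * c y * (\<beta> \<tau> x * \<beta> \<tau> y))"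
    by (subst (2) sum.swap, subst sum.swap) simp
  also have "\<dots> = (\<Sum>\<tau>=1..a. (lin S c (\<beta> \<tau>))\<^sup>2)" unfolding rank1_form lin_def ..
  also have "(\<Sum>x\<in>S. \<Sum>y\<in>S. c x * c y * (1 * 1)) = (lin S c (\<lambda>_. 1))\<^sup>2"
    unfolding rank1_form lin_def ..
  finally show ?thesis unfolding integral_pbern_lin_sq[OF S a] .
qed

lemma psd_ksob:
  assumes "1 \<le> a" "\<gamma> \<ge> 0"
  shows "psd_on {0..1} (ksob a \<gamma>)"
proof (rule psd_onI)
  show "ksob a \<gamma> x y = ksob a \<gamma> y x" for x y by (simp add: ksob_def abs_minus_commute mult.commute)
  fix S :: "real set" and c :: "real \<Rightarrow> real" assume "finite S" "S \<subseteq> {0..1}"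
  thus "0 \<le> (\<Sum>x\<in>S. \<Sum>y\<in>S. c x * c y * ksob a \<gamma> x y)"
    using assms by (simp add: ksob_form sum_nonneg)
qed

lemma psd_on_diffI:
  assumes "psd_on X k" "psd_on X l"
    "\<And>S c. finite S \<Longrightarrow> S \<subseteq> X \<Longrightarrow> (\<Sum>x\<in>S. \<Sum>y\<in>S. c x * c y * l x y) \<le> (\<Sum>x\<in>S. \<Sum>y\<in>S. c x * c y * k x y)"
  shows "psd_on X (\<lambda>x y. k x y - l x y)"
proof (rule psd_onI)
  fix S and c :: "'a \<Rightarrow> real" assume "finite S" "S \<subseteq> X"
  thus "0 \<le> (\<Sum>x\<in>S. \<Sum>y\<in>S. c x * c y * (k x y - l x y))"
    using assms(3) by (simp add: right_diff_distrib sum_subtractf)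
qed (use assms(1,2)[THEN psd_on_sym] in metis)

lemma series_form:
  "(\<Sum>x\<in>S. \<Sum>y\<in>S. c x * c y * (1 + \<gamma> * (\<Sum>n<N. r n * p n x y))) =
    (lin S c (\<lambda>_. 1))\<^sup>2 + \<gamma> * (\<Sum>n<N. r n * (\<Sum>x\<in>S. \<Sum>y\<in>S. c x * c y * p n x y))"
proof -
  have "(\<Sum>x\<in>S. \<Sum>y\<in>S. c x * c y * (1 + \<gamma> * (\<Sum>n<N. r n * p n x y))) =
     (\<Sum>x\<in>S. \<Sum>y\<in>S. c x * c y * (1 * 1)) + \<gamma> * (\<Sum>x\<in>S. \<Sum>y\<in>S. \<Sum>n<N. c x * c y * (r n * p n x y))"
    by (simp add: sum_distrib_left algebra_simps sum.distrib)
  also have "(\<Sum>x\<in>S. \<Sum>y\<in>S. \<Sum>n<N. c x * c y * (r n * p n x y)) = (\<Sum>n<N. \<Sum>x\<in>S. \<Sum>y\<in>S. c x * c y * (r n * p n x y))"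
    by (subst (2) sum.swap, subst sum.swap) simp
  also have "\<dots> = (\<Sum>n<N. r n * (\<Sum>x\<in>S. \<Sum>y\<in>S. c x * c y * p n x y))"
    by (simp add: sum_distrib_left algebra_simps)
  also have "(\<Sum>x\<in>S. \<Sum>y\<in>S. c x * c y * (1 * 1)) = (lin S c (\<lambda>_. 1))\<^sup>2"
    unfolding rank1_form lin_def ..
  finally show ?thesis .
qed

lemma scaled_form:
  fixes c :: "'a \<Rightarrow> real"
  shows "(\<Sum>x\<in>S. \<Sum>y\<in>S. c x * c y * (C * k x y)) = C * (\<Sum>x\<in>S. \<Sum>y\<in>S. c x * c y * k x y)"
  by (simp add: sum_distrib_left mult_ac)

lemma scos_form:
  "(\<Sum>x\<in>S. \<Sum>y\<in>S. c x * c y * scos n x y) = 2 * (lin S c (\<lambda>x. cos (pi * real (Suc n) * x + 0)))\<^sup>2"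
  unfolding lin_def rank1_form[symmetric] scos_def by (simp add: sum_distrib_left mult_ac)

text \<open>The sine is written as a cosine with phase \<open>- (pi / 2)\<close>, so that
  \<open>lin_cos\<close> serves both.\<close>

lemma skor_form:
  "(\<Sum>x\<in>S. \<Sum>y\<in>S. c x * c y * skor n x y) = 2 * (lin S c (\<lambda>x. cos (2 * pi * real (Suc n) * x + 0)))\<^sup>2
     + 2 * (lin S c (\<lambda>x. cos (2 * pi * real (Suc n) * x + - (pi / 2))))\<^sup>2"
proof -
  have "skor n x y = 2 * (cos (2 * pi * real (Suc n) * x + 0) * cos (2 * pi * real (Suc n) * y + 0))
     + 2 * (cos (2 * pi * real (Suc n) * x + - (pi / 2)) * cos (2 * pi * real (Suc n) * y + - (pi / 2)))" for x y
    unfolding skor_def right_diff_distrib cos_diff[of "2 * pi * real (Suc n) * x"] by (simp add: cos_diff)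
  hence "(\<Sum>x\<in>S. \<Sum>y\<in>S. c x * c y * skor n x y) =
    2 * (\<Sum>x\<in>S. \<Sum>y\<in>S. c x * c y * (cos (2 * pi * real (Suc n) * x + 0) * cos (2 * pi * real (Suc n) * y + 0))) +
    2 * (\<Sum>x\<in>S. \<Sum>y\<in>S. c x * c y * (cos (2 * pi * real (Suc n) * x + - (pi / 2)) * cos (2 * pi * real (Suc n) * y + - (pi / 2))))"
    unfolding sum_distrib_left sum.distrib[symmetric] by (intro sum.cong refl) (simp only: algebra_simps)
  thus ?thesis unfolding rank1_form lin_def .
qed

section \<open>Korobov and cosine forms bounded by the Sobolev form\<close>

lemma decay_nat: "decay (real a) n = 1 / real (Suc n) ^ (2 * a)"
proof -
  have "decay (real a) n = real (Suc n) powr - real (2 * a)" by (simp add: decay_def)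
  thus ?thesis unfolding powr_minus by (simp only: powr_realpow of_nat_0_less_iff zero_less_Suc) (simp add: field_simps)
qed

text \<open>At multiples of \<open>2 * pi\<close> the mean and all boundary terms vanish. The
  squared factor of the remainder cancels \<open>decay\<close> up to
  \<open>(2 * pi) ^ (2 * a)\<close>, and a Bessel sum remains.\<close>

lemma sum_decay_kor_le:
  assumes S: "S \<subseteq> {0..1}" and a: "1 \<le> a"
  shows "(\<Sum>n<N. decay (real a) n * (2 * (lin S c (\<lambda>x. cos (2 * pi * real (Suc n) * x + \<theta>)))\<^sup>2)) \<le>
     (2 * pi) ^ (2 * a) * (\<integral>t. (pbern_lin a S c t)\<^sup>2 \<partial>U)"
proof -
  define I where "I n = (\<integral>t. pbern_lin a S c t * cos (2 * pi * real (Suc n) * t + (\<theta> + real a * (pi / 2))) \<partial>U)" for n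
  have "decay (real a) n * (2 * (lin S c (\<lambda>x. cos (2 * pi * real (Suc n) * x + \<theta>)))\<^sup>2) = (2 * pi) ^ (2 * a) * (2 * (I n)\<^sup>2)" for n
  proof -
    have "(\<integral>t. cos (2 * pi * real (Suc n) * t + \<theta>) \<partial>U) = 0"
      using freq_full(1,4)[of n] by (intro integral_cos_zero) auto
    hence "lin S c (\<lambda>x. cos (2 * pi * real (Suc n) * x + \<theta>)) = - ((2 * pi * real (Suc n)) ^ a * I n)"
      unfolding lin_cos[OF S a] I_def add.assoc freq_full(5) by simp
    hence "(lin S c (\<lambda>x. cos (2 * pi * real (Suc n) * x + \<theta>)))\<^sup>2 = (2 * pi) ^ (2 * a) * real (Suc n) ^ (2 * a) * (I n)\<^sup>2"
      by (simp only: power2_minus power_mult_distrib power_mult[symmetric] mult.commute[of a 2])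
    moreover have "real (Suc n) ^ (2 * a) \<noteq> 0" by simp
    ultimately show ?thesis unfolding decay_nat by (simp only:) (simp add: field_simps del: of_nat_Suc)
  qed
  hence "(\<Sum>n<N. decay (real a) n * (2 * (lin S c (\<lambda>x. cos (2 * pi * real (Suc n) * x + \<theta>)))\<^sup>2)) =
     (2 * pi) ^ (2 * a) * (\<Sum>n<N. 2 * (I n)\<^sup>2)" by (simp only: sum_distrib_left)
  also have "(\<Sum>n<N. 2 * (I n)\<^sup>2) \<le> (\<integral>t. (pbern_lin a S c t)\<^sup>2 \<partial>U)"
    unfolding I_def by (rule bessel_cos[OF freq_full(1) freq_full(2) freq_full(3) freq_full(6) bdd_meas_pbern_lin])
  finally show ?thesis by (simp add: mult_left_mono)
qed

lemma kkor_dominated_ksob: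
  assumes a: "1 \<le> a" and \<gamma>: "\<gamma> > 0"
  shows "dominated_on {0..1} (kkor (real a) \<gamma>) (ksob a \<gamma>)"
proof (rule dominated_onI)
  \<comment> \<open>The 1 covers the constant function; the factor 2 counts the cosine and the sine
    family.\<close>
  let ?C = "1 + 2 * (2 * pi) ^ (2 * a)"
  show "?C > 0" by (simp add: add_pos_nonneg)
  show "psd_on {0..1} (\<lambda>x y. ?C * ksob a \<gamma> x y - kkor (real a) \<gamma> x y)"
    unfolding kkor_def
  proof (rule psd_on_series_bound[OF kkor_sums])
    fix N
    show "psd_on {0..1} (\<lambda>x y. ?C * ksob a \<gamma> x y - (1 + \<gamma> * (\<Sum>n<N. decay (real a) n * skor n x y)))"
    proof (rule psd_on_diffI)
      show "psd_on {0..1} (\<lambda>x y. ?C * ksob a \<gamma> x y)"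
        using a \<gamma> by (intro psd_on_scale psd_ksob) auto
      show "psd_on {0..1} (\<lambda>x y. 1 + \<gamma> * (\<Sum>n<N. decay (real a) n * skor n x y))"
        using \<gamma> by (intro psd_on_add psd_on_one psd_on_scale psd_on_sum psd_skor decay_nonneg) auto
      fix S :: "real set" and c :: "real \<Rightarrow> real" assume S: "finite S" "S \<subseteq> {0..1}"
      define W where "W = (\<integral>t. (pbern_lin a S c t)\<^sup>2 \<partial>U)"
      define L where "L = (lin S c (\<lambda>_. 1))\<^sup>2"
      define B where "B = (\<Sum>\<tau>=1..a. (lin S c (\<beta> \<tau>))\<^sup>2)"
      define P where "P = (2 * pi) ^ (2 * a)"
      have nn: "0 \<le> W" "0 \<le> L" "0 \<le> B" "0 \<le> P" by (auto simp: W_def L_def B_def P_def intro!: sum_nonneg)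
      have "(\<Sum>n<N. decay (real a) n * (\<Sum>x\<in>S. \<Sum>y\<in>S. c x * c y * skor n x y)) \<le> P * W + P * W"
        unfolding skor_form distrib_left sum.distrib W_def P_def
        by (intro add_mono sum_decay_kor_le S a)
      hence "L + \<gamma> * (\<Sum>n<N. decay (real a) n * (\<Sum>x\<in>S. \<Sum>y\<in>S. c x * c y * skor n x y)) \<le> L + \<gamma> * (P * W + P * W)"
        using \<gamma> by simp
      also have "\<dots> \<le> (1 + 2 * P) * (L + \<gamma> * (B + W))"
        using nn \<gamma> by (simp add: algebra_simps)
      finally show "(\<Sum>x\<in>S. \<Sum>y\<in>S. c x * c y * (1 + \<gamma> * (\<Sum>n<N. decay (real a) n * skor n x y)))
        \<le> (\<Sum>x\<in>S. \<Sum>y\<in>S. c x * c y * (?C * ksob a \<gamma> x y))"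
        unfolding series_form scaled_form ksob_form[OF S(2) a]
          W_def[symmetric] L_def[symmetric] B_def[symmetric] P_def[symmetric] .
    qed
  qed (use a in simp)
qed (use a \<gamma> in \<open>auto intro!: psd_kkor psd_ksob\<close>)

lemma sum_inverse_squares_le: "(\<Sum>n<N. 1 / (real (Suc n))\<^sup>2) \<le> pi\<^sup>2 / 6"
proof -
  have "(\<lambda>n. 1 / (real (Suc n))\<^sup>2) sums (pi\<^sup>2 / 6)" using inverse_squares_sums by (simp add: add.commute)
  thus ?thesis using sum_le_suminf[of "\<lambda>n. 1 / (real (Suc n))\<^sup>2" "{..<N}"]
    by (simp add: sums_iff)
qed

text \<open>Boundary terms survive but grow at most like \<open>\<omega> ^ (a - 1)\<close>, so
  \<open>decay\<close> leaves a multiple of \<open>1 / (n + 1)^2\<close>. In \<open>16 * a\<close>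
  there is a 2 from the kernel, a 2 from splitting the square, a 4 from the squared difference of
  cosines, and \<open>a\<close> counts the terms.\<close>

lemma sum_decay_cos_le:
  assumes S: "S \<subseteq> {0..1}" and a: "1 \<le> a"
  shows "(\<Sum>n<N. decay (real a) n * (2 * (lin S c (\<lambda>x. cos (pi * real (Suc n) * x + 0)))\<^sup>2)) \<le>
     pi ^ (2 * a) * (16 * real a * (pi\<^sup>2 / 6) + 2) * ((\<Sum>\<tau>=1..a. (lin S c (\<beta> \<tau>))\<^sup>2) + (\<integral>t. (pbern_lin a S c t)\<^sup>2 \<partial>U))"
proof -
  define I where "I n = (\<integral>t. pbern_lin a S c t * cos (pi * real (Suc n) * t + (0 + real a * (pi / 2))) \<partial>U)" for n
  define B where "B = (\<Sum>\<tau>=1..a. (lin S c (\<beta> \<tau>))\<^sup>2)"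
  define W where "W = (\<integral>t. (pbern_lin a S c t)\<^sup>2 \<partial>U)"
  define P where "P = pi ^ (2 * a)"
  have nn: "0 \<le> B" "0 \<le> W" "0 \<le> P" by (auto simp: B_def W_def P_def intro!: sum_nonneg)
  have summand: "decay (real a) n * (2 * (lin S c (\<lambda>x. cos (pi * real (Suc n) * x + 0)))\<^sup>2) \<le>
      P * (16 * real a * B * (1 / (real (Suc n))\<^sup>2) + 2 * (2 * (I n)\<^sup>2))" for n
  proof -
    define \<omega> where "\<omega> = pi * real (Suc n)"
    define \<delta> where "\<delta> \<tau> = \<omega> ^ (\<tau> - 1) * (cos (\<omega> + 0 + real (\<tau> - 1) * (pi / 2)) - cos (0 + real (\<tau> - 1) * (pi / 2)))" for \<tau>
    define u where "u = (\<Sum>\<tau>=1..a. lin S c (\<beta> \<tau>) * \<delta> \<tau>)"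
    define Y where "Y = \<omega> ^ (a - 1)"
    have "pi * 1 \<le> pi * real (Suc n)" by (intro mult_left_mono) auto
    hence om1: "1 \<le> \<omega>" unfolding \<omega>_def using pi_gt3 by linarith
    have "(\<integral>t. cos (\<omega> * t + 0) \<partial>U) = 0"
      unfolding \<omega>_def using freq_half(1,3)[of n] by (intro integral_cos_zero) auto
    hence lin: "lin S c (\<lambda>x. cos (\<omega> * x + 0)) = u - \<omega> ^ a * I n"
      unfolding lin_cos[OF S a] I_def u_def \<delta>_def \<omega>_def by simp
    \<comment> \<open>All boundary terms are compared with the highest power; this needs
      \<open>\<omega> \<ge> 1\<close>.\<close>
    have "(\<delta> \<tau>)\<^sup>2 \<le> 4 * Y\<^sup>2" if "\<tau> \<in> {1..a}" for \<tau>
    proof -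
      have "\<bar>\<delta> \<tau>\<bar> = \<omega> ^ (\<tau> - 1) * \<bar>cos (\<omega> + 0 + real (\<tau> - 1) * (pi / 2)) - cos (0 + real (\<tau> - 1) * (pi / 2))\<bar>"
        unfolding \<delta>_def using om1 by (simp add: abs_mult)
      also have "\<dots> \<le> Y * 2"
      proof (intro mult_mono)
        show "\<omega> ^ (\<tau> - 1) \<le> Y" unfolding Y_def using om1 that by (intro power_increasing) auto
        show "\<bar>cos (\<omega> + 0 + real (\<tau> - 1) * (pi / 2)) - cos (0 + real (\<tau> - 1) * (pi / 2))\<bar> \<le> 2"
          using abs_cos_le_one[of "\<omega> + 0 + real (\<tau> - 1) * (pi / 2)"] abs_cos_le_one[of "0 + real (\<tau> - 1) * (pi / 2)"]
          by linarith
      qed (use om1 in \<open>auto simp: Y_def\<close>)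
      finally have "\<bar>\<delta> \<tau>\<bar>\<^sup>2 \<le> (Y * 2)\<^sup>2" by (intro power_mono) auto
      thus ?thesis by (simp add: power_mult_distrib)
    qed
    hence "(\<Sum>\<tau>=1..a. (\<delta> \<tau>)\<^sup>2) \<le> real (card {1..a}) * (4 * Y\<^sup>2)" by (rule sum_bounded_above)
    hence d: "(\<Sum>\<tau>=1..a. (\<delta> \<tau>)\<^sup>2) \<le> real a * (4 * Y\<^sup>2)" by simp
    have "u\<^sup>2 \<le> B * (\<Sum>\<tau>=1..a. (\<delta> \<tau>)\<^sup>2)" unfolding u_def B_def by (rule Cauchy_Schwarz_ineq_sum)
    also have "\<dots> \<le> B * (real a * (4 * Y\<^sup>2))" by (intro mult_left_mono d nn)
    finally have u: "u\<^sup>2 \<le> 4 * real a * B * Y\<^sup>2" by (simp only: mult_ac)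
    have "(u - \<omega> ^ a * I n)\<^sup>2 \<le> 2 * u\<^sup>2 + 2 * (\<omega> ^ a * I n)\<^sup>2"
      using zero_le_power2[of "u + \<omega> ^ a * I n"] by (simp add: power2_eq_square algebra_simps)
    also have "\<dots> \<le> 8 * real a * B * Y\<^sup>2 + 2 * (\<omega> ^ a * I n)\<^sup>2" using u by linarith
    finally have "decay (real a) n * (2 * (lin S c (\<lambda>x. cos (\<omega> * x + 0)))\<^sup>2) \<le>
        decay (real a) n * (2 * (8 * real a * B * Y\<^sup>2 + 2 * (\<omega> ^ a * I n)\<^sup>2))"
      unfolding lin by (intro mult_left_mono decay_nonneg) auto
    also have "\<dots> = 16 * real a * B * (decay (real a) n * Y\<^sup>2) + 2 * (2 * (I n)\<^sup>2) * (decay (real a) n * (\<omega> ^ a)\<^sup>2)"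
      by (simp add: algebra_simps power_mult_distrib)
    also have "decay (real a) n * (\<omega> ^ a)\<^sup>2 = P"
      unfolding decay_nat P_def \<omega>_def power_mult_distrib power_mult[symmetric] mult.commute[of a 2]
      by simp
    also have "decay (real a) n * Y\<^sup>2 \<le> P * (1 / (real (Suc n))\<^sup>2)"
    proof -
      have "\<omega> ^ a = \<omega> * Y" unfolding Y_def using a by (cases a) auto
      hence "decay (real a) n * Y\<^sup>2 * \<omega>\<^sup>2 = P"
        using \<open>decay (real a) n * (\<omega> ^ a)\<^sup>2 = P\<close> by (simp add: power_mult_distrib mult_ac)
      hence "decay (real a) n * Y\<^sup>2 = P / \<omega>\<^sup>2" using om1 by (simp add: field_simps)
      also have "\<dots> \<le> P / (real (Suc n))\<^sup>2"
      proof (intro divide_left_mono)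
        have "1 * real (Suc n) \<le> \<omega>" unfolding \<omega>_def using pi_gt3 by (intro mult_right_mono) auto
        thus "(real (Suc n))\<^sup>2 \<le> \<omega>\<^sup>2" by (intro power_mono) auto
      qed (use nn om1 in auto)
      finally show ?thesis by simp
    qed
    hence "16 * real a * B * (decay (real a) n * Y\<^sup>2) + 2 * (2 * (I n)\<^sup>2) * P \<le>
       16 * real a * B * (P * (1 / (real (Suc n))\<^sup>2)) + 2 * (2 * (I n)\<^sup>2) * P"
      using nn by (intro add_right_mono mult_left_mono) auto
    finally show ?thesis unfolding \<omega>_def by (simp add: algebra_simps)
  qed
  have "(\<Sum>n<N. decay (real a) n * (2 * (lin S c (\<lambda>x. cos (pi * real (Suc n) * x + 0)))\<^sup>2)) \<le>
      (\<Sum>n<N. P * (16 * real a * B * (1 / (real (Suc n))\<^sup>2) + 2 * (2 * (I n)\<^sup>2)))"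
    by (intro sum_mono summand)
  also have "\<dots> = P * (16 * real a * B * (\<Sum>n<N. 1 / (real (Suc n))\<^sup>2) + 2 * (\<Sum>n<N. 2 * (I n)\<^sup>2))"
    by (simp only: sum_distrib_left[symmetric] sum.distrib)
  also have "\<dots> \<le> P * (16 * real a * B * (pi\<^sup>2 / 6) + 2 * W)"
  proof (intro mult_left_mono add_mono sum_inverse_squares_le)
    have "2 * (0 + real a * (pi / 2)) = 2 * (real a * (pi / 2))" by simp
    thus "(\<Sum>n<N. 2 * (I n)\<^sup>2) \<le> W" unfolding I_def W_def
      by (intro bessel_cos bdd_meas_pbern_lin freq_half(1,2,4)) (simp only: freq_half(5))
  qed (use nn in auto)
  also have "\<dots> \<le> P * ((16 * real a * (pi\<^sup>2 / 6) + 2) * (B + W))"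
  proof (intro mult_left_mono nn)
    define E where "E = 16 * real a * (pi\<^sup>2 / 6)"
    have "0 \<le> E" by (simp add: E_def)
    hence "E * B + 2 * W \<le> (E + 2) * (B + W)" using nn by (simp add: algebra_simps)
    thus "16 * real a * B * (pi\<^sup>2 / 6) + 2 * W \<le> (16 * real a * (pi\<^sup>2 / 6) + 2) * (B + W)"
      unfolding E_def by (simp only: mult_ac)
  qed
  finally show ?thesis unfolding P_def B_def W_def by (simp only: mult.assoc)
qed

lemma kcos_dominated_ksob:
  assumes a: "1 \<le> a" and \<gamma>: "\<gamma> > 0"
  shows "dominated_on {0..1} (kcos (real a) \<gamma>) (ksob a \<gamma>)"
proof (rule dominated_onI)
  let ?C = "1 + pi ^ (2 * a) * (16 * real a * (pi\<^sup>2 / 6) + 2)"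
  show "?C > 0" by (intro add_pos_nonneg) auto
  show "psd_on {0..1} (\<lambda>x y. ?C * ksob a \<gamma> x y - kcos (real a) \<gamma> x y)"
    unfolding kcos_def
  proof (rule psd_on_series_bound[OF kcos_sums])
    fix N
    show "psd_on {0..1} (\<lambda>x y. ?C * ksob a \<gamma> x y - (1 + \<gamma> * (\<Sum>n<N. decay (real a) n * scos n x y)))"
    proof (rule psd_on_diffI)
      show "psd_on {0..1} (\<lambda>x y. ?C * ksob a \<gamma> x y)"
        using a \<gamma> by (intro psd_on_scale psd_ksob) auto
      show "psd_on {0..1} (\<lambda>x y. 1 + \<gamma> * (\<Sum>n<N. decay (real a) n * scos n x y))"
        using \<gamma> by (intro psd_on_add psd_on_one psd_on_scale psd_on_sum psd_scos decay_nonneg) auto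
      fix S :: "real set" and c :: "real \<Rightarrow> real" assume S: "finite S" "S \<subseteq> {0..1}"
      define Q where "Q = (\<Sum>\<tau>=1..a. (lin S c (\<beta> \<tau>))\<^sup>2) + (\<integral>t. (pbern_lin a S c t)\<^sup>2 \<partial>U)"
      define L where "L = (lin S c (\<lambda>_. 1))\<^sup>2"
      define P where "P = pi ^ (2 * a) * (16 * real a * (pi\<^sup>2 / 6) + 2)"
      have nn: "0 \<le> Q" "0 \<le> L" "0 \<le> P" by (auto simp: Q_def L_def P_def intro!: sum_nonneg add_nonneg_nonneg)
      have "(\<Sum>n<N. decay (real a) n * (\<Sum>x\<in>S. \<Sum>y\<in>S. c x * c y * scos n x y)) \<le> P * Q"
        unfolding scos_form P_def Q_def by (rule sum_decay_cos_le[OF S(2) a])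
      hence "L + \<gamma> * (\<Sum>n<N. decay (real a) n * (\<Sum>x\<in>S. \<Sum>y\<in>S. c x * c y * scos n x y)) \<le> L + \<gamma> * (P * Q)"
        using \<gamma> by simp
      also have "\<dots> \<le> (1 + P) * (L + \<gamma> * Q)"
        using nn \<gamma> by (simp add: algebra_simps)
      finally show "(\<Sum>x\<in>S. \<Sum>y\<in>S. c x * c y * (1 + \<gamma> * (\<Sum>n<N. decay (real a) n * scos n x y)))
        \<le> (\<Sum>x\<in>S. \<Sum>y\<in>S. c x * c y * (?C * ksob a \<gamma> x y))"
        unfolding series_form scaled_form ksob_form[OF S(2) a]
          L_def[symmetric] Q_def[symmetric] P_def[symmetric] .
    qed
  qed (use a in simp)
qed (use a \<gamma> in \<open>auto intro!: psd_kcos psd_ksob\<close>)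

section \<open>The closed form of the cosine series for smoothness 1\<close>

definition sob1 :: "real \<Rightarrow> real \<Rightarrow> real" where
  "sob1 x y = \<beta> 1 x * \<beta> 1 y + \<beta> 2 \<bar>x - y\<bar>"

lemma ksob_1: "ksob 1 \<gamma> x y = 1 + \<gamma> * sob1 x y"
  by (simp add: ksob_def sob1_def)

lemma sob1_form:
  assumes S: "S \<subseteq> {0..1}"
  shows "(\<Sum>x\<in>S. \<Sum>y\<in>S. c x * c y * sob1 x y) = (lin S c (\<beta> 1))\<^sup>2 + (\<integral>t. (pbern_lin 1 S c t)\<^sup>2 \<partial>U)"
  unfolding integral_pbern_lin_sq[OF S order_refl] lin_def rank1_form[symmetric] sob1_def
  by (simp add: sum.distrib distrib_left)

lemma psd_sob1: "psd_on {0..1} sob1"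
proof (rule psd_onI)
  show "sob1 x y = sob1 y x" for x y by (simp add: sob1_def abs_minus_commute mult.commute)
  fix S :: "real set" and c :: "real \<Rightarrow> real" assume "S \<subseteq> {0..1}"
  thus "0 \<le> (\<Sum>x\<in>S. \<Sum>y\<in>S. c x * c y * sob1 x y)" by (simp add: sob1_form)
qed

text \<open>The boundary term is \<open>b\<close> times the integral of the derivative of the
  cosine, so it joins the remainder in a coefficient of \<open>V = b - W\<close>, with
  \<open>W = pbern_lin 1 S c\<close>. As \<open>W\<close> has mean 0, the square of \<open>V\<close>
  integrates to exactly the \<open>sob1\<close> form: no constant is lost.\<close>

lemma sum_decay_cos_1_le:
  assumes S: "S \<subseteq> {0..1}"
  shows "(\<Sum>n<N. decay 1 n * (\<Sum>x\<in>S. \<Sum>y\<in>S. c x * c y * scos n x y)) \<le> (\<Sum>x\<in>S. \<Sum>y\<in>S. c x * c y * (pi\<^sup>2 * sob1 x y))"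
proof -
  define b where "b = lin S c (\<beta> 1)"
  define V where "V t = b - pbern_lin 1 S c t" for t
  define I where "I n = (\<integral>t. V t * cos (pi * real (Suc n) * t + (real 1 * (pi / 2))) \<partial>U)" for n
  have V: "bdd_meas V" unfolding V_def by (intro bdd_meas_diff bdd_meas_const bdd_meas_pbern_lin)
  have summand: "decay 1 n * (\<Sum>x\<in>S. \<Sum>y\<in>S. c x * c y * scos n x y) = pi\<^sup>2 * (2 * (I n)\<^sup>2)" for n
  proof -
    define \<omega> where "\<omega> = pi * real (Suc n)"
    have 0: "(\<integral>t. cos (\<omega> * t + 0) \<partial>U) = 0"
      unfolding \<omega>_def using freq_half(1,3)[of n] by (intro integral_cos_zero) auto
    have 1: "(\<integral>t. \<omega> * cos (\<omega> * t + pi / 2) \<partial>U) = cos (\<omega> * 1) - cos (\<omega> * 0)"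
    proof (rule integral_FTC[of "{}"])
      show "((\<lambda>t. cos (\<omega> * t)) has_real_derivative \<omega> * cos (\<omega> * t + pi / 2)) (at t)" for t
        by (auto intro!: derivative_eq_intros simp: cos_add)
    qed (auto intro!: continuous_intros bdd_meas_mult bdd_meas_const bdd_meas_cos)
    have "I n = (\<integral>t. b * cos (\<omega> * t + pi / 2) - pbern_lin 1 S c t * cos (\<omega> * t + pi / 2) \<partial>U)"
      unfolding I_def V_def \<omega>_def by (simp add: left_diff_distrib)
    also have "\<dots> = (\<integral>t. b * cos (\<omega> * t + pi / 2) \<partial>U) - (\<integral>t. pbern_lin 1 S c t * cos (\<omega> * t + pi / 2) \<partial>U)"
      by (intro Bochner_Integration.integral_diff bdd_meas_integrable bdd_meas_mult bdd_meas_const bdd_meas_pbern_lin bdd_meas_cos)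
    also have "(\<integral>t. b * cos (\<omega> * t + pi / 2) \<partial>U) = b * (\<integral>t. cos (\<omega> * t + pi / 2) \<partial>U)" by simp
    finally have "\<omega> * I n = b * (\<omega> * (\<integral>t. cos (\<omega> * t + pi / 2) \<partial>U)) - \<omega> * (\<integral>t. pbern_lin 1 S c t * cos (\<omega> * t + pi / 2) \<partial>U)"
      by (simp only: right_diff_distrib mult.left_commute)
    also have "\<omega> * (\<integral>t. cos (\<omega> * t + pi / 2) \<partial>U) = (\<integral>t. \<omega> * cos (\<omega> * t + pi / 2) \<partial>U)" by simp
    also have "b * \<dots> - \<omega> * (\<integral>t. pbern_lin 1 S c t * cos (\<omega> * t + pi / 2) \<partial>U) = lin S c (\<lambda>x. cos (\<omega> * x + 0))"
      unfolding lin_cos[OF S order_refl] 0 1 b_def by simp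
    finally have "(lin S c (\<lambda>x. cos (\<omega> * x + 0)))\<^sup>2 = pi\<^sup>2 * (real (Suc n))\<^sup>2 * (I n)\<^sup>2"
      by (simp add: \<omega>_def power_mult_distrib[symmetric])
    moreover have "decay 1 n * (real (Suc n))\<^sup>2 = 1" using decay_nat[of 1 n] by simp
    ultimately show ?thesis unfolding scos_form \<omega>_def by (simp add: algebra_simps)
  qed
  have "(\<integral>t. pbern_lin 1 S c t * 1 \<partial>U) = lin S c (\<lambda>x. \<integral>t. pbern 1 x t * 1 \<partial>U)"
    by (rule integral_pbern_lin) (rule bdd_meas_const)
  also have "\<dots> = 0" unfolding lin_def
    by (intro sum.neutral ballI) (use S integral_pbern[of 1] in auto)
  finally have w0: "(\<integral>t. pbern_lin 1 S c t \<partial>U) = 0" by simp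
  have "(\<integral>t. (V t)\<^sup>2 \<partial>U) = (\<integral>t. (b\<^sup>2 - 2 * b * pbern_lin 1 S c t) + (pbern_lin 1 S c t)\<^sup>2 \<partial>U)"
    unfolding V_def power2_diff by (simp only: diff_add_eq)
  also have "\<dots> = (\<integral>t. b\<^sup>2 - 2 * b * pbern_lin 1 S c t \<partial>U) + (\<integral>t. (pbern_lin 1 S c t)\<^sup>2 \<partial>U)"
    by (intro Bochner_Integration.integral_add bdd_meas_integrable bdd_meas_diff bdd_meas_mult bdd_meas_const bdd_meas_pbern_lin bdd_meas_power2)
  also have "(\<integral>t. b\<^sup>2 - 2 * b * pbern_lin 1 S c t \<partial>U) = (\<integral>t. b\<^sup>2 \<partial>U) - (\<integral>t. 2 * b * pbern_lin 1 S c t \<partial>U)"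
    by (intro Bochner_Integration.integral_diff bdd_meas_integrable bdd_meas_diff bdd_meas_mult bdd_meas_const bdd_meas_pbern_lin bdd_meas_power2)
  also have "\<dots> = b\<^sup>2" unfolding integral_U_const using w0 by simp
  finally have V2: "(\<integral>t. (V t)\<^sup>2 \<partial>U) = b\<^sup>2 + (\<integral>t. (pbern_lin 1 S c t)\<^sup>2 \<partial>U)" .
  have "(\<Sum>n<N. decay 1 n * (\<Sum>x\<in>S. \<Sum>y\<in>S. c x * c y * scos n x y)) = pi\<^sup>2 * (\<Sum>n<N. 2 * (I n)\<^sup>2)"
    unfolding summand by (simp only: sum_distrib_left)
  also have "(\<Sum>n<N. 2 * (I n)\<^sup>2) \<le> (\<integral>t. (V t)\<^sup>2 \<partial>U)"
    unfolding I_def by (intro bessel_cos V freq_half)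
  finally show ?thesis unfolding scaled_form sob1_form[OF S] V2 b_def by simp
qed

text \<open>The difference of the two sides is a positive semidefinite kernel by Bessel's inequality;
  its diagonal is continuous, nonnegative and has integral 0, so it vanishes identically.\<close>

lemma cos_series_1:
  assumes x: "x \<in> {0..1}" and y: "y \<in> {0..1}"
  shows "(\<Sum>n. decay 1 n * scos n x y) = pi\<^sup>2 * sob1 x y"
proof -
  define T where "T x y = pi\<^sup>2 * sob1 x y - (\<Sum>n. decay 1 n * scos n x y)" for x y
  have T: "psd_on {0..1} T"
  proof (rule psd_on_LIMSEQ)
    show "psd_on {0..1} (\<lambda>x y. pi\<^sup>2 * sob1 x y - (\<Sum>n<N. decay 1 n * scos n x y))" for N
    proof (rule psd_on_diffI)
      fix S :: "real set" and c :: "real \<Rightarrow> real" assume S: "finite S" "S \<subseteq> {0..1}"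
      have "(\<Sum>x\<in>S. \<Sum>y\<in>S. c x * c y * (\<Sum>n<N. decay 1 n * scos n x y)) =
        (\<Sum>n<N. decay 1 n * (\<Sum>x\<in>S. \<Sum>y\<in>S. c x * c y * scos n x y))"
        using series_form[of c 1 "decay 1" scos N S] rank1_form[of c "\<lambda>_. 1" S]
        by (simp add: lin_def distrib_left sum.distrib)
      thus "(\<Sum>x\<in>S. \<Sum>y\<in>S. c x * c y * (\<Sum>n<N. decay 1 n * scos n x y)) \<le> (\<Sum>x\<in>S. \<Sum>y\<in>S. c x * c y * (pi\<^sup>2 * sob1 x y))"
        using sum_decay_cos_1_le[OF S(2), where N = N and c = c] by simp
    qed (auto intro!: psd_on_scale psd_on_sum psd_sob1 psd_scos decay_nonneg)
    show "(\<lambda>N. pi\<^sup>2 * sob1 x y - (\<Sum>n<N. decay 1 n * scos n x y)) \<longlonglongrightarrow> T x y" for x y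
      using kcos_sums[of 1 x y] unfolding sums_def T_def by (intro tendsto_intros) simp
  qed
  define d where "d x = T x x" for x
  have d_nonneg: "0 \<le> d x" if "x \<in> {0..1}" for x
    using psd_on_ge0[OF T, of "{x}" "\<lambda>_. 1"] that by (simp add: d_def)
  have d_alt: "d x = pi\<^sup>2 * ((x - 1/2)\<^sup>2 + 1/12) - (\<Sum>n. decay 1 n * scos n x x)" for x
    by (simp add: d_def T_def sob1_def \<beta>_1 \<beta>_2 power2_eq_square)
  \<comment> \<open>Continuity of the diagonal is needed to pass from a vanishing integral to
    vanishing at every point.\<close>
  have "uniform_limit UNIV (\<lambda>N x. \<Sum>n<N. decay 1 n * scos n x x) (\<lambda>x. \<Sum>n. decay 1 n * scos n x x) sequentially"
  proof (rule Weierstrass_m_test)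
    show "norm (decay 1 n * scos n x x) \<le> decay 1 n * 2" for n x
      using scos_bound[of n x x] decay_nonneg[of 1 n] by (simp add: abs_mult mult_left_mono)
    show "summable (\<lambda>n. decay 1 n * 2)" by (intro summable_mult2 decay_summable) simp
  qed
  hence "continuous_on UNIV (\<lambda>x. \<Sum>n. decay 1 n * scos n x x)"
    by (rule uniform_limit_theorem[rotated]) (auto simp: scos_def intro!: continuous_intros always_eventually)
  hence d_cont: "continuous_on UNIV d" unfolding d_alt[abs_def] by (intro continuous_intros)
  \<comment> \<open>Each \<open>scos n x x\<close> has integral 1, so the trace of the difference is
    \<open>pi^2 / 6\<close> minus a partial sum of the Basel series.\<close>
  have int_le: "integral\<^sup>L U d \<le> pi\<^sup>2 * (1 / 6) - (\<Sum>n<N. 1 / (real (Suc n))\<^sup>2)" for N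
  proof -
    have q: "(\<integral>x. (x - 1/2)\<^sup>2 + 1/12 \<partial>U) = 1 / 6"
    proof -
      have "(\<integral>x. (x - 1/2)\<^sup>2 + 1/12 \<partial>U) = ((1 - 1/2) ^ 3 / 3 + 1 / 12) - ((0 - 1/2) ^ 3 / 3 + 0 / 12 :: real)"
        by (rule integral_FTC[of "{}"])
           (auto intro!: continuous_intros derivative_eq_intros bdd_meas_continuous simp: power2_eq_square)
      also have "\<dots> = 1 / 6" by (simp add: power3_eq_cube)
      finally show ?thesis .
    qed
    have sc: "(\<integral>x. scos n x x \<partial>U) = 1" for n
    proof -
      have "scos n x x = (sqrt 2 * cos (pi * real (Suc n) * x + 0)) * (sqrt 2 * cos (pi * real (Suc n) * x + 0))" for x
        by (simp add: scos_def)
      thus ?thesis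
        using orthonormal_cos[OF freq_half(1) freq_half(2) freq_half(4), of "real 0 * (pi / 2)" n n] freq_half(5)[of _ _ 0]
        by simp
    qed
    have bs: "bdd_meas (\<lambda>x. scos n x x)" for n unfolding scos_def by (intro bdd_meas_continuous continuous_intros)
    have "integral\<^sup>L U d \<le> (\<integral>x. pi\<^sup>2 * ((x - 1/2)\<^sup>2 + 1/12) - (\<Sum>n<N. decay 1 n * scos n x x) \<partial>U)"
    proof (rule integral_mono)
      show "d x \<le> pi\<^sup>2 * ((x - 1/2)\<^sup>2 + 1/12) - (\<Sum>n<N. decay 1 n * scos n x x)" for x
        unfolding d_alt using kcos_sums[of 1 x x]
        by (intro diff_left_mono sum_le_suminf) (auto simp: sums_iff scos_def decay_nonneg)
    qed (intro bdd_meas_integrable bdd_meas_continuous d_cont,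
         intro bdd_meas_integrable bdd_meas_diff bdd_meas_mult bdd_meas_const bdd_meas_sum bs bdd_meas_continuous continuous_intros)
    also have "\<dots> = (\<integral>x. pi\<^sup>2 * ((x - 1/2)\<^sup>2 + 1/12) \<partial>U) - (\<integral>x. (\<Sum>n<N. decay 1 n * scos n x x) \<partial>U)"
      by (intro Bochner_Integration.integral_diff bdd_meas_integrable bdd_meas_mult bdd_meas_const bdd_meas_sum bs bdd_meas_continuous continuous_intros)
    also have "(\<integral>x. (\<Sum>n<N. decay 1 n * scos n x x) \<partial>U) = (\<Sum>n<N. \<integral>x. decay 1 n * scos n x x \<partial>U)"
      by (intro Bochner_Integration.integral_sum bdd_meas_integrable bdd_meas_mult bdd_meas_const bs)
    finally show ?thesis using q sc decay_nat[of 1] by simp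
  qed
  have "(\<lambda>N. pi\<^sup>2 * (1 / 6) - (\<Sum>n<N. 1 / (real (Suc n))\<^sup>2)) \<longlonglongrightarrow> pi\<^sup>2 * (1 / 6) - pi\<^sup>2 / 6"
    using inverse_squares_sums unfolding sums_def by (intro tendsto_intros) (simp add: add.commute)
  hence "integral\<^sup>L U d \<le> pi\<^sup>2 * (1 / 6) - pi\<^sup>2 / 6"
    by (rule LIMSEQ_le_const) (use int_le in auto)
  hence le0: "integral\<^sup>L U d \<le> 0" by simp
  have d_int: "(d has_integral integral {0..1} d) {0..1}"
    by (intro integrable_integral integrable_continuous_real continuous_on_subset[OF d_cont]) auto
  hence "integral\<^sup>L U d = integral {0..1} d" by (intro bdd_meas_has_integral bdd_meas_continuous d_cont)
  moreover have "0 \<le> integral {0..1} d"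
    using d_int d_nonneg by (intro has_integral_nonneg[OF d_int]) auto
  ultimately have "(d has_integral 0) (cbox 0 1)" using d_int le0 by (simp add: cbox_interval)
  hence d0: "d x = 0" if "x \<in> {0..1}" for x
    using that d_nonneg
    by (intro has_integral_0_cbox_imp_0[of 0 1 d x] continuous_on_subset[OF d_cont]) auto
  have "T x y = 0"
  proof (cases "x = y")
    case True
    thus ?thesis using d0[OF x] by (simp add: d_def)
  next
    case False
    \<comment> \<open>With zero diagonal, the coefficients (1, 1) and (1, -1) give the off-diagonal
      entry both signs.\<close>
    have "0 \<le> (\<Sum>u\<in>{x, y}. \<Sum>v\<in>{x, y}. c u * c v * T u v)" for c
      by (rule psd_on_ge0[OF T]) (use x y in auto)
    from this[of "\<lambda>_. 1"] this[of "\<lambda>u. if u = x then 1 else -1"]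
    show ?thesis using False d0[OF x] d0[OF y] psd_on_sym[OF T x y] by (simp add: d_def)
  qed
  thus ?thesis by (simp add: T_def)
qed

text \<open>By the closed form the difference of the kernels is
  \<open>\<gamma> * (pi^2 - 1) * sob1\<close>, so the constant 1 works.\<close>

lemma ksob_1_dominated_kcos:
  assumes "\<gamma> > 0"
  shows "dominated_on {0..1} (ksob 1 \<gamma>) (kcos 1 \<gamma>)"
proof (rule dominated_onI[of _ _ _ 1])
  have "1 \<le> pi\<^sup>2" using pi_gt3 by (simp add: one_le_power)
  hence "psd_on {0..1} (\<lambda>x y. (\<gamma> * (pi\<^sup>2 - 1)) * sob1 x y)"
    using assms by (intro psd_on_scale psd_sob1) auto
  thus "psd_on {0..1} (\<lambda>x y. 1 * kcos 1 \<gamma> x y - ksob 1 \<gamma> x y)"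
    by (rule psd_on_cong[THEN iffD1, rotated])
       (simp add: kcos_def cos_series_1 ksob_1[unfolded One_nat_def] algebra_simps)
qed (use assms in \<open>auto intro!: psd_ksob psd_kcos\<close>)

section \<open>Non-inclusions\<close>

lemma one_minus_cos_le: "1 - cos u \<le> (u::real)\<^sup>2 / 2"
proof -
  have "\<bar>sin (u / 2)\<bar>\<^sup>2 \<le> \<bar>u / 2\<bar>\<^sup>2" by (intro power_mono abs_sin_x_le_abs_x) auto
  moreover have "cos u = 1 - 2 * (sin (u / 2))\<^sup>2" using cos_double_sin[of "u / 2"] by simp
  ultimately show ?thesis by (simp add: power_divide)
qed

text \<open>Coarse scales are bounded trivially, fine scales quadratically; both sums are geometric.
  Splitting off one scale replaces \<open>x\<close> by \<open>x / 2\<close>, and the bound is chosen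
  to reproduce itself: \<open>4 + 2 * (6 * (x / 2) - 4) = 6 * x - 4\<close>.\<close>

lemma dyadic_cos_sum_le:
  fixes x :: real
  assumes "1 \<le> x"
  shows "(\<Sum>i<n. 2 ^ Suc i * (1 - cos (x / 2 ^ Suc i))) \<le> 6 * x - 4"
  using assms
proof (induction n arbitrary: x)
  case (Suc n)
  show ?case
  proof (cases "x \<le> 2")
    case True
    have "(\<Sum>i<Suc n. 2 ^ Suc i * (1 - cos (x / 2 ^ Suc i))) \<le> (\<Sum>i<Suc n. x\<^sup>2 / 4 * (1 / 2) ^ i)"
    proof (rule sum_mono)
      fix i
      have "2 ^ Suc i * (1 - cos (x / 2 ^ Suc i)) \<le> 2 ^ Suc i * ((x / 2 ^ Suc i)\<^sup>2 / 2)"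
        by (intro mult_left_mono one_minus_cos_le) auto
      also have "\<dots> = x\<^sup>2 / 4 * (1 / 2) ^ i" by (simp add: field_simps power2_eq_square)
      finally show "2 ^ Suc i * (1 - cos (x / 2 ^ Suc i)) \<le> x\<^sup>2 / 4 * (1 / 2) ^ i" .
    qed
    also have "\<dots> = x\<^sup>2 / 4 * (\<Sum>i<Suc n. (1 / 2) ^ i)" by (simp only: sum_distrib_left)
    also have "(\<Sum>i<Suc n. (1 / 2 :: real) ^ i) \<le> 2"
      by (subst sum_gp_strict) (auto simp: field_simps)
    also have "x\<^sup>2 / 4 * 2 \<le> x" using True Suc.prems by (simp add: power2_eq_square)
    finally show ?thesis using Suc.prems by (simp add: mult_left_mono)
  next
    case False
    have "(\<Sum>i<Suc n. 2 ^ Suc i * (1 - cos (x / 2 ^ Suc i))) =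
       2 * (1 - cos (x / 2)) + 2 * (\<Sum>i<n. 2 ^ Suc i * (1 - cos ((x / 2) / 2 ^ Suc i)))"
      unfolding sum.lessThan_Suc_shift sum_distrib_left by (simp add: mult.assoc)
    also have "\<dots> \<le> 2 * (1 - - 1) + 2 * (6 * (x / 2) - 4)"
      using False by (intro add_mono mult_left_mono Suc.IH diff_left_mono cos_ge_minus_one) auto
    finally show ?thesis by simp
  qed
qed simp

text \<open>\<open>N * sin (2 * pi / N)\<close> does not decrease when \<open>N\<close> doubles, by
  the double angle formula, and equals 4 at \<open>N = 4\<close>.\<close>

lemma dyadic_sin_ge: "4 \<le> 2 ^ (i + 2) * sin (2 * pi / 2 ^ (i + 2))"
proof (induction i)
  case 0
  thus ?case by (simp add: power2_eq_square)
next
  case (Suc i)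
  define v where "v = 2 * pi / 2 ^ (Suc i + 2)"
  have "(4::real) \<le> 2 ^ (Suc i + 2)" using power_increasing[of 2 "Suc i + 2" "2::real"] by simp
  hence "2 * pi / 2 ^ (Suc i + 2) \<le> 2 * pi / 4" by (intro divide_left_mono) auto
  hence "v \<le> 2 * pi / 4" unfolding v_def .
  hence v: "0 \<le> v" "v \<le> pi" using pi_gt_zero by (simp add: v_def, linarith)
  have "4 \<le> 2 ^ (i + 2) * sin (2 * v)" using Suc by (simp add: v_def)
  also have "\<dots> = 2 ^ (Suc i + 2) * sin v * cos v" by (simp add: sin_double)
  also have "\<dots> \<le> 2 ^ (Suc i + 2) * sin v * 1"
    by (intro mult_left_mono cos_le_one mult_nonneg_nonneg sin_ge_zero v) auto
  finally show ?case by (simp add: v_def)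
qed

text \<open>\<open>cos_series_1\<close> at (0, 0) minus (t, 0). The value is at most
  \<open>pi^2 * t / 2\<close>, so the weight \<open>1 / t\<close> of a dyadic scale leaves a bounded
  contribution.\<close>

lemma decay_1_one_minus_cos_sums:
  assumes t: "t \<in> {0..1}"
  shows "(\<lambda>n. decay 1 n * (1 - cos (pi * real (Suc n) * t))) sums (pi\<^sup>2 * (t / 2 - t\<^sup>2 / 4))"
proof -
  have "(\<lambda>n. (decay 1 n * scos n 0 0 - decay 1 n * scos n t 0) / 2) sums ((pi\<^sup>2 * sob1 0 0 - pi\<^sup>2 * sob1 t 0) / 2)"
    using kcos_sums[of 1 0 0] kcos_sums[of 1 t 0] t
    by (intro sums_divide sums_diff) (simp_all add: cos_series_1)
  also have "(\<lambda>n. (decay 1 n * scos n 0 0 - decay 1 n * scos n t 0) / 2) = (\<lambda>n. decay 1 n * (1 - cos (pi * real (Suc n) * t)))"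
    by (simp add: scos_def fun_eq_iff field_simps)
  also have "(pi\<^sup>2 * sob1 0 0 - pi\<^sup>2 * sob1 t 0) / 2 = pi\<^sup>2 * (t / 2 - t\<^sup>2 / 4)"
    using t by (simp add: sob1_def \<beta>_1 \<beta>_2 field_simps power2_eq_square)
  finally show ?thesis .
qed

text \<open>The threshold 3/2 enters here: one power of the frequency is given away and the decay of
  smoothness 1 must remain.\<close>

lemma decay_le:
  assumes "\<alpha> \<ge> 3/2"
  shows "decay \<alpha> n * real (Suc n) \<le> decay 1 n"
proof -
  have "decay \<alpha> n * real (Suc n) = real (Suc n) powr (- 2 * \<alpha> + 1)"
    unfolding decay_def powr_add by simp
  also have "\<dots> \<le> real (Suc n) powr (- 2 * 1)" using assms by (intro powr_mono) auto
  finally show ?thesis by (simp add: decay_def)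
qed

text \<open>The test functional is \<open>\<Sum>i. 2\<^sup>i (\<delta>\<^bsub>2\<^sup>-\<^sup>i\<^esub> - \<delta>\<^bsub>0\<^esub>)\<close>, a sum of difference quotients at 0 over
  dyadic scales. Its squared norm in the cosine space grows only linearly in the number of scales,
  while its square on the sine grows quadratically.\<close>

lemma kcos_no_sine_bound:
  assumes \<alpha>: "\<alpha> \<ge> 3/2" and \<gamma>: "\<gamma> > 0"
  shows "\<exists>S c. finite S \<and> S \<subseteq> {0..1} \<and>
    M * (\<Sum>x\<in>S. \<Sum>y\<in>S. c x * c y * kcos \<alpha> \<gamma> x y) < (lin S c (\<lambda>x. sin (2 * pi * x)))\<^sup>2"
proof -
  \<comment> \<open>\<open>C * real m\<close> bounds \<open>M\<close> times the squared norm of the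
    functional with \<open>m\<close> scales.\<close>
  define C where "C = \<bar>M\<bar> * (6 * pi ^ 3 * \<gamma>)"
  obtain n where n: "C < real n" using reals_Archimedean2 by blast
  \<comment> \<open>The scale 1/2 contributes nothing since \<open>sin pi = 0\<close>; the remaining
    \<open>n + 1\<close> scales contribute at least 4 each.\<close>
  define m where "m = n + 2"
  define pt :: "nat \<Rightarrow> real" where "pt i = 1 / 2 ^ Suc i" for i
  define S where "S = insert 0 (pt ` {..<m})"
  define c where "c t = (if t = 0 then - (\<Sum>i<m. 2 ^ Suc i) else 1 / t)" for t :: real
  have pt: "0 < pt i" "pt i \<le> 1" for i
    using one_le_power[of "2::real" "Suc i"] by (auto simp: pt_def divide_le_eq)
  have S: "finite S" "S \<subseteq> {0..1}" using pt by (auto simp: S_def less_imp_le)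
  have inj: "inj_on pt {..<m}" by (auto simp: inj_on_def pt_def)
  have lin: "lin S c g = (\<Sum>i<m. 2 ^ Suc i * (g (pt i) - g 0))" for g
  proof -
    have "0 \<notin> pt ` {..<m}" using pt by (auto simp: less_le)
    hence "lin S c g = c 0 * g 0 + (\<Sum>i<m. c (pt i) * g (pt i))"
      unfolding lin_def S_def by (simp add: sum.reindex[OF inj])
    also have "(\<Sum>i<m. c (pt i) * g (pt i)) = (\<Sum>i<m. 2 ^ Suc i * g (pt i))"
      by (intro sum.cong refl) (simp add: c_def pt_def)
    also have "c 0 = - (\<Sum>i<m. 2 ^ Suc i)" by (simp add: c_def)
    finally show ?thesis by (simp add: right_diff_distrib sum_subtractf sum_distrib_right)
  qed
  define A where "A k = (\<Sum>i<m. 2 ^ Suc i * (1 - cos (pi * real (Suc k) * pt i)))" for k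
  have A: "0 \<le> A k" "A k \<le> 6 * pi * real (Suc k)" for k
  proof -
    show "0 \<le> A k" unfolding A_def by (intro sum_nonneg mult_nonneg_nonneg) auto
    have "pi * 1 \<le> pi * real (Suc k)" by (intro mult_left_mono) auto
    hence "1 \<le> pi * real (Suc k)" using pi_gt3 by linarith
    from dyadic_cos_sum_le[OF this, of m] show "A k \<le> 6 * pi * real (Suc k)"
      unfolding A_def pt_def by simp
  qed
  have lincos: "lin S c (\<lambda>x. cos (pi * real (Suc k) * x + 0)) = - A k" for k
    unfolding lin A_def sum_negf[symmetric] by (intro sum.cong refl) (simp add: algebra_simps)
  have lin1: "lin S c (\<lambda>_. 1) = 0" unfolding lin by simp
  have part: "(\<Sum>x\<in>S. \<Sum>y\<in>S. c x * c y * (1 + \<gamma> * (\<Sum>k<N. decay \<alpha> k * scos k x y))) \<le> 6 * pi ^ 3 * \<gamma> * real m" for N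
  proof -
    \<comment> \<open>One factor \<open>A k\<close> is bounded by a multiple of the frequency and
      absorbed by \<open>decay_le\<close>; the other is kept, so that its series can be
      summed.\<close>
    have "decay \<alpha> k * (2 * (- A k)\<^sup>2) \<le> 12 * pi * (decay 1 k * A k)" for k
    proof -
      have "decay \<alpha> k * (2 * (- A k)\<^sup>2) = 2 * (decay \<alpha> k * A k) * A k" by (simp add: power2_eq_square)
      also have "\<dots> \<le> 2 * (decay \<alpha> k * A k) * (6 * pi * real (Suc k))"
        using A[of k] decay_nonneg[of \<alpha> k] by (intro mult_left_mono) auto
      also have "\<dots> = 12 * pi * A k * (decay \<alpha> k * real (Suc k))" by simp
      also have "\<dots> \<le> 12 * pi * A k * decay 1 k"
        using A[of k] by (intro mult_left_mono decay_le \<alpha>) auto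
      finally show ?thesis by (simp add: mult_ac)
    qed
    hence "(\<Sum>k<N. decay \<alpha> k * (2 * (- A k)\<^sup>2)) \<le> (\<Sum>k<N. 12 * pi * (decay 1 k * A k))" by (rule sum_mono)
    \<comment> \<open>After exchanging the sums, each scale contributes at most
      \<open>pi^2 / 2\<close>, hence linear growth in \<open>m\<close>.\<close>
    also have "\<dots> = 12 * pi * (\<Sum>i<m. 2 ^ Suc i * (\<Sum>k<N. decay 1 k * (1 - cos (pi * real (Suc k) * pt i))))"
      unfolding A_def sum_distrib_left by (subst sum.swap) (simp add: mult_ac)
    also have "\<dots> \<le> 12 * pi * (\<Sum>i<m. pi\<^sup>2 / 2)"
    proof (intro mult_left_mono sum_mono)
      fix i
      have "(\<Sum>k<N. decay 1 k * (1 - cos (pi * real (Suc k) * pt i))) \<le> pi\<^sup>2 * (pt i / 2 - (pt i)\<^sup>2 / 4)"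
        using decay_1_one_minus_cos_sums[of "pt i"] pt[of i]
        by (metis (no_types, lifting) atLeastAtMost_iff diff_ge_0_iff_ge cos_le_one finite_lessThan
            less_imp_le mult_nonneg_nonneg decay_nonneg sum_le_suminf sums_iff)
      also have "\<dots> \<le> pi\<^sup>2 * (pt i / 2)" by (intro mult_left_mono) auto
      finally have "2 ^ Suc i * (\<Sum>k<N. decay 1 k * (1 - cos (pi * real (Suc k) * pt i))) \<le> 2 ^ Suc i * (pi\<^sup>2 * (pt i / 2))"
        by (intro mult_left_mono) auto
      also have "\<dots> = pi\<^sup>2 / 2" by (simp add: pt_def)
      finally show "2 ^ Suc i * (\<Sum>k<N. decay 1 k * (1 - cos (pi * real (Suc k) * pt i))) \<le> pi\<^sup>2 / 2" .
    qed auto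
    also have "\<dots> = 6 * pi ^ 3 * real m" by (simp add: power3_eq_cube power2_eq_square)
    finally have "\<gamma> * (\<Sum>k<N. decay \<alpha> k * (2 * (- A k)\<^sup>2)) \<le> \<gamma> * (6 * pi ^ 3 * real m)"
      using \<gamma> by (intro mult_left_mono) auto
    thus ?thesis unfolding series_form scos_form lincos lin1 by (simp add: mult_ac)
  qed
  define Q where "Q = (\<Sum>x\<in>S. \<Sum>y\<in>S. c x * c y * kcos \<alpha> \<gamma> x y)"
  have Q0: "0 \<le> Q" unfolding Q_def by (rule psd_on_ge0[OF psd_kcos S]) (use \<alpha> \<gamma> in auto)
  have "(\<lambda>N. \<Sum>x\<in>S. \<Sum>y\<in>S. c x * c y * (1 + \<gamma> * (\<Sum>k<N. decay \<alpha> k * scos k x y))) \<longlonglongrightarrow> Q"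
    unfolding Q_def kcos_def
    by (intro tendsto_intros kcos_sums[unfolded sums_def]) (use \<alpha> in auto)
  hence Qle: "Q \<le> 6 * pi ^ 3 * \<gamma> * real m"
    by (rule LIMSEQ_le_const2) (use part in auto)
  have "M * Q \<le> \<bar>M\<bar> * Q" using Q0 by (intro mult_right_mono) auto
  also have "\<dots> \<le> \<bar>M\<bar> * (6 * pi ^ 3 * \<gamma> * real m)" by (intro mult_left_mono Qle) auto
  also have "\<dots> = C * real m" by (simp add: C_def)
  also have "\<dots> \<le> real n * real m" using n by (intro mult_right_mono) auto
  also have "\<dots> < (4 * real (n + 1))\<^sup>2" unfolding m_def by (simp add: power2_eq_square algebra_simps add_pos_nonneg)
  also have "\<dots> \<le> (lin S c (\<lambda>x. sin (2 * pi * x)))\<^sup>2"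
  proof (intro power_mono)
    have "4 * real (n + 1) = (\<Sum>i<n + 1. 4)" by simp
    also have "\<dots> \<le> (\<Sum>i<n + 1. 2 ^ (i + 2) * sin (2 * pi / 2 ^ (i + 2)))"
      by (intro sum_mono dyadic_sin_ge)
    also have "\<dots> = lin S c (\<lambda>x. sin (2 * pi * x))"
    proof -
      have "m = Suc (n + 1)" by (simp add: m_def)
      thus ?thesis unfolding lin by (simp only: sum.lessThan_Suc_shift) (simp add: pt_def)
    qed
    finally show "4 * real (n + 1) \<le> lin S c (\<lambda>x. sin (2 * pi * x))" .
  qed auto
  finally show ?thesis using S unfolding Q_def by blast
qed

section \<open>Reduction of the non-inclusions to one coordinate\<close>

definition axis_pt :: "real \<Rightarrow> nat \<Rightarrow> real" where
  "axis_pt t = (\<lambda>j. if j = 0 then t else 0)"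

lemma axis_pt_cube: "s \<ge> 1 \<Longrightarrow> t \<in> {0..1} \<Longrightarrow> axis_pt t \<in> unit_cube s"
  by (auto simp: axis_pt_def unit_cube_def)

lemma inj_axis_pt: "inj axis_pt"
  by (auto simp: inj_def axis_pt_def fun_eq_iff)

text \<open>On the first axis a product kernel is its first factor times a constant, so a
  one-dimensional obstruction survives in every dimension.\<close>

lemma prod_axis_pt:
  fixes k :: "nat \<Rightarrow> real \<Rightarrow> real \<Rightarrow> real"
  assumes "s \<ge> 1"
  shows "(\<Prod>j<s. k j (axis_pt t j) (axis_pt u j)) = k 0 t u * (\<Prod>j\<in>{1..<s}. k j 0 0)"
proof -
  have "{..<s} = insert 0 {1..<s}" using assms by auto
  thus ?thesis by (simp add: axis_pt_def)
qed

lemma psd_on_cube: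
  assumes "\<And>j. j < s \<Longrightarrow> psd_on {0..1} (k j)"
  shows "psd_on (unit_cube s) (\<lambda>x y. \<Prod>j<s. k j (x j) (y j))"
  using dominated_on_cube[of s k k] dominated_on_refl assms by (auto simp: dominated_on_def)

lemma kkor_ends:
  assumes "x \<in> {0, 1}" "y \<in> {0, 1}"
  shows "kkor \<alpha> \<gamma> x y = kkor \<alpha> \<gamma> 0 0"
proof -
  have "cos (2 * pi * real (Suc n)) = 1" for n
    using cos_2npi[of "Suc n"] by (simp only: mult_ac)
  hence "skor n x y = skor n 0 0" for n
    using assms unfolding skor_def by (auto simp del: of_nat_Suc)
  thus ?thesis by (simp add: kkor_def)
qed

text \<open>The difference of the evaluations at \<open>p\<close> and \<open>q\<close> has norm 0
  for the Korobov kernel by periodicity, so it must annihilate every function of that space; on the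
  section of \<open>k\<close> at \<open>q\<close> it does not vanish.\<close>

lemma not_subset_kkor:
  fixes k :: "nat \<Rightarrow> real \<Rightarrow> real \<Rightarrow> real"
  assumes s: "s \<ge> 1" and \<gamma>: "\<And>j. j < s \<Longrightarrow> \<gamma> j > 0" and \<alpha>: "\<alpha> > 1/2"
    and k: "\<And>j. j < s \<Longrightarrow> psd_on {0..1} (k j)" "\<And>j. j < s \<Longrightarrow> k j 0 0 \<noteq> 0" "k 0 1 0 \<noteq> k 0 0 0"
  shows "rkhs_not_subset (\<lambda>x y. complex_of_real (\<Prod>j<s. k j (x j) (y j)))
    (\<lambda>x y. complex_of_real (\<Prod>j<s. kkor \<alpha> (\<gamma> j) (x j) (y j))) (unit_cube s)"
proof -
  let ?X = "unit_cube s"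
  define p q where "p = axis_pt 1" and "q = axis_pt 0"
  have pq: "p \<in> ?X" "q \<in> ?X" "p \<noteq> q" unfolding p_def q_def
    using axis_pt_cube[OF s] inj_axis_pt by (auto dest: injD)
  interpret A: psd_kernel ?X "\<lambda>x y. \<Prod>j<s. k j (x j) (y j)"
    by unfold_locales (intro psd_on_cube k)
  interpret B: psd_kernel ?X "\<lambda>x y. \<Prod>j<s. kkor \<alpha> (\<gamma> j) (x j) (y j)"
    by unfold_locales (intro psd_on_cube psd_kkor \<alpha>, use \<gamma> in \<open>auto intro: less_imp_le\<close>)
  define f where "f x = A.K x q" for x
  have "f \<in> rkhs A.K ?X" unfolding f_def by (rule A.section_mem_rkhs) (rule pq)
  moreover have "f \<notin> rkhs B.K ?X"
  proof
    assume "f \<in> rkhs B.K ?X"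
    then obtain M where M: "\<And>S c. finite S \<Longrightarrow> S \<subseteq> ?X \<Longrightarrow>
      (\<Sum>x\<in>S. c x * Re (f x))\<^sup>2 \<le> M * (\<Sum>x\<in>S. \<Sum>y\<in>S. c x * c y * (\<Prod>j<s. kkor \<alpha> (\<gamma> j) (x j) (y j)))"
      by (rule B.rkhs_real_bound) blast
    define c where "c x = (if x = p then 1 else -1 :: real)" for x
    have const: "(\<Prod>j<s. kkor \<alpha> (\<gamma> j) (x j) (y j)) = (\<Prod>j<s. kkor \<alpha> (\<gamma> j) 0 0)" if "x \<in> {p, q}" "y \<in> {p, q}" for x y
      by (intro prod.cong refl kkor_ends) (use that in \<open>auto simp: p_def q_def axis_pt_def split: if_splits\<close>)
    have "(\<Sum>x\<in>{p, q}. c x * Re (f x))\<^sup>2 \<le>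
        M * (\<Sum>x\<in>{p, q}. \<Sum>y\<in>{p, q}. c x * c y * (\<Prod>j<s. kkor \<alpha> (\<gamma> j) (x j) (y j)))"
      by (rule M) (use pq in auto)
    also have "(\<Sum>x\<in>{p, q}. \<Sum>y\<in>{p, q}. c x * c y * (\<Prod>j<s. kkor \<alpha> (\<gamma> j) (x j) (y j))) =
        (\<Sum>x\<in>{p, q}. \<Sum>y\<in>{p, q}. c x * c y * (\<Prod>j<s. kkor \<alpha> (\<gamma> j) 0 0))"
      by (intro sum.cong refl) (simp only: const)
    also have "\<dots> = 0" using pq(3) by (simp add: c_def)
    finally have "Re (f p) = Re (f q)" using pq(3) by (simp add: c_def)
    hence "k 0 1 0 * (\<Prod>j\<in>{1..<s}. k j 0 0) = k 0 0 0 * (\<Prod>j\<in>{1..<s}. k j 0 0)"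
      unfolding f_def p_def q_def prod_axis_pt[OF s] by (simp only: Re_complex_of_real)
    moreover have "(\<Prod>j\<in>{1..<s}. k j 0 0) \<noteq> 0" using k(2) by simp
    ultimately show False using k(3) by simp
  qed
  ultimately show ?thesis unfolding rkhs_not_subset_def by blast
qed

lemma kcos_0:
  assumes "\<alpha> > 1/2" "\<gamma> > 0"
  shows "1 \<le> kcos \<alpha> \<gamma> 0 0" "kcos \<alpha> \<gamma> 1 0 < kcos \<alpha> \<gamma> 0 0"
proof -
  have "0 \<le> (\<Sum>n. decay \<alpha> n * scos n 0 0)"
    by (rule suminf_nonneg[OF sums_summable[OF kcos_sums[OF assms(1)]]]) (simp add: scos_def decay_nonneg)
  thus "1 \<le> kcos \<alpha> \<gamma> 0 0" using assms by (simp add: kcos_def)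
  \<comment> \<open>All terms are nonnegative, and the lowest frequency, where the cosine is -1 at
    the point 1, makes the inequality strict.\<close>
  define g where "g n = decay \<alpha> n * scos n 0 0 - decay \<alpha> n * scos n 1 0" for n
  have g: "g sums ((\<Sum>n. decay \<alpha> n * scos n 0 0) - (\<Sum>n. decay \<alpha> n * scos n 1 0))"
    unfolding g_def by (intro sums_diff kcos_sums assms)
  have g_nonneg: "0 \<le> g n" for n
    unfolding g_def right_diff_distrib[symmetric] using decay_nonneg[of \<alpha> n] by (simp add: scos_def)
  have "sum g {0} \<le> suminf g" using g g_nonneg by (intro sum_le_suminf) (auto simp: sums_iff)
  moreover have "g 0 = 4" by (simp add: g_def decay_def scos_def)
  ultimately have "(\<Sum>n. decay \<alpha> n * scos n 1 0) < (\<Sum>n. decay \<alpha> n * scos n 0 0)" using g by (simp add: sums_iff)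
  thus "kcos \<alpha> \<gamma> 1 0 < kcos \<alpha> \<gamma> 0 0" using assms by (simp add: kcos_def)
qed

lemma one_dominated_kkor:
  assumes "\<alpha> > 1/2" "\<gamma> > 0"
  shows "dominated_on X (\<lambda>x y. 1) (kkor \<alpha> \<gamma>)"
proof (rule dominated_onI[of _ _ _ 1])
  show "psd_on X (\<lambda>x y. 1 * kkor \<alpha> \<gamma> x y - 1)"
  proof (rule psd_on_LIMSEQ)
    show "psd_on X (\<lambda>x y. \<gamma> * (\<Sum>n<N. decay \<alpha> n * skor n x y))" for N
      using assms by (intro psd_on_scale psd_on_sum psd_skor decay_nonneg) auto
    show "(\<lambda>N. \<gamma> * (\<Sum>n<N. decay \<alpha> n * skor n x y)) \<longlonglongrightarrow> 1 * kkor \<alpha> \<gamma> x y - 1" for x y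
      using kkor_sums[OF assms(1), of x y] unfolding sums_def kkor_def by (auto intro!: tendsto_intros)
  qed
qed (use assms in \<open>auto intro!: psd_on_one psd_kkor\<close>)

text \<open>The term of frequency 1 splits into a cosine and a sine square; removing the sine part,
  which has weight \<open>2 * \<gamma>\<close>, leaves a positive semidefinite kernel.\<close>

lemma sin_dominated_kkor:
  assumes "\<alpha> > 1/2" "\<gamma> > 0"
  shows "dominated_on X (\<lambda>x y. sin (2 * pi * x) * sin (2 * pi * y)) (kkor \<alpha> \<gamma>)"
proof (rule dominated_onI[of _ _ _ "1 / (2 * \<gamma>)"])
  have "psd_on X (\<lambda>x y. kkor \<alpha> \<gamma> x y - 2 * \<gamma> * (sin (2 * pi * x) * sin (2 * pi * y)))"
  proof (rule psd_on_LIMSEQ)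
    show "psd_on X (\<lambda>x y. 1 + \<gamma> * (\<Sum>n<N. decay \<alpha> (Suc n) * skor (Suc n) x y)
        + 2 * \<gamma> * (cos (2 * pi * x) * cos (2 * pi * y)))" for N
      using assms
      by (intro psd_on_add psd_on_one psd_on_scale psd_on_sum psd_skor decay_nonneg psd_on_rank1) auto
    fix x y
    have "(\<lambda>N. 1 + \<gamma> * (\<Sum>n<Suc N. decay \<alpha> n * skor n x y) - 2 * \<gamma> * (sin (2 * pi * x) * sin (2 * pi * y)))
       \<longlonglongrightarrow> kkor \<alpha> \<gamma> x y - 2 * \<gamma> * (sin (2 * pi * x) * sin (2 * pi * y))"
      unfolding kkor_def
      by (intro tendsto_intros LIMSEQ_Suc kkor_sums[unfolded sums_def] assms)
    moreover have "skor 0 x y = 2 * (cos (2 * pi * x) * cos (2 * pi * y)) + 2 * (sin (2 * pi * x) * sin (2 * pi * y))"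
      by (simp add: skor_def right_diff_distrib cos_diff)
    moreover have "decay \<alpha> 0 = 1" by (simp add: decay_def)
    ultimately show "(\<lambda>N. 1 + \<gamma> * (\<Sum>n<N. decay \<alpha> (Suc n) * skor (Suc n) x y)
        + 2 * \<gamma> * (cos (2 * pi * x) * cos (2 * pi * y))) \<longlonglongrightarrow>
        kkor \<alpha> \<gamma> x y - 2 * \<gamma> * (sin (2 * pi * x) * sin (2 * pi * y))"
      unfolding sum.lessThan_Suc_shift by (simp add: algebra_simps)
  qed
  hence "psd_on X (\<lambda>x y. 1 / (2 * \<gamma>) * (kkor \<alpha> \<gamma> x y - 2 * \<gamma> * (sin (2 * pi * x) * sin (2 * pi * y))))"
    using assms by (intro psd_on_scale) auto
  thus "psd_on X (\<lambda>x y. 1 / (2 * \<gamma>) * kkor \<alpha> \<gamma> x y - sin (2 * pi * x) * sin (2 * pi * y))"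
    using assms(2) by (simp add: right_diff_distrib)
qed (use assms in \<open>auto intro!: psd_on_rank1 psd_kkor\<close>)

text \<open>The witness is the sine in the first coordinate, constant in the others. It is a section
  of a product of rank one kernels dominated by the Korobov product.\<close>

lemma kkor_not_subset_kcos:
  assumes s: "s \<ge> 1" and \<gamma>: "\<And>j. j < s \<Longrightarrow> \<gamma> j > 0" and \<alpha>: "\<alpha> \<ge> 3/2"
  shows "rkhs_not_subset (\<lambda>x y. complex_of_real (\<Prod>j<s. kkor \<alpha> (\<gamma> j) (x j) (y j)))
    (\<lambda>x y. complex_of_real (\<Prod>j<s. kcos \<alpha> (\<gamma> j) (x j) (y j))) (unit_cube s)"
proof -
  let ?X = "unit_cube s"
  let ?K = "\<lambda>x y. complex_of_real (\<Prod>j<s. kkor \<alpha> (\<gamma> j) (x j) (y j))"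
  have \<alpha>2: "\<alpha> > 1/2" using \<alpha> by simp
  define l where "l j = (if j = 0 then (\<lambda>x y. sin (2 * pi * x) * sin (2 * pi * y)) else (\<lambda>x y. 1))" for j :: nat
  have dom: "dominated_on {0..1} (l j) (kkor \<alpha> (\<gamma> j))" if "j < s" for j
    using sin_dominated_kkor[OF \<alpha>2 \<gamma>[OF that]] one_dominated_kkor[OF \<alpha>2 \<gamma>[OF that]]
    by (cases "j = 0") (auto simp: l_def)
  interpret L: psd_kernel ?X "\<lambda>x y. \<Prod>j<s. l j (x j) (y j)"
    by unfold_locales (rule psd_on_cube, use dom in \<open>auto simp: dominated_on_def\<close>)
  interpret B: psd_kernel ?X "\<lambda>x y. \<Prod>j<s. kcos \<alpha> (\<gamma> j) (x j) (y j)"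
    by unfold_locales (intro psd_on_cube psd_kcos \<alpha>2, use \<gamma> in \<open>auto intro: less_imp_le\<close>)
  \<comment> \<open>At 1/4 the sine equals 1, so the section is the sine itself on the first
    axis.\<close>
  define f where "f x = L.K x (axis_pt (1/4))" for x
  have f_axis: "f (axis_pt t) = complex_of_real (sin (2 * pi * t))" for t
  proof -
    have "(\<Prod>j\<in>{1..<s}. l j 0 0) = 1" by (rule prod.neutral) (auto simp: l_def)
    moreover have "2 * pi * (1 / 4) = pi / 2" by simp
    ultimately show ?thesis unfolding f_def prod_axis_pt[OF s] by (simp add: l_def)
  qed
  have "f \<in> rkhs L.K ?X" unfolding f_def by (rule L.section_mem_rkhs) (rule axis_pt_cube[OF s], simp)
  moreover have "rkhs L.K ?X \<subseteq> rkhs ?K ?X"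
    using rkhs_embeds_of_dominated_on[OF dominated_on_cube[OF dom]] by (simp add: rkhs_embeds_def)
  ultimately have "f \<in> rkhs ?K ?X" by blast
  moreover have "f \<notin> rkhs B.K ?X"
  proof
    assume "f \<in> rkhs B.K ?X"
    then obtain M where M: "\<And>S c. finite S \<Longrightarrow> S \<subseteq> ?X \<Longrightarrow>
      (\<Sum>x\<in>S. c x * Re (f x))\<^sup>2 \<le> M * (\<Sum>x\<in>S. \<Sum>y\<in>S. c x * c y * (\<Prod>j<s. kcos \<alpha> (\<gamma> j) (x j) (y j)))"
      by (rule B.rkhs_real_bound) blast
    define R where "R = (\<Prod>j\<in>{1..<s}. kcos \<alpha> (\<gamma> j) 0 0)"
    obtain S c where S: "finite S" "S \<subseteq> {0..1}" and
      less: "M * R * (\<Sum>x\<in>S. \<Sum>y\<in>S. c x * c y * kcos \<alpha> (\<gamma> 0) x y) < (lin S c (\<lambda>x. sin (2 * pi * x)))\<^sup>2"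
      using kcos_no_sine_bound[OF \<alpha> \<gamma>[of 0], of "M * R"] s by auto
    define c' where "c' x = c (x 0)" for x :: "nat \<Rightarrow> real"
    have inj: "inj_on axis_pt S" using inj_axis_pt by (rule inj_on_subset) auto
    have c': "c' (axis_pt t) = c t" for t by (simp add: c'_def axis_pt_def)
    have "(\<Sum>x\<in>axis_pt ` S. c' x * Re (f x))\<^sup>2 \<le>
       M * (\<Sum>x\<in>axis_pt ` S. \<Sum>y\<in>axis_pt ` S. c' x * c' y * (\<Prod>j<s. kcos \<alpha> (\<gamma> j) (x j) (y j)))"
      by (rule M) (use S axis_pt_cube[OF s] in auto)
    also have "\<dots> = M * (\<Sum>x\<in>S. \<Sum>y\<in>S. c x * c y * (kcos \<alpha> (\<gamma> 0) x y * R))"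
      by (simp add: sum.reindex[OF inj] c' prod_axis_pt[OF s, of "\<lambda>j. kcos \<alpha> (\<gamma> j)"] R_def)
    also have "\<dots> = M * R * (\<Sum>x\<in>S. \<Sum>y\<in>S. c x * c y * kcos \<alpha> (\<gamma> 0) x y)"
      by (simp add: sum_distrib_left mult_ac)
    also have "(\<Sum>x\<in>axis_pt ` S. c' x * Re (f x)) = lin S c (\<lambda>x. sin (2 * pi * x))"
      by (simp add: sum.reindex[OF inj] c' f_axis lin_def)
    finally show False using less by simp
  qed
  ultimately show ?thesis unfolding rkhs_not_subset_def by blast
qed

section \<open>Transfer to the complex product kernels and conclusion\<close>

lemma rkhs_not_subset_mono:
  "rkhs_embeds K L X \<Longrightarrow> rkhs_not_subset K M X \<Longrightarrow> rkhs_not_subset L M X"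
  by (auto simp: rkhs_embeds_def rkhs_not_subset_def)

lemma prod_kernel_of_real:
  assumes "\<And>g x y. K g x y = complex_of_real (k g x y)"
  shows "prod_kernel K s \<gamma> = (\<lambda>x y. complex_of_real (\<Prod>j<s. k (\<gamma> j) (x j) (y j)))"
  by (simp add: prod_kernel_def assms fun_eq_iff)

lemma prod_kernel_embeds:
  assumes "\<And>g x y. K g x y = complex_of_real (k g x y)" "\<And>g x y. L g x y = complex_of_real (l g x y)"
    and "\<And>j. j < s \<Longrightarrow> dominated_on {0..1} (k (\<gamma> j)) (l (\<gamma> j))"
  shows "rkhs_embeds (prod_kernel K s \<gamma>) (prod_kernel L s \<gamma>) (unit_cube s)"
  unfolding prod_kernel_of_real[of K k, OF assms(1)] prod_kernel_of_real[of L l, OF assms(2)]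
  by (intro rkhs_embeds_of_dominated_on dominated_on_cube[of s "\<lambda>j. k (\<gamma> j)" "\<lambda>j. l (\<gamma> j)"] assms(3))

theorem mainTheorem2:
  fixes s :: nat and \<gamma> :: "nat \<Rightarrow> real"
  assumes "s \<ge> 1" and "\<forall>j<s. \<gamma> j > 0"
  shows
   "(let X = unit_cube s;
         Kkor = (\<lambda>\<alpha>. prod_kernel (K_kor \<alpha>) s \<gamma>);
         Kcos = (\<lambda>\<alpha>. prod_kernel (K_cos \<alpha>) s \<gamma>);
         Kkc  = (\<lambda>\<alpha>. prod_kernel (K_korcos \<alpha>) s \<gamma>);
         Ksob = (\<lambda>a::nat. prod_kernel (K_sob a) s \<gamma>)
     in
     \<comment> \<open>(i) alpha = 1\<close>
     (rkhs_embeds (Kkor 1) (Ksob 1) X \<and>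
      rkhs_equiv (Ksob 1) (Kcos 1) X \<and>
      rkhs_equiv (Kcos 1) (Kkc 1) X \<and>
      rkhs_not_subset (Ksob 1) (Kkor 1) X \<and>
      rkhs_not_subset (Kcos 1) (Kkor 1) X \<and>
      rkhs_not_subset (Kkc 1) (Kkor 1) X) \<and>
     \<comment> \<open>(ii) integer alpha > 1\<close>
     (\<forall>a::nat. a > 1 \<longrightarrow>
        rkhs_embeds (Kkor (real a)) (Kkc (real a)) X \<and>
        rkhs_embeds (Kcos (real a)) (Kkc (real a)) X \<and>
        rkhs_embeds (Kkc (real a)) (Ksob a) X) \<and>
     \<comment> \<open>(iii) real alpha\<close>
     (\<forall>\<alpha>::real. \<alpha> > 1/2 \<longrightarrow>
        rkhs_not_subset (Kcos \<alpha>) (Kkor \<alpha>) X \<and>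
        rkhs_not_subset (Kkc \<alpha>) (Kkor \<alpha>) X) \<and>
     (\<forall>\<alpha>::real. \<alpha> \<ge> 3/2 \<longrightarrow>
        rkhs_not_subset (Kkc \<alpha>) (Kcos \<alpha>) X \<and>
        rkhs_not_subset (Kkor \<alpha>) (Kcos \<alpha>) X))"
proof -
  have \<gamma>: "\<gamma> j > 0" if "j < s" for j using assms that by blast
  have kc_eq: "K_korcos \<alpha> g x y = complex_of_real (kkc \<alpha> g x y)" if "\<alpha> > 1/2" for \<alpha> g x y
    by (simp add: K_korcos_def kkc_def K_kor_eq[OF that] K_cos_eq[OF that])
  note eqs = K_kor_eq K_cos_eq kc_eq K_sob_eq
  have kor_sob: "dominated_on {0..1} (kkor (real a) (\<gamma> j)) (ksob a (\<gamma> j))"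
    and cos_sob: "dominated_on {0..1} (kcos (real a) (\<gamma> j)) (ksob a (\<gamma> j))"
    and kc_sob: "dominated_on {0..1} (kkc (real a) (\<gamma> j)) (ksob a (\<gamma> j))" if "a \<ge> 1" "j < s" for a j
    using kkor_dominated_ksob[OF that(1) \<gamma>[OF that(2)]] kcos_dominated_ksob[OF that(1) \<gamma>[OF that(2)]]
      kkc_dominated[of _ "real a" "\<gamma> j"] that \<gamma>[OF that(2)] by auto
  have sob_cos: "dominated_on {0..1} (ksob 1 (\<gamma> j)) (kcos 1 (\<gamma> j))" if "j < s" for j
    by (rule ksob_1_dominated_kcos) (rule \<gamma>[OF that])
  have kor_kc: "dominated_on {0..1} (kkor \<alpha> (\<gamma> j)) (kkc \<alpha> (\<gamma> j))"
    and cos_kc: "dominated_on {0..1} (kcos \<alpha> (\<gamma> j)) (kkc \<alpha> (\<gamma> j))" if "\<alpha> > 1/2" "j < s" for \<alpha> j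
    using kkor_dominated_kkc[OF that(1)] kcos_dominated_kkc[OF that(1)] \<gamma>[OF that(2)] by (auto intro: less_imp_le)
  have i1: "rkhs_embeds (prod_kernel (K_kor 1) s \<gamma>) (prod_kernel (K_sob 1) s \<gamma>) (unit_cube s)"
    by (rule prod_kernel_embeds[OF eqs(1) eqs(4)]) (use kor_sob[of 1] in auto)
  have i2: "rkhs_equiv (prod_kernel (K_sob 1) s \<gamma>) (prod_kernel (K_cos 1) s \<gamma>) (unit_cube s)"
    unfolding rkhs_equiv_def
    by (intro conjI prod_kernel_embeds[OF eqs(2) eqs(4)] prod_kernel_embeds[OF eqs(4) eqs(2)])
       (use cos_sob[of 1] sob_cos in auto)
  \<comment> \<open>The direction from the sum space to the cosine space passes through the Sobolev
    space of smoothness 1.\<close>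
  have i3: "rkhs_equiv (prod_kernel (K_cos 1) s \<gamma>) (prod_kernel (K_korcos 1) s \<gamma>) (unit_cube s)"
    unfolding rkhs_equiv_def
    by (intro conjI prod_kernel_embeds[OF eqs(2) eqs(3)] prod_kernel_embeds[OF eqs(3) eqs(2)])
       (use cos_kc[of 1] dominated_on_trans[OF kc_sob[of 1] sob_cos] in auto)
  have cos_kor: "rkhs_not_subset (prod_kernel (K_cos \<alpha>) s \<gamma>) (prod_kernel (K_kor \<alpha>) s \<gamma>) (unit_cube s)"
    if \<alpha>: "\<alpha> > 1/2" for \<alpha>
    unfolding prod_kernel_of_real[of "K_cos \<alpha>", OF K_cos_eq[OF \<alpha>]] prod_kernel_of_real[of "K_kor \<alpha>", OF K_kor_eq[OF \<alpha>]]
  proof (rule not_subset_kkor[OF assms(1) \<gamma> \<alpha>, where k = "\<lambda>j. kcos \<alpha> (\<gamma> j)"])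
    show "kcos \<alpha> (\<gamma> 0) 1 0 \<noteq> kcos \<alpha> (\<gamma> 0) 0 0" using kcos_0(2)[OF \<alpha> \<gamma>[of 0]] assms(1) by simp
    fix j assume j: "j < s"
    show "psd_on {0..1} (kcos \<alpha> (\<gamma> j))" using psd_kcos[OF \<alpha>] \<gamma>[OF j] by simp
    show "kcos \<alpha> (\<gamma> j) 0 0 \<noteq> 0" using kcos_0(1)[OF \<alpha> \<gamma>[OF j]] by simp
  qed
  \<comment> \<open>The cosine space lies in the Sobolev space, so its function outside the Korobov
    space serves here too.\<close>
  have sob_kor: "rkhs_not_subset (prod_kernel (K_sob 1) s \<gamma>) (prod_kernel (K_kor 1) s \<gamma>) (unit_cube s)"
    by (rule rkhs_not_subset_mono[OF _ cos_kor]) (use i2 in \<open>auto simp: rkhs_equiv_def\<close>)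
  have kor_cos: "rkhs_not_subset (prod_kernel (K_kor \<alpha>) s \<gamma>) (prod_kernel (K_cos \<alpha>) s \<gamma>) (unit_cube s)"
    if \<alpha>: "\<alpha> \<ge> 3/2" for \<alpha>
  proof -
    have \<alpha>2: "\<alpha> > 1/2" using \<alpha> by simp
    show ?thesis
      unfolding prod_kernel_of_real[of "K_cos \<alpha>", OF K_cos_eq[OF \<alpha>2]] prod_kernel_of_real[of "K_kor \<alpha>", OF K_kor_eq[OF \<alpha>2]]
      by (rule kkor_not_subset_kcos[OF assms(1) \<gamma> \<alpha>])
  qed
  have kor_kc_embeds: "rkhs_embeds (prod_kernel (K_kor \<alpha>) s \<gamma>) (prod_kernel (K_korcos \<alpha>) s \<gamma>) (unit_cube s)"
    if \<alpha>: "\<alpha> > 1/2" for \<alpha>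
    by (rule prod_kernel_embeds[OF K_kor_eq[OF \<alpha>] kc_eq[OF \<alpha>]]) (rule kor_kc[OF \<alpha>])
  have cos_kc_embeds: "rkhs_embeds (prod_kernel (K_cos \<alpha>) s \<gamma>) (prod_kernel (K_korcos \<alpha>) s \<gamma>) (unit_cube s)"
    if \<alpha>: "\<alpha> > 1/2" for \<alpha>
    by (rule prod_kernel_embeds[OF K_cos_eq[OF \<alpha>] kc_eq[OF \<alpha>]]) (rule cos_kc[OF \<alpha>])
  have kc_kor: "rkhs_not_subset (prod_kernel (K_korcos \<alpha>) s \<gamma>) (prod_kernel (K_kor \<alpha>) s \<gamma>) (unit_cube s)"
    if \<alpha>: "\<alpha> > 1/2" for \<alpha>
    by (rule rkhs_not_subset_mono[OF cos_kc_embeds[OF \<alpha>] cos_kor[OF \<alpha>]])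
  have kc_cos: "rkhs_not_subset (prod_kernel (K_korcos \<alpha>) s \<gamma>) (prod_kernel (K_cos \<alpha>) s \<gamma>) (unit_cube s)"
    if \<alpha>: "\<alpha> \<ge> 3/2" for \<alpha>
    by (rule rkhs_not_subset_mono[OF kor_kc_embeds kor_cos[OF \<alpha>]]) (use \<alpha> in simp)
  have kc_sob_embeds: "rkhs_embeds (prod_kernel (K_korcos (real a)) s \<gamma>) (prod_kernel (K_sob a) s \<gamma>) (unit_cube s)"
    if a: "a > 1" for a
    by (rule prod_kernel_embeds[OF kc_eq K_sob_eq]) (use kc_sob[of a] a in auto)
  show ?thesis unfolding Let_def
    by (intro conjI allI impI i1 i2 i3 sob_kor cos_kor kc_kor kor_kc_embeds cos_kc_embeds kc_sob_embeds kc_cos kor_cos) auto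
qed

end
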